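(* Let $a=3$ and let $b\in\{4,5,7,8\}$. Then for every complex number $q$ with $|q|<1$, the series $Z_{3,b}(q)$ converges and $$Z_{3,b}(q)=P_{3,b}(q).$$
   Context: Let $a,b>1$ be coprime integers. Let $\Gamma=\langle a,b\rangle=\{ax+by: x,y\in\mathbb{Z}_{\ge 0}\}$ be the numerical semigroup generated by $a,b$, and let $G=\mathbb{Z}_{\ge 0}\setminus\Gamma$ be its finite set of gaps, of cardinality $(a-1)(b-1)/2$. For an integer $x$ set $$U(x)=1_{x\ge 0}-1_{x\ge a}-1_{x\ge b}+1_{x\ge a+b},$$ where $1_{x\ge c}$ equals $1$ if $x\ge c$ and $0$ otherwise. For $\mathbf{n}=(n_i)_{i\in G}\in\mathbb{Z}^G$ set $$Q(\mathbf{n})=\sum_{i,j\in G}U(j-i)\,n_in_j$$ (sum over all ordered pairs $(i,j)\in G\times G$). For $m\ge 0$ put $(q)_m=\prod_{j=1}^m(1-q^j)$, and use the convention $1/(q)_m=0$ for $m<0$. Define $$Z_{a,b}(q)=\sum_{\mathbf{n}\in\mathbb{Z}^G}q^{Q(\mathbf{n})}\prod_{i\in G}\frac{(q)_{n_i-n_{i-a-b}}}{(q)_{n_i-n_{i-a}}\,(q)_{n_i-n_{i-b}}},$$ where $n_i=0$ for $i<0$. (For $i\in G$, each of $i-a,\,i-b,\,i-a-b$ is either negative or an element of $G$.) A term is zero as soon as one of its denominator indices is negative; thus the sum is supported on those $\mathbf{n}$ with $n_i\ge 0$ for all $i\in G$ and $n_i\ge n_j$ whenever $i,j\in G$ and $i-j\in\Gamma$,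 and for these all numerator indices are nonnegative. For $i\in\mathbb{Z}$ define $$r_{a,b}(i)=\min\{a,\,b,\,\mathrm{dist}(ai,(a+b)\mathbb{Z})\}-1+1_{(a+b)\mathbb{Z}}(i),$$ where $\mathrm{dist}(ai,(a+b)\mathbb{Z})$ is the distance from $ai$ to the closest multiple of $a+b$, and $1_{(a+b)\mathbb{Z}}(i)$ is $1$ if $(a+b)\mid i$ and $0$ otherwise. Define, for $|q|<1$, $$P_{a,b}(q)=\prod_{i\ge 1}(1-q^i)^{-r_{a,b}(i)}.$$ *)

theory Defs
  imports "HOL-Analysis.Analysis"
begin

definition Gam :: "int \<Rightarrow> int \<Rightarrow> int set" where
  "Gam a b = {a * x + b * y | x y. x \<ge> 0 \<and> y \<ge> 0}"

definition gaps :: "int \<Rightarrow> int \<Rightarrow> int set" where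
  "gaps a b = {0..} - Gam a b"

definition U :: "int \<Rightarrow> int \<Rightarrow> int \<Rightarrow> int" where
  "U a b x = of_bool (x \<ge> 0) - of_bool (x \<ge> a) - of_bool (x \<ge> b) + of_bool (x \<ge> a + b)"

definition Q :: "int \<Rightarrow> int \<Rightarrow> (int \<Rightarrow> int) \<Rightarrow> int" where
  "Q a b n = (\<Sum>i\<in>gaps a b. \<Sum>j\<in>gaps a b. U a b (j - i) * n i * n j)"

(* Integer vectors indexed by the gaps, extended by zero; this builds in n i = 0 for i < 0. *)
definition gap_vectors :: "int \<Rightarrow> int \<Rightarrow> (int \<Rightarrow> int) set" where
  "gap_vectors a b = {n. \<forall>i. i \<notin> gaps a b \<longrightarrow> n i = 0}"

(* For m < 0 the value is 1 (empty product); in Zterm such a value is only ever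
   multiplied by a vanishing reciprocal factor. *)
definition qfac :: "complex \<Rightarrow> int \<Rightarrow> complex" where
  "qfac q m = (\<Prod>j=1..nat m. 1 - q ^ j)"

definition inv_qfac :: "complex \<Rightarrow> int \<Rightarrow> complex" where
  "inv_qfac q m = (if m < 0 then 0 else 1 / qfac q m)"

definition Zterm :: "int \<Rightarrow> int \<Rightarrow> complex \<Rightarrow> (int \<Rightarrow> int) \<Rightarrow> complex" where
  "Zterm a b q n = q powi Q a b n *
     (\<Prod>i\<in>gaps a b. qfac q (n i - n (i - a - b)) *
        inv_qfac q (n i - n (i - a)) * inv_qfac q (n i - n (i - b)))"

definition Z :: "int \<Rightarrow> int \<Rightarrow> complex \<Rightarrow> complex" where
  "Z a b q = (\<Sum>\<^sub>\<infinity>n\<in>gap_vectors a b. Zterm a b q n)"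

definition dist_multiples :: "int \<Rightarrow> int \<Rightarrow> int" where
  "dist_multiples x m = (INF k. \<bar>x - m * k\<bar>)"

definition r :: "int \<Rightarrow> int \<Rightarrow> int \<Rightarrow> int" where
  "r a b i = min a (min b (dist_multiples (a * i) (a + b))) - 1 + of_bool (a + b dvd i)"

definition P :: "int \<Rightarrow> int \<Rightarrow> complex \<Rightarrow> complex" where
  "P a b q = (\<Prod>i. (1 - q ^ Suc i) powi (- r a b (int (Suc i))))"

end

theory Submission
  imports Defs
begin

text \<open>The series and the product are both expressed by the same alternating sum over the root lattice of
type A2. Write \<open>(q)\<close> for the infinite product over \<open>1 - q^i\<close>.

On the product side, put \<open>Q = q^(b+3)\<close>. The exponents of \<open>P\<close> are such that \<open>(q)^2 P\<close> times
the infinite product \<open>(Q)\<close> is a product of three theta functions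
\<open>\<theta>(q^x) \<theta>(q^y) \<theta>(q^z)\<close> with \<open>x + y + z = b + 3\<close>. Multiplying out the
three Jacobi triple products and summing along the diagonal gives the denominator identity of the affine
root system A2 (\<open>macdonald\<close>), so that \<open>(q)^2 P\<close> becomes an alternating sum over pairs
\<open>(k1, k2)\<close> of powers of \<open>q\<close> with quadratic exponents.

On the series side the tool is the A2 Bailey lemma (\<open>bailey_lemma\<close>): summation against
\<open>q^(r^2 - r s + s^2) / ((q)_(L-r) (q)_(M-s))\<close> reproduces a certain kernel in \<open>(L, M)\<close> that
depends on a lattice point \<open>k\<close>, up to the factor \<open>q^(k1^2 + k1 k2 + k2^2)\<close>. The lemma is
therefore applied to a sum over lattice points without destroying its shape: each application raises the
modulus \<open>b + 3\<close> by three. The seed is a finite alternating sum of products of three q-binomial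
coefficients that collapses to a single one (\<open>base_pair\<close>, of modulus 4); replacing \<open>q\<close> by
\<open>1/q\<close> turns it into a seed of modulus 2 (\<open>base_pair_dual\<close>). One and two steps from the first
seed give \<open>b = 4\<close> and \<open>b = 7\<close>; two and three steps from the second give \<open>b = 5\<close> and
\<open>b = 8\<close>.

The iterated sum has two chains of summation variables. One chain can be summed away
(\<open>durfee_shifted\<close>), which replaces it by q-binomial coefficients, and after the remaining ones are split
with the q-Vandermonde formula (\<open>qbin_split\<close>) the summand is that of \<open>Z\<close>, indexed by the gaps of
the semigroup, times three factors \<open>1/(q)_m\<close> with \<open>m\<close> tending to infinity. In the limit the kernel
tends to \<open>(q)^-5\<close> and these factors to \<open>(q)^-3\<close>, whence \<open>(q)^2 Z\<close> is the same lattice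
sum. Dominated convergence is available because on the support of the summand \<open>4 Q(n)\<close> is at least three
times the square of the entry at the largest gap, and this entry bounds all others.\<close>

section \<open>Summation formulas for q-factorials\<close>

lemma consecutive_product_even: "\<exists>a. u * (u - 1) = a * (2::int)"
  using even_mult_iff[of u "u - 1"] by (metis dvd_def even_diff_iff odd_one mult.commute even_add)

lemma consecutive_product_even_Suc: "\<exists>a. u * (u + 1) = a * (2::int)"
  using consecutive_product_even[of "u + 1"] by (simp add: mult.commute)

text \<open>The finite identities hold as soon as no q-factorial vanishes. Values of modulus greater than one have to be
included: one of the two seeds arises from the other by replacing \<open>q\<close> by \<open>1/q\<close>.\<close>

locale q_not_root =
  fixes q :: complex
  assumes q_nz: "q \<noteq> 0" and q_nr: "\<And>n. n > 0 \<Longrightarrow> q ^ n \<noteq> 1"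
begin

abbreviation qf :: "int \<Rightarrow> complex" where "qf \<equiv> qfac q"
abbreviation iq :: "int \<Rightarrow> complex" where "iq \<equiv> inv_qfac q"

lemma powi_add: "q powi (a + b) = q powi a * q powi b"
  by (simp add: power_int_add q_nz)

lemma powi_neq_1: "n \<noteq> 0 \<Longrightarrow> q powi n \<noteq> 1"
  by (cases "n > 0") (auto simp: power_int_def q_nr power_inverse)

lemma qf_nz: "qf n \<noteq> 0"
  by (auto simp: qfac_def q_nr)

lemma iq_neg: "n < 0 \<Longrightarrow> iq n = 0"
  by (simp add: inv_qfac_def)

lemma iq_0: "iq 0 = 1"
  by (simp add: inv_qfac_def qfac_def)

lemma qf_iq: "n \<ge> 0 \<Longrightarrow> qf n * iq n = 1"
  by (simp add: inv_qfac_def qf_nz)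

lemma qf_rec: "n \<ge> 1 \<Longrightarrow> qf n = (1 - q powi n) * qf (n - 1)"
proof -
  assume n: "n \<ge> 1"
  then have "nat n = Suc (nat (n - 1))" by simp
  then have "{1..nat n} = insert (nat n) {1..nat (n - 1)}" "nat n \<notin> {1..nat (n - 1)}" by auto
  then show ?thesis using n by (simp add: qfac_def power_int_def)
qed

text \<open>Because the reciprocal vanishes at negative arguments, this recurrence holds for all integers. It is what allows
boundary terms in the sums below to be treated like all others.\<close>

lemma iq_rec: "iq (n - 1) = (1 - q powi n) * iq n"
proof (cases "n \<ge> 1")
  case True
  then have "1 - q powi n \<noteq> 0" using powi_neq_1[of n] by auto
  then show ?thesis using True by (simp add: inv_qfac_def qf_rec[of n])
next
  case False
  then consider "n = 0" | "n < 0" by linarith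
  then show ?thesis by cases (auto simp: iq_neg)
qed

lemma vandermonde_atLeastAtMost:
  assumes "A \<ge> 0" "B \<ge> 0"
  shows "(\<Sum>t\<in>{0..B}. q powi ((C-t)*(B-t)) * iq t * iq (B-t) * iq (C-t) * iq (A-C+t)) =
         qf (A+B) * iq C * iq (A+B-C) * iq A * iq B"
  using assms(2)
proof (induction B arbitrary: C rule: int_ge_induct)
  case base
  then show ?case using assms(1) qf_iq[of A] by (simp add: iq_0 algebra_simps)
next
  case (step B)
  define V where "V = (\<lambda>C. qf (A+B) * iq C * iq (A+B-C) * iq A * iq B)"
  define f where "f = (\<lambda>t. q powi ((C-1-t)*(B-t)) * iq t * iq (B-t) * iq (C-1-t) * iq (A-(C-1)+t))"
  define g where "g = (\<lambda>t. q powi ((C-t)*(B-t)) * iq t * iq (B-t) * iq (C-t) * iq (A-C+t))"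
  let ?S = "\<lambda>t. q powi ((C-t)*(B+1-t)) * iq t * iq (B+1-t) * iq (C-t) * iq (A-C+t)"
  have t: "(1 - q powi (B+1)) * ?S t = f (t-1) + q powi C * g t" for t
  proof -
    have s: "1 - q powi (B+1) = (1 - q powi t) + q powi t * (1 - q powi (B+1-t))"
      using powi_add[of t "B+1-t"] by (simp add: algebra_simps)
    have e: "q powi ((C-t)*(B+1-t)) * q powi t = q powi C * q powi ((C-t)*(B-t))"
      by (simp flip: powi_add add: algebra_simps)
    have i1: "iq (t-1) = (1 - q powi t) * iq t" by (rule iq_rec)
    have i2: "iq (B-t) = (1 - q powi (B+1-t)) * iq (B+1-t)"
      using iq_rec[of "B+1-t"] by (simp add: algebra_simps)
    have f': "f (t-1) = q powi ((C-t)*(B+1-t)) * iq (t-1) * iq (B+1-t) * iq (C-t) * iq (A-C+t)"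
      by (simp add: f_def algebra_simps)
    have "(1 - q powi (B+1)) * ?S t =
        q powi ((C-t)*(B+1-t)) * ((1 - q powi t) * iq t) * iq (B+1-t) * iq (C-t) * iq (A-C+t) +
        (q powi ((C-t)*(B+1-t)) * q powi t) * iq t * ((1 - q powi (B+1-t)) * iq (B+1-t)) * iq (C-t) * iq (A-C+t)"
      unfolding s by (simp only: ring_distribs mult_ac)
    also have "\<dots> = f (t-1) + q powi C * g t"
      unfolding f' g_def by (simp only: e mult.assoc flip: i1 i2)
    finally show ?thesis .
  qed
  have "(1 - q powi (B+1)) * (\<Sum>t\<in>{0..B+1}. ?S t) =
      (\<Sum>t\<in>{0..B+1}. f (t-1)) + q powi C * (\<Sum>t\<in>{0..B+1}. g t)"
    unfolding sum_distrib_left t sum.distrib ..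
  also have "(\<Sum>t\<in>{0..B+1}. f (t-1)) = (\<Sum>t\<in>{-1..B}. f t)"
    by (rule sum.reindex_bij_witness[of _ "\<lambda>t. t+1" "\<lambda>t. t-1"]) auto
  also have "\<dots> = (\<Sum>t\<in>{0..B}. f t)"
    by (rule sum.mono_neutral_right) (auto simp: f_def iq_neg)
  also have "\<dots> = V (C-1)" unfolding f_def V_def by (rule step.IH)
  also have "(\<Sum>t\<in>{0..B+1}. g t) = (\<Sum>t\<in>{0..B}. g t)"
    by (rule sum.mono_neutral_right) (auto simp: g_def iq_neg)
  also have "\<dots> = V C" unfolding g_def V_def by (rule step.IH)
  also have "V (C-1) + q powi C * V C =
     (1 - q powi (B+1)) * (qf (A+(B+1)) * iq C * iq (A+(B+1)-C) * iq A * iq (B+1))"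
  proof -
    let ?n = "A + (B+1)"
    have 1: "qf ?n = (1 - q powi ?n) * qf (A+B)" using qf_rec[of ?n] step assms by (simp add: algebra_simps)
    have 2: "1 - q powi ?n = (1 - q powi C) + q powi C * (1 - q powi (?n - C))"
      using powi_add[of C "?n - C"] by (simp add: algebra_simps)
    have 3: "iq (C-1) = (1 - q powi C) * iq C" by (rule iq_rec)
    have 4: "iq (A+B-C) = (1 - q powi (?n-C)) * iq (?n-C)" using iq_rec[of "?n-C"] by (simp add: algebra_simps)
    have 5: "iq B = (1 - q powi (B+1)) * iq (B+1)" using iq_rec[of "B+1"] by simp
    have 6: "A+B-(C-1) = ?n - C" by simp
    show ?thesis unfolding V_def 6 1 2 3 4 5 by (simp add: algebra_simps)
  qed
  finally have "(1 - q powi (B+1)) * (\<Sum>t\<in>{0..B+1}. ?S t) =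
     (1 - q powi (B+1)) * (qf (A+(B+1)) * iq C * iq (A+(B+1)-C) * iq A * iq (B+1))" .
  moreover have "1 - q powi (B+1) \<noteq> 0" using powi_neq_1[of "B+1"] step by auto
  ultimately show ?case by simp
qed

text \<open>The q-Vandermonde formula with both sides divided by \<open>(q)_A (q)_B\<close>. In this form it is true for arbitrary
integers \<open>A, B, C\<close>, which spares a case distinction whenever it is applied inside another sum.\<close>

lemma vandermonde:
  assumes "finite I" "{0..B} \<subseteq> I"
  shows "(\<Sum>t\<in>I. q powi ((C-t)*(B-t)) * iq t * iq (B-t) * iq (C-t) * iq (A-C+t)) =
         qf (A+B) * iq C * iq (A+B-C) * iq A * iq B"
proof (cases "A \<ge> 0 \<and> B \<ge> 0")
  case True
  have "(\<Sum>t\<in>I. q powi ((C-t)*(B-t)) * iq t * iq (B-t) * iq (C-t) * iq (A-C+t)) =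
     (\<Sum>t\<in>{0..B}. q powi ((C-t)*(B-t)) * iq t * iq (B-t) * iq (C-t) * iq (A-C+t))"
    using assms by (intro sum.mono_neutral_right) (auto simp: iq_neg not_le)
  then show ?thesis using vandermonde_atLeastAtMost[of A B C] True by simp
next
  case False
  have "iq t * iq (B-t) * iq (C-t) * iq (A-C+t) = 0" for t
    using False by (cases "t < 0"; cases "B-t < 0"; cases "C-t < 0") (auto simp: iq_neg)
  then have z: "q powi ((C-t)*(B-t)) * iq t * iq (B-t) * iq (C-t) * iq (A-C+t) = 0" for t
    by auto
  show ?thesis using False unfolding z by (auto simp: iq_neg)
qed

lemma vandermonde':
  assumes "finite I" "{0..X} \<subseteq> I"
  shows "(\<Sum>t\<in>I. q powi (t*(t+D)) * iq t * iq (t+D) * iq (X-t) * iq (Y-t)) =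
         qf (X+Y+D) * iq (X+D) * iq Y * iq (Y+D) * iq X"
proof -
  have "(\<Sum>t\<in>I. q powi (t*(t+D)) * iq t * iq (t+D) * iq (X-t) * iq (Y-t)) =
    (\<Sum>t\<in>(\<lambda>t. X-t)`I. q powi (((X+D)-t)*(X-t)) * iq t * iq (X-t) * iq ((X+D)-t) * iq ((Y+D)-(X+D)+t))"
    by (subst sum.reindex) (auto simp: inj_on_def algebra_simps intro!: sum.cong)
  also have "\<dots> = qf ((Y+D)+X) * iq (X+D) * iq ((Y+D)+X-(X+D)) * iq (Y+D) * iq X"
  proof (rule vandermonde)
    show "{0..X} \<subseteq> (\<lambda>t. X-t)`I"
    proof
      fix x assume "x \<in> {0..X}"
      then have "X - x \<in> I" using assms by auto
      then show "x \<in> (\<lambda>t. X-t)`I" by (auto intro: image_eqI[of _ _ "X-x"])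
    qed
  qed (use assms in auto)
  finally show ?thesis by (simp add: algebra_simps)
qed

text \<open>The difference of the two sides telescopes; the antidifference \<open>H\<close> is the summand with its two rising
reciprocals lowered by one, times \<open>q^(L-r)\<close>.\<close>

lemma durfee_rec:
  fixes L u v a b :: int
  defines "t \<equiv> \<lambda>L r. q powi ((r+u)*(r+v)) * iq (L-r) * iq (r+u) * iq (r+v)"
  assumes "a \<le> -u" "L \<le> b" "a \<le> b + 1"
  shows "(\<Sum>r\<in>{a..b}. t (L-1) r) = (1 - q powi (L+u)) * (1 - q powi (L+v)) * (\<Sum>r\<in>{a..b}. t L r)"
proof -
  define H where "H = (\<lambda>r. q powi (L-r) * q powi ((r+u)*(r+v)) * iq (L-r) * iq (r+u-1) * iq (r+v-1))"
  have "(1 - q powi (L+u)) * (1 - q powi (L+v)) * t L r - t (L-1) r = H r - H (r+1)" for r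
  proof -
    define A U' V' x where "A = q powi L" and "U' = q powi u" and "V' = q powi v" and "x = q powi r"
    define G where "G = q powi ((r+u)*(r+v))"
    have x0: "x \<noteq> 0" by (simp add: x_def q_nz)
    have d: "q powi (L-r) = A / x" by (simp add: A_def x_def power_int_diff q_nz)
    have e1: "q powi (L+u) = A * U'" "q powi (L+v) = A * V'" "q powi (r+u) = x * U'" "q powi (r+v) = x * V'"
      by (simp_all add: A_def U'_def V'_def x_def powi_add)
    have e2: "q powi (L-(r+1)) * q powi ((r+1+u)*(r+1+v)) = A * x * U' * V' * G"
      unfolding A_def x_def U'_def V'_def G_def by (simp flip: powi_add add: algebra_simps)
    have i1: "iq (L-1-r) = (1 - A/x) * iq (L-r)"
      using iq_rec[of "L-r"] unfolding d by (simp add: algebra_simps)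
    have i1': "iq (L-(r+1)) = (1 - A/x) * iq (L-r)" using i1 by (simp add: algebra_simps)
    have i2: "iq (r+u-1) = (1 - x*U') * iq (r+u)" using iq_rec[of "r+u"] unfolding e1 .
    have i3: "iq (r+v-1) = (1 - x*V') * iq (r+v)" using iq_rec[of "r+v"] unfolding e1 .
    have h1: "H (r+1) = A * x * U' * V' * G * ((1 - A/x) * iq (L-r)) * iq (r+u) * iq (r+v)"
      unfolding H_def i1'[symmetric] e2[symmetric] by (simp add: algebra_simps)
    have h0: "H r = A/x * G * iq (L-r) * ((1 - x*U') * iq (r+u)) * ((1 - x*V') * iq (r+v))"
      unfolding H_def i2 i3 d G_def by simp
    have t1: "t (L-1) r = G * ((1 - A/x) * iq (L-r)) * iq (r+u) * iq (r+v)"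
      unfolding t_def i1 G_def ..
    have t0: "t L r = G * iq (L-r) * iq (r+u) * iq (r+v)"
      unfolding t_def G_def ..
    have k: "(1 - A*U') * (1 - A*V') - (1 - A/x) =
       A/x * (1 - x*U') * (1 - x*V') - A*x*U'*V'*(1 - A/x)"
      using x0 by (simp add: field_simps)
    show ?thesis
    proof -
      let ?g = "G * iq (L-r) * iq (r+u) * iq (r+v)"
      have "(1 - A*U') * (1 - A*V') * t L r - t (L-1) r = ((1 - A*U') * (1 - A*V') - (1 - A/x)) * ?g"
        unfolding t1 t0 by (simp only: ring_distribs mult_ac)
      also have "\<dots> = H r - H (r+1)"
        unfolding k h1 h0 by (simp only: ring_distribs mult_ac)
      finally show ?thesis unfolding e1 .
    qed
  qed
  then have "(\<Sum>r\<in>{a..b}. (1 - q powi (L+u)) * (1 - q powi (L+v)) * t L r - t (L-1) r) = (\<Sum>r\<in>{a..b}. H r - H (r+1))"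
    by simp
  also have "\<dots> = (\<Sum>r\<in>{a..b}. H r) - (\<Sum>r\<in>{a+1..b+1}. H r)"
  proof -
    have "(\<Sum>r\<in>{a..b}. H (r+1)) = (\<Sum>r\<in>{a+1..b+1}. H r)"
      by (rule sum.reindex_bij_witness[of _ "\<lambda>t. t-1" "\<lambda>t. t+1"]) auto
    then show ?thesis by (simp add: sum_subtractf)
  qed
  also have "(\<Sum>r\<in>{a..b}. H r) = (\<Sum>r\<in>{a..b+1}. H r)"
    by (rule sum.mono_neutral_left) (use assms in \<open>auto simp: H_def iq_neg\<close>)
  also have "(\<Sum>r\<in>{a+1..b+1}. H r) = (\<Sum>r\<in>{a..b+1}. H r)"
    by (rule sum.mono_neutral_left) (use assms in \<open>auto simp: H_def iq_neg\<close>)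
  finally show ?thesis by (simp add: sum_subtractf sum_distrib_left)
qed

text \<open>The limiting case of the q-Vandermonde formula in which one of the upper parameters is infinite, known from the
decomposition of a partition by its Durfee rectangle.\<close>

lemma durfee:
  assumes "finite I" "{-u..L} \<subseteq> I"
  shows "(\<Sum>r\<in>I. q powi ((r+u)*(r+v)) * iq (L-r) * iq (r+u) * iq (r+v)) = iq (L+u) * iq (L+v)"
proof -
  define t where "t = (\<lambda>L r. q powi ((r+u)*(r+v)) * iq (L-r) * iq (r+u) * iq (r+v))"
  have z: "t L r = 0" if "r < -u \<or> r < -v \<or> L < r" for L r
    using that by (auto simp: t_def iq_neg)
  have ind: "\<forall>L. L + u \<le> int n \<longrightarrow> (\<Sum>r\<in>{-u..L}. t L r) = iq (L+u) * iq (L+v)" for n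
  proof (induction n)
    case 0
    show ?case
    proof (intro allI impI)
      fix L assume "L + u \<le> int 0"
      then consider "L + u < 0" | "L = -u" by linarith
      then show "(\<Sum>r\<in>{-u..L}. t L r) = iq (L+u) * iq (L+v)"
        by cases (auto simp: iq_neg t_def iq_0)
    qed
  next
    case (Suc n)
    show ?case
    proof (intro allI impI)
      fix L assume L: "L + u \<le> int (Suc n)"
      consider "L + u \<le> int n" | "L + v < 0" | "L = -v" "L + u > int n" | "L + v > 0" "L + u = int (Suc n)"
        using L by linarith
      then show "(\<Sum>r\<in>{-u..L}. t L r) = iq (L+u) * iq (L+v)"
      proof cases
        case 1 then show ?thesis using Suc by blast
      next
        case 2
        then have "t L r = 0" for r using z[of r L] by linarith
        then show ?thesis using 2 by (simp add: iq_neg)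
      next
        case 3
        have "(\<Sum>r\<in>{-u..L}. t L r) = (\<Sum>r\<in>{L}. t L r)"
          by (rule sum.mono_neutral_right) (use 3 in \<open>auto intro!: z\<close>)
        then show ?thesis using 3 by (simp add: t_def iq_0)
      next
        case 4
        have "(\<Sum>r\<in>{-u..L}. t (L-1) r) = (\<Sum>r\<in>{-u..L-1}. t (L-1) r)"
          by (rule sum.mono_neutral_right) (auto intro!: z)
        also have "\<dots> = iq (L-1+u) * iq (L-1+v)" using Suc 4 by auto
        also have "\<dots> = (1 - q powi (L+u)) * (1 - q powi (L+v)) * (iq (L+u) * iq (L+v))"
          using iq_rec[of "L+u"] iq_rec[of "L+v"] by (simp add: diff_add_eq mult_ac)
        finally have "(1 - q powi (L+u)) * (1 - q powi (L+v)) * (\<Sum>r\<in>{-u..L}. t L r) = \<dots>"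
          using durfee_rec[of "-u" u L L v] 4 unfolding t_def by simp
        moreover have "1 - q powi (L+u) \<noteq> 0" "1 - q powi (L+v) \<noteq> 0"
          using powi_neq_1[of "L+u"] powi_neq_1[of "L+v"] 4 by auto
        ultimately show ?thesis by simp
      qed
    qed
  qed
  have "(\<Sum>r\<in>I. t L r) = (\<Sum>r\<in>{-u..L}. t L r)"
    using assms by (intro sum.mono_neutral_right) (auto intro!: z)
  also have "\<dots> = iq (L+u) * iq (L+v)" using ind[of "nat (L+u)"] by auto
  finally show ?thesis unfolding t_def .
qed

definition qbin :: "int \<Rightarrow> int \<Rightarrow> complex" where
  "qbin n j = qf n * iq j * iq (n - j)"

lemma qbin_0: "qbin n j = 0" if "j < 0 \<or> n < j"
  using that by (auto simp: qbin_def iq_neg)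

lemma qbin_Suc:
  assumes "n \<ge> 0"
  shows "qbin (n+1) j = q powi j * qbin n j + qbin n (j-1)"
proof -
  have 1: "qf (n+1) = (1 - q powi (n+1)) * qf n" using qf_rec[of "n+1"] assms by simp
  have 2: "1 - q powi (n+1) = (1 - q powi j) + q powi j * (1 - q powi (n+1 - j))"
    using powi_add[of j "n+1 - j"] by (simp add: algebra_simps)
  have 3: "iq (j-1) = (1 - q powi j) * iq j" by (rule iq_rec)
  have 4: "iq (n-j) = (1 - q powi (n+1-j)) * iq (n+1-j)" using iq_rec[of "n+1-j"] by (simp add: algebra_simps)
  have 6: "n-(j-1) = n+1 - j" by simp
  show ?thesis unfolding qbin_def 6 1 2 3 4 by (simp only: ring_distribs mult_ac add_ac diff_conv_add_uminus)
qed

text \<open>A negative power \<open>q^(-p s)\<close> is a combination of falling q-factorials of \<open>q^s\<close>. Multiplied by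
\<open>1/(q)_s\<close>, each of them only shifts the argument of the reciprocal.\<close>

lemma negative_power_expansion:
  "q powi (- int p * s) * iq s = (\<Sum>k\<in>{0..int p}. qbin (int p) k * q powi (k*k - int p * k - s*k) * iq (s-k))"
proof (induction p arbitrary: s)
  case 0
  then show ?case by (simp add: qbin_def iq_0 qfac_def)
next
  case (Suc p)
  define P where "P = int p"
  have P0: "P \<ge> 0" by (simp add: P_def)
  have sP: "int (Suc p) = P + 1" by (simp add: P_def)
  define F where "F = (\<lambda>s k. qbin P k * q powi (k*k - P * k - s*k) * iq (s-k))"
  have IH: "q powi (- P * s) * iq s = (\<Sum>k\<in>{0..P}. F s k)" for s
    unfolding F_def P_def by (rule Suc.IH)
  have "q powi (- (P+1) * s) * iq s = q powi (- P * s) * iq s + q powi (-s-P) * (q powi (- P * (s-1)) * iq (s-1))"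
  proof -
    have a: "q powi (-s-P) * q powi (- P * (s-1)) = q powi (- (P+1) * s)"
      by (simp flip: powi_add add: algebra_simps)
    have b: "q powi (- (P+1) * s) * q powi s = q powi (- P * s)"
      by (simp flip: powi_add add: algebra_simps)
    show ?thesis unfolding iq_rec[of s] mult.assoc[symmetric] a
      using b by (simp add: ring_distribs)
  qed
  also have "\<dots> = (\<Sum>k\<in>{0..P}. F s k) + q powi (-s-P) * (\<Sum>k\<in>{0..P}. F (s-1) k)"
    unfolding IH ..
  also have "(\<Sum>k\<in>{0..P}. F s k) = (\<Sum>k\<in>{0..P+1}. F s k)"
    by (rule sum.mono_neutral_left) (auto simp: F_def qbin_0)
  also have "(\<Sum>k\<in>{0..P}. F (s-1) k) = (\<Sum>k\<in>{1..P+1}. F (s-1) (k-1))"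
    by (rule sum.reindex_bij_witness[of _ "\<lambda>t. t-1" "\<lambda>t. t+1"]) auto
  also have "\<dots> = (\<Sum>k\<in>{0..P+1}. F (s-1) (k-1))"
    by (rule sum.mono_neutral_left) (auto simp: F_def qbin_0)
  also have "(\<Sum>k\<in>{0..P+1}. F s k) + q powi (-s-P) * (\<Sum>k\<in>{0..P+1}. F (s-1) (k-1)) =
     (\<Sum>k\<in>{0..P+1}. F s k + q powi (-s-P) * F (s-1) (k-1))"
    by (simp add: sum.distrib sum_distrib_left)
  also have "\<dots> = (\<Sum>k\<in>{0..P+1}. qbin (P+1) k * q powi (k*k - (P+1) * k - s*k) * iq (s-k))"
  proof (rule sum.cong[OF refl])
    fix k
    have a: "q powi (-s-P) * q powi ((k-1)*(k-1) - P*(k-1) - (s-1)*(k-1)) = q powi (k*k - (P+1) * k - s*k)"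
      by (simp flip: powi_add add: algebra_simps)
    have b: "q powi k * q powi (k*k - (P+1) * k - s*k) = q powi (k*k - P * k - s*k)"
      by (simp flip: powi_add add: algebra_simps)
    have c: "s-1-(k-1) = s-k" by simp
    have "F s k + q powi (-s-P) * F (s-1) (k-1) =
       qbin P k * (q powi k * q powi (k*k - (P+1) * k - s*k)) * iq (s-k) +
       qbin P (k-1) * (q powi (-s-P) * q powi ((k-1)*(k-1) - P*(k-1) - (s-1)*(k-1))) * iq (s-k)"
      unfolding F_def b c by (simp only: mult_ac)
    also have "\<dots> = qbin (P+1) k * q powi (k*k - (P+1) * k - s*k) * iq (s-k)"
      unfolding a qbin_Suc[OF P0] by (simp only: ring_distribs mult_ac)
    finally show "F s k + q powi (-s-P) * F (s-1) (k-1) = qbin (P+1) k * q powi (k*k - (P+1) * k - s*k) * iq (s-k)" .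
  qed
  finally show ?case unfolding sP .
qed

text \<open>If the exponent of \<open>q\<close> is not the one required by \<open>durfee\<close>, the discrepancy is a negative power of
\<open>q^(s-j)\<close>. Expanding that power makes every term summable, at the price of one q-binomial coefficient and a
new variable \<open>J\<close> that plays the same part as \<open>s\<close> did.\<close>

lemma durfee_shifted:
  assumes "A + R \<ge> j" "finite I" "{j..M} \<subseteq> I"
  shows "(\<Sum>s\<in>I. q powi (s* s - A* s) * iq (M-s) * iq (s-j) * iq (s+R)) =
         (\<Sum>J\<in>I. q powi (J*J - A*J) * qbin (A+R-j) (J-j) * iq (M-J) * iq (M+R))"
proof -
  define p where "p = nat (A+R-j)"
  define P where "P = int p"
  have P: "P = A + R - j" "P \<ge> 0" using assms by (auto simp: P_def p_def)
  have A: "A = P + j - R" using P by simp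
  have "(\<Sum>s\<in>I. q powi (s* s - A* s) * iq (M-s) * iq (s-j) * iq (s+R)) =
     (\<Sum>s\<in>I. \<Sum>k\<in>{0..P}. qbin P k * q powi ((j+k)*(j+k) - A*(j+k)) *
        (q powi ((s-(j+k))*(s+R)) * iq (M-s) * iq (s-(j+k)) * iq (s+R)))"
  proof (rule sum.cong[OF refl])
    fix s
    have e: "q powi (s* s - A* s) = q powi ((s-j)*(s+R) + j*R - P*j) * q powi (- P * (s-j))"
      unfolding A by (simp flip: powi_add add: algebra_simps)
    have "q powi (s* s - A* s) * iq (M-s) * iq (s-j) * iq (s+R) =
       q powi ((s-j)*(s+R) + j*R - P*j) * iq (M-s) * iq (s+R) * (q powi (- P * (s-j)) * iq (s-j))"
      unfolding e by (simp only: mult_ac)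
    also have "\<dots> = (\<Sum>k\<in>{0..P}. q powi ((s-j)*(s+R) + j*R - P*j) * iq (M-s) * iq (s+R) *
       (qbin P k * q powi (k*k - P * k - (s-j)*k) * iq (s-j-k)))"
      unfolding P_def negative_power_expansion sum_distrib_left ..
    also have "\<dots> = (\<Sum>k\<in>{0..P}. qbin P k * q powi ((j+k)*(j+k) - A*(j+k)) *
        (q powi ((s-(j+k))*(s+R)) * iq (M-s) * iq (s-(j+k)) * iq (s+R)))" (is "sum ?lt _ = sum ?rt _")
    proof (rule sum.cong[OF refl])
      fix k
      have 1: "q powi ((s-j)*(s+R) + j*R - P*j) * q powi (k*k - P * k - (s-j)*k) =
         q powi ((j+k)*(j+k) - A*(j+k)) * q powi ((s-(j+k))*(s+R))"
        unfolding A by (simp flip: powi_add add: algebra_simps)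
      have 2: "s-j-k = s-(j+k)" by simp
      have "q powi ((s-j)*(s+R) + j*R - P*j) * iq (M-s) * iq (s+R) *
       (qbin P k * q powi (k*k - P * k - (s-j)*k) * iq (s-j-k)) =
        (q powi ((s-j)*(s+R) + j*R - P*j) * q powi (k*k - P * k - (s-j)*k)) * qbin P k * iq (M-s) * iq (s-(j+k)) * iq (s+R)"
        unfolding 2 by (simp only: mult_ac)
      then show "?lt k = ?rt k"
        unfolding 1 by (simp only: mult_ac)
    qed
    finally show "q powi (s* s - A* s) * iq (M-s) * iq (s-j) * iq (s+R) = \<dots>" .
  qed
  also have "\<dots> = (\<Sum>k\<in>{0..P}. qbin P k * q powi ((j+k)*(j+k) - A*(j+k)) *
        (\<Sum>s\<in>I. q powi ((s-(j+k))*(s+R)) * iq (M-s) * iq (s-(j+k)) * iq (s+R)))"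
    by (subst sum.swap) (simp add: sum_distrib_left)
  also have "\<dots> = (\<Sum>k\<in>{0..P}. qbin P k * q powi ((j+k)*(j+k) - A*(j+k)) * (iq (M-(j+k)) * iq (M+R)))" (is "sum ?lt _ = sum ?rt _")
  proof (rule sum.cong[OF refl])
    fix k assume k: "k \<in> {0..P}"
    have "(\<Sum>s\<in>I. q powi ((s+-(j+k))*(s+R)) * iq (M-s) * iq (s+-(j+k)) * iq (s+R)) = iq (M+-(j+k)) * iq (M+R)"
      by (rule durfee) (use k assms in auto)
    then have "(\<Sum>s\<in>I. q powi ((s-(j+k))*(s+R)) * iq (M-s) * iq (s-(j+k)) * iq (s+R)) = iq (M-(j+k)) * iq (M+R)"
      by (simp only: diff_conv_add_uminus)
    then show "?lt k = ?rt k" by simp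
  qed
  also have "\<dots> = (\<Sum>J\<in>{j..j+P}. q powi (J*J - A*J) * qbin P (J-j) * iq (M-J) * iq (M+R))"
    by (rule sum.reindex_bij_witness[of _ "\<lambda>t. t-j" "\<lambda>t. j+t"]) (auto simp: mult_ac)
  also have "\<dots> = (\<Sum>J\<in>{j..j+P} \<union> I. q powi (J*J - A*J) * qbin P (J-j) * iq (M-J) * iq (M+R))"
    by (rule sum.mono_neutral_left) (use assms in \<open>auto simp: qbin_0\<close>)
  also have "\<dots> = (\<Sum>J\<in>I. q powi (J*J - A*J) * qbin P (J-j) * iq (M-J) * iq (M+R))"
  proof (rule sum.mono_neutral_right)
    show "\<forall>i\<in>{j..j+P} \<union> I - I. q powi (i*i - A*i) * qbin P (i-j) * iq (M-i) * iq (M+R) = 0"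
    proof
      fix i assume "i \<in> {j..j+P} \<union> I - I"
      then have "M - i < 0" using assms(3) by force
      then show "q powi (i*i - A*i) * qbin P (i-j) * iq (M-i) * iq (M+R) = 0" by (simp add: iq_neg)
    qed
  qed (use assms in auto)
  finally show ?thesis unfolding P(1) .
qed

section \<open>The Bailey lemma of type A2\<close>

text \<open>With \<open>k3 = - k1 - k2\<close> this is \<open>(q)_(L+M)\<close> divided by the product over \<open>i\<close> of
\<open>(q)_(L+k_i) (q)_(M-k_i)\<close>.\<close>

definition kernel :: "int \<Rightarrow> int \<Rightarrow> int \<Rightarrow> int \<Rightarrow> complex" where
  "kernel L M k1 k2 = qf (L+M) * (iq (L+k1) * iq (L+k2) * iq (L-k1-k2)) * (iq (M-k1) * iq (M-k2) * iq (M+k1+k2))"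

text \<open>One q-Vandermonde expansion of the factors involving \<open>k1\<close> and \<open>k2\<close> introduces a variable
\<open>t\<close> and cancels the mixed term \<open>- r s\<close> in the exponent. The sums over \<open>r\<close> and over
\<open>s\<close> then separate and are both evaluated by \<open>durfee\<close>; the remaining sum over \<open>t\<close> is again
a q-Vandermonde sum.\<close>

lemma bailey_lemma:
  assumes "0 \<le> L" "0 \<le> M"
  shows "(\<Sum>r\<in>{0..L}. \<Sum>s\<in>{0..M}. q powi (r*r - r* s + s* s) * iq (L-r) * iq (M-s) * kernel r s k1 k2) =
         q powi (k1*k1 + k1*k2 + k2*k2) * kernel L M k1 k2"
proof -
  \<comment> \<open>The ranges are enlarged so that every inner sum below covers the support demanded by its summation formula; the
additional terms vanish because for negative \<open>r\<close> or \<open>s\<close> the numbers \<open>r + k_i\<close>, respectively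
\<open>s - k_i\<close>, are not all nonnegative.\<close>
  define k3 where "k3 = - k1 - k2"
  define IR where "IR = {-\<bar>k3\<bar>..L}"
  define IS where "IS = {-\<bar>k3\<bar>..M}"
  define IT where "IT = {0..L+M+\<bar>k1\<bar>+\<bar>k2\<bar>}"
  have fin: "finite IR" "finite IS" "finite IT" by (auto simp: IR_def IS_def IT_def)
  define f where "f = (\<lambda>r s. q powi (r*r - r* s + s* s) * iq (L-r) * iq (M-s) * kernel r s k1 k2)"
  have z: "f r s = 0" if "r < 0 \<or> s < 0" for r s
  proof -
    have "r+k1 < 0 \<or> r+k2 < 0 \<or> r-k1-k2 < 0 \<or> s-k1 < 0 \<or> s-k2 < 0 \<or> s+k1+k2 < 0"
      using that by linarith
    then show ?thesis by (auto simp: f_def kernel_def iq_neg)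
  qed
  have "(\<Sum>r\<in>{0..L}. \<Sum>s\<in>{0..M}. f r s) = (\<Sum>r\<in>{0..L}. \<Sum>s\<in>IS. f r s)"
    by (intro sum.cong[OF refl] sum.mono_neutral_left) (auto simp: IS_def z)
  also have "\<dots> = (\<Sum>r\<in>IR. \<Sum>s\<in>IS. f r s)"
    by (intro sum.mono_neutral_left) (auto simp: IR_def z)
  also have "\<dots> = (\<Sum>r\<in>IR. \<Sum>s\<in>IS. \<Sum>t\<in>IT. q powi ((k1-t)*(s-k2-t) - k3*(k1-t) + s* s) *
        iq (M-s) * iq t * iq (s-k2-t) * iq (k2-k1+t) * iq (s-k3) *
        (q powi ((r+k3)*(r+(k1-t))) * iq (L-r) * iq (r+k3) * iq (r+(k1-t))))"
  proof (intro sum.cong[OF refl])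
    fix r s assume "r \<in> IR" and s: "s \<in> IS"
    have V: "(\<Sum>t\<in>IT. q powi ((r+k1-t)*(s-k2-t)) * iq t * iq (s-k2-t) * iq (r+k1-t) * iq (r+k2-(r+k1)+t)) =
       qf (r+k2+(s-k2)) * iq (r+k1) * iq (r+k2+(s-k2)-(r+k1)) * iq (r+k2) * iq (s-k2)"
      by (rule vandermonde) (use assms s in \<open>auto simp: IT_def IS_def\<close>)
    have "f r s = q powi (r*r - r* s + s* s) * iq (L-r) * iq (M-s) * iq (r+k3) * iq (s-k3) *
       (qf (r+k2+(s-k2)) * iq (r+k1) * iq (r+k2+(s-k2)-(r+k1)) * iq (r+k2) * iq (s-k2))"
      unfolding f_def kernel_def k3_def by (simp add: algebra_simps)
    also have "\<dots> = (\<Sum>t\<in>IT. q powi (r*r - r* s + s* s) * iq (L-r) * iq (M-s) * iq (r+k3) * iq (s-k3) *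
       (q powi ((r+k1-t)*(s-k2-t)) * iq t * iq (s-k2-t) * iq (r+k1-t) * iq (r+k2-(r+k1)+t)))"
      unfolding V[symmetric] sum_distrib_left ..
    also have "\<dots> = (\<Sum>t\<in>IT. q powi ((k1-t)*(s-k2-t) - k3*(k1-t) + s* s) *
        iq (M-s) * iq t * iq (s-k2-t) * iq (k2-k1+t) * iq (s-k3) *
        (q powi ((r+k3)*(r+(k1-t))) * iq (L-r) * iq (r+k3) * iq (r+(k1-t))))" (is "sum ?lt _ = sum ?rt _")
    proof (rule sum.cong[OF refl])
      fix t
      have e: "q powi (r*r - r* s + s* s) * q powi ((r+k1-t)*(s-k2-t)) =
          q powi ((k1-t)*(s-k2-t) - k3*(k1-t) + s* s) * q powi ((r+k3)*(r+(k1-t)))"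
        unfolding k3_def by (simp flip: powi_add add: algebra_simps)
      have a: "r+k2-(r+k1)+t = k2-k1+t" "r+k1-t = r+(k1-t)" by simp_all
      have "q powi (r*r - r* s + s* s) * iq (L-r) * iq (M-s) * iq (r+k3) * iq (s-k3) *
       (q powi ((r+k1-t)*(s-k2-t)) * iq t * iq (s-k2-t) * iq (r+k1-t) * iq (r+k2-(r+k1)+t)) =
       (q powi (r*r - r* s + s* s) * q powi ((r+k1-t)*(s-k2-t))) * iq (M-s) * iq t * iq (s-k2-t) * iq (k2-k1+t) * iq (s-k3) *
        (iq (L-r) * iq (r+k3) * iq (r+(k1-t)))" unfolding a by (simp only: mult_ac)
      also note e
      finally show "?lt t = ?rt t"
        by (simp only: mult_ac)
    qed
    finally show "f r s = \<dots>" .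
  qed
  also have "\<dots> = (\<Sum>s\<in>IS. \<Sum>t\<in>IT. \<Sum>r\<in>IR. q powi ((k1-t)*(s-k2-t) - k3*(k1-t) + s* s) *
        iq (M-s) * iq t * iq (s-k2-t) * iq (k2-k1+t) * iq (s-k3) *
        (q powi ((r+k3)*(r+(k1-t))) * iq (L-r) * iq (r+k3) * iq (r+(k1-t))))"
    by (subst sum.swap, rule sum.cong[OF refl], rule sum.swap)
  also have "\<dots> = (\<Sum>s\<in>IS. \<Sum>t\<in>IT. q powi ((k1-t)*(s-k2-t) - k3*(k1-t) + s* s) *
        iq (M-s) * iq t * iq (s-k2-t) * iq (k2-k1+t) * iq (s-k3) * (iq (L+k3) * iq (L+(k1-t))))"
    unfolding sum_distrib_left[symmetric]
    by (subst durfee) (auto simp: IR_def)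
  also have "\<dots> = (\<Sum>t\<in>IT. \<Sum>s\<in>IS. q powi ((k1-t)*(-k2-t) - k3*(k1-t) - k3*(k2+t)) *
        iq t * iq (k2-k1+t) * iq (L+k3) * iq (L+(k1-t)) *
        (q powi ((s + -k3)*(s+(-k2-t))) * iq (M-s) * iq (s + -k3) * iq (s+(-k2-t))))"
  proof (subst sum.swap, intro sum.cong[OF refl])
    fix t s
    have e: "q powi ((k1-t)*(s-k2-t) - k3*(k1-t) + s* s) =
       q powi ((k1-t)*(-k2-t) - k3*(k1-t) - k3*(k2+t)) * q powi ((s + -k3)*(s+(-k2-t)))"
      unfolding k3_def by (simp flip: powi_add add: algebra_simps)
    have a: "s + -k3 = s - k3" "s+(-k2-t) = s-k2-t" by simp_all
    show "q powi ((k1-t)*(s-k2-t) - k3*(k1-t) + s* s) *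
        iq (M-s) * iq t * iq (s-k2-t) * iq (k2-k1+t) * iq (s-k3) * (iq (L+k3) * iq (L+(k1-t))) =
       q powi ((k1-t)*(-k2-t) - k3*(k1-t) - k3*(k2+t)) *
        iq t * iq (k2-k1+t) * iq (L+k3) * iq (L+(k1-t)) *
        (q powi ((s + -k3)*(s+(-k2-t))) * iq (M-s) * iq (s + -k3) * iq (s+(-k2-t)))"
      unfolding e unfolding a by (simp only: mult_ac)
  qed
  also have "\<dots> = (\<Sum>t\<in>IT. q powi ((k1-t)*(-k2-t) - k3*(k1-t) - k3*(k2+t)) *
        iq t * iq (k2-k1+t) * iq (L+k3) * iq (L+(k1-t)) * (iq (M + -k3) * iq (M + (-k2-t))))"
    unfolding sum_distrib_left[symmetric]
    by (subst durfee) (auto simp: IS_def)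
  also have "\<dots> = (\<Sum>t\<in>IT. q powi (k1*k1+k1*k2+k2*k2) * iq (L+k3) * iq (M-k3) *
     (q powi (t*(t+(k2-k1))) * iq t * iq (t+(k2-k1)) * iq (L+k1-t) * iq (M-k2-t)))" (is "sum ?lt _ = sum ?rt _")
  proof (rule sum.cong[OF refl])
    fix t
    have e: "q powi ((k1-t)*(-k2-t) - k3*(k1-t) - k3*(k2+t)) = q powi (k1*k1+k1*k2+k2*k2) * q powi (t*(t+(k2-k1)))"
      unfolding k3_def by (simp flip: powi_add add: algebra_simps)
    have a: "k2-k1+t = t+(k2-k1)" "L+(k1-t) = L+k1-t" "M + -k3 = M-k3" "M + (-k2-t) = M-k2-t" by simp_all
    show "?lt t = ?rt t"
      unfolding e a by (simp only: mult_ac)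
  qed
  also have "\<dots> = q powi (k1*k1+k1*k2+k2*k2) * iq (L+k3) * iq (M-k3) *
     (qf ((L+k1)+(M-k2)+(k2-k1)) * iq ((L+k1)+(k2-k1)) * iq (M-k2) * iq ((M-k2)+(k2-k1)) * iq (L+k1))"
    unfolding sum_distrib_left[symmetric]
    by (subst vandermonde') (use assms in \<open>auto simp: IT_def\<close>)
  also have "\<dots> = q powi (k1*k1+k1*k2+k2*k2) * kernel L M k1 k2"
    unfolding kernel_def k3_def by (simp add: algebra_simps)
  finally show ?thesis unfolding f_def .
qed

end

section \<open>A finite denominator identity at level one\<close>

definition chi3 :: "int \<Rightarrow> int" where
  "chi3 d = (if d mod 3 = 1 then 1 else if d mod 3 = 2 then -1 else 0)"

lemma chi3_minus: "chi3 (- d) = - chi3 d"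
proof -
  have "d mod 3 = 0 \<or> d mod 3 = 1 \<or> d mod 3 = 2" by presburger
  then show ?thesis unfolding chi3_def by (auto; presburger)
qed

lemma chi3_cong: "3 dvd (a - b) \<Longrightarrow> chi3 a = chi3 b"
  unfolding chi3_def by (simp add: mod_eq_dvd_iff[symmetric])

text \<open>The coefficient of the lattice point \<open>(k1, k2, - k1 - k2)\<close>. Adding \<open>(0, 1, 2)\<close> to the point
gives residues modulo 3 that are either all different, and then this is the sign of the permutation they form,
or all equal, and then it vanishes.\<close>

definition eps :: "int \<Rightarrow> int \<Rightarrow> int" where
  "eps k1 k2 = chi3 (k2 - k1 + 1)"

definition nrm :: "int \<Rightarrow> int \<Rightarrow> int" where
  "nrm k1 k2 = k1*k1 + k1*k2 + k2*k2"

definition plane :: "int \<Rightarrow> (int \<times> int \<times> int) set" where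
  "plane N = {(a, b, c). a + b + c = N}"

definition finsupp :: "(int \<Rightarrow> complex) \<Rightarrow> bool" where
  "finsupp f \<longleftrightarrow> finite {x. f x \<noteq> 0}"

context q_not_root begin

text \<open>Three positions that are distinct modulo 3 are weighted by the sign of their residues. The exponent of \<open>q\<close>
is chosen so that moving one position by 3 multiplies the weight by \<open>q\<close> to that position; the division by 6 is
exact for distinct residues.\<close>

definition alt_weight :: "int \<Rightarrow> int \<Rightarrow> int \<Rightarrow> complex" where
  "alt_weight a b c = of_int (chi3 (b - a)) * q powi ((a*a + b*b + c*c - 3*(a+b+c) + 4) div 6)"

text \<open>As a function of three sequences this is trilinear and alternating, like a determinant: the weight changes sign under
transpositions of the positions, provided that 3 divides \<open>N\<close>.\<close>

definition alt_sum :: "(int \<Rightarrow> complex) \<Rightarrow> (int \<Rightarrow> complex) \<Rightarrow> (int \<Rightarrow> complex) \<Rightarrow> int \<Rightarrow> complex" where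
  "alt_sum f g h N = (\<Sum>\<^sub>\<infinity>(a, b, c)\<in>plane N. alt_weight a b c * f a * g b * h c)"

lemma alt_sum_summable:
  assumes "finsupp f" "finsupp g"
  shows "(\<lambda>(a, b, c). alt_weight a b c * f a * g b * h c) summable_on plane N"
proof (rule finite_nonzero_values_imp_summable_on)
  have "{x\<in>plane N. (\<lambda>(a, b, c). alt_weight a b c * f a * g b * h c) x \<noteq> 0} \<subseteq>
      (\<lambda>(a,b). (a,b,N-a-b)) ` ({x. f x \<noteq> 0} \<times> {x. g x \<noteq> 0})"
    by (auto simp: plane_def image_iff)
  then show "finite {x\<in>plane N. (\<lambda>(a, b, c). alt_weight a b c * f a * g b * h c) x \<noteq> 0}"
    by (rule finite_subset) (use assms in \<open>auto simp: finsupp_def\<close>)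
qed

lemma alt_sum_add:
  assumes "finsupp f" "finsupp g"
  shows "alt_sum f g (\<lambda>p. h p + h' p) N = alt_sum f g h N + alt_sum f g h' N"
proof -
  have "alt_sum f g h N + alt_sum f g h' N =
     (\<Sum>\<^sub>\<infinity>x\<in>plane N. (\<lambda>(a, b, c). alt_weight a b c * f a * g b * h c) x + (\<lambda>(a, b, c). alt_weight a b c * f a * g b * h' c) x)"
    unfolding alt_sum_def by (rule infsum_add[symmetric]) (intro alt_sum_summable assms)+
  also have "\<dots> = alt_sum f g (\<lambda>p. h p + h' p) N"
    unfolding alt_sum_def by (rule infsum_cong) (auto simp: algebra_simps)
  finally show ?thesis ..
qed

lemma alt_sum_scale: "alt_sum f g (\<lambda>p. z * h p) N = z * alt_sum f g h N"
  unfolding alt_sum_def by (subst infsum_cmult_right'[symmetric]) (auto intro!: infsum_cong simp: mult_ac)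

lemma alt_sum_swap12: "alt_sum g f h N = - alt_sum f g h N"
proof -
  have "alt_sum g f h N = (\<Sum>\<^sub>\<infinity>x\<in>plane N. - (\<lambda>(a, b, c). alt_weight a b c * f a * g b * h c) x)"
    unfolding alt_sum_def
  proof (rule infsum_reindex_bij_witness[of _ "\<lambda>(a,b,c). (b,a,c)" "\<lambda>(a,b,c). (b,a,c)"])
    fix x assume "x \<in> plane N"
    show "- (\<lambda>(a, b, c). alt_weight a b c * f a * g b * h c) ((\<lambda>(a,b,c). (b,a,c)) x) = (\<lambda>(a, b, c). alt_weight a b c * g a * f b * h c) x"
    proof (cases x)
      case (fields a b c)
      have "chi3 (a - b) = - chi3 (b - a)" using chi3_minus[of "b - a"] by simp
      then show ?thesis unfolding fields alt_weight_def by (simp add: add_ac mult_ac)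
    qed
  qed (auto simp: plane_def)
  then show ?thesis by (simp add: infsum_uminus alt_sum_def)
qed

lemma alt_sum_swap13:
  assumes "3 dvd N"
  shows "alt_sum h g f N = - alt_sum f g h N"
proof -
  have "alt_sum h g f N = (\<Sum>\<^sub>\<infinity>x\<in>plane N. - (\<lambda>(a, b, c). alt_weight a b c * f a * g b * h c) x)"
    unfolding alt_sum_def
  proof (rule infsum_reindex_bij_witness[of _ "\<lambda>(a,b,c). (c,b,a)" "\<lambda>(a,b,c). (c,b,a)"])
    fix x assume x: "x \<in> plane N"
    show "- (\<lambda>(a, b, c). alt_weight a b c * f a * g b * h c) ((\<lambda>(a,b,c). (c,b,a)) x) = (\<lambda>(a, b, c). alt_weight a b c * h a * g b * f c) x"
    proof (cases x)
      case (fields a b c)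
      have N: "N = a + b + c" using x fields by (simp add: plane_def)
      have "chi3 (b - c) = chi3 (- (b - a))"
        by (rule chi3_cong) (use assms N in presburger)
      then have "chi3 (b - c) = - chi3 (b - a)" unfolding chi3_minus .
      then show ?thesis unfolding fields alt_weight_def by (simp add: add_ac mult_ac)
    qed
  qed (auto simp: plane_def)
  then show ?thesis by (simp add: infsum_uminus alt_sum_def)
qed

lemma alt_sum_rotate: "3 dvd N \<Longrightarrow> alt_sum f g h N = alt_sum h f g N"
  using alt_sum_swap12[of g f h N] alt_sum_swap13[of N g f h] by simp

lemma alt_sum_eq13: "3 dvd N \<Longrightarrow> alt_sum f g f N = 0"
  using alt_sum_swap13[of N f g f] by simp

lemma alt_sum_eq23: "3 dvd N \<Longrightarrow> alt_sum g f f N = 0"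
  using alt_sum_rotate[of N f g f] alt_sum_eq13[of N f g] alt_sum_rotate[of N g f f] by simp

lemma alt_sum_shift3: "alt_sum f g h N = alt_sum f g (\<lambda>p. q powi p * h (p + 3)) (N - 3)"
  unfolding alt_sum_def
proof (rule infsum_reindex_bij_witness[of _ "\<lambda>(a,b,c). (a,b,c+3)" "\<lambda>(a,b,c). (a,b,c-3)"])
  fix x assume "x \<in> plane N"
  show "(\<lambda>(a, b, c). alt_weight a b c * f a * g b * (q powi c * h (c + 3))) ((\<lambda>(a,b,c). (a,b,c-3)) x) =
        (\<lambda>(a, b, c). alt_weight a b c * f a * g b * h c) x"
  proof (cases x)
    case (fields a b c)
    have "a*a + b*b + c*c - 3*(a+b+c) + 4 = (a*a + b*b + (c-3)*(c-3) - 3*(a+b+(c-3)) + 4) + (c-3) * 6"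
      by (simp add: algebra_simps)
    then have "(a*a + b*b + c*c - 3*(a+b+c) + 4) div 6 = (a*a + b*b + (c-3)*(c-3) - 3*(a+b+(c-3)) + 4) div 6 + (c-3)"
      by (simp only: div_mult_self1)
    then have "alt_weight a b c = alt_weight a b (c-3) * q powi (c-3)"
      unfolding alt_weight_def by (simp only: powi_add mult.assoc)
    then show ?thesis unfolding fields by simp
  qed
qed (auto simp: plane_def)

lemma alt_sum_shift1:
  "alt_sum f g h (3*n) = q powi (n - 2) * alt_sum (\<lambda>p. f (p+1)) (\<lambda>p. g (p+1)) (\<lambda>p. h (p+1)) (3*(n-1))"
proof -
  have "alt_sum f g h (3*n) = (\<Sum>\<^sub>\<infinity>x\<in>plane (3*(n-1)). q powi (n - 2) * (\<lambda>(a, b, c). alt_weight a b c * f (a+1) * g (b+1) * h (c+1)) x)"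
    unfolding alt_sum_def
  proof (rule infsum_reindex_bij_witness[of _ "\<lambda>(a,b,c). (a+1,b+1,c+1)" "\<lambda>(a,b,c). (a-1,b-1,c-1)"])
    fix x assume x: "x \<in> plane (3*n)"
    show "q powi (n - 2) * (\<lambda>(a, b, c). alt_weight a b c * f (a+1) * g (b+1) * h (c+1)) ((\<lambda>(a,b,c). (a-1,b-1,c-1)) x) =
          (\<lambda>(a, b, c). alt_weight a b c * f a * g b * h c) x"
    proof (cases x)
      case (fields a b c)
      have n: "a + b + c = 3 * n" using x fields by (simp add: plane_def)
      then have c: "c = 3 * n - a - b" by simp
      have "a*a + b*b + c*c - 3*(a+b+c) + 4 =
        ((a-1)*(a-1) + (b-1)*(b-1) + (c-1)*(c-1) - 3*((a-1)+(b-1)+(c-1)) + 4) + (n - 2) * 6"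
        unfolding c by (simp add: algebra_simps)
      then have "(a*a + b*b + c*c - 3*(a+b+c) + 4) div 6 =
        ((a-1)*(a-1) + (b-1)*(b-1) + (c-1)*(c-1) - 3*((a-1)+(b-1)+(c-1)) + 4) div 6 + (n - 2)"
        by simp
      then have "alt_weight a b c = alt_weight (a-1) (b-1) (c-1) * q powi (n-2)"
        unfolding alt_weight_def by (simp only: powi_add mult.assoc diff_diff_eq2 diff_add_eq) simp
      then show ?thesis unfolding fields by simp
    qed
  qed (auto simp: plane_def)
  then show ?thesis by (simp add: infsum_cmult_right' alt_sum_def)
qed

text \<open>Consider the determinants \<open>D a b c\<close> in the shifts of \<open>\<Psi>\<close> by \<open>a, b, c\<close>. Moving
one position by 3, and using the functional equation of \<open>\<Psi>\<close> to absorb the resulting factor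
\<open>q^p\<close>, relates shifts by 2 and 3 to shifts by \<open>-1\<close> and \<open>0\<close>; a repeated shift makes a
determinant vanish, and a common shift of all three changes it by a power of \<open>q\<close> only. The three relations
obtained in this way eliminate the determinants with shifts \<open>0, 1, 3\<close> and \<open>0, 2, 3\<close>, and leave a
recurrence of first order for the one with shifts \<open>0, 1, 2\<close>.\<close>

lemma alt_sum_recurrence:
  fixes \<Psi> :: "int \<Rightarrow> complex" and z :: complex
  assumes fin: "finsupp \<Psi>"
    and rel: "\<And>j. q powi j * (\<Psi> j + \<Psi> (j-1)) = \<Psi> j + z * \<Psi> (j-1)"
  defines "X \<equiv> \<lambda>n. alt_sum \<Psi> (\<lambda>p. \<Psi> (p-1)) (\<lambda>p. \<Psi> (p-2)) (3*n)"
  shows "(q powi L - z) * X L = q powi (1 - 3*L) * (1 - q powi L) * X (L+1)"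
proof -
  define w where "w = (\<lambda>c p. \<Psi> (p - c))"
  have bw: "finsupp (w c)" for c
  proof -
    have "{x. w c x \<noteq> 0} = (\<lambda>x. x + c) ` {x. \<Psi> x \<noteq> 0}"
      by (auto simp: w_def image_iff intro!: exI[of _ "_ - c"])
    then show ?thesis using fin unfolding finsupp_def by simp
  qed
  define D where "D = (\<lambda>a b c n. alt_sum (w a) (w b) (w c) (3*n))"
  have w1: "(\<lambda>p. w c (p+1)) = w (c-1)" for c by (auto simp: w_def algebra_simps)
  have sh: "D a b c n = q powi (n-2) * D (a-1) (b-1) (c-1) (n-1)" for a b c n
    unfolding D_def by (subst alt_sum_shift1) (simp only: w1)
  have rot: "D a b c n = D c a b n" for a b c n
    unfolding D_def by (rule alt_sum_rotate) simp
  \<comment> \<open>Moving the third position across a period; \<open>z\<close> enters through the functional equation of \<open>\<Psi>\<close>.\<close>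
  have seam: "D a b 2 n + D a b 3 n = q powi (-1) * (D a b (-1) (n-1) + z * D a b 0 (n-1))" for a b n
  proof -
    have h: "(\<lambda>p. q powi p * (w 2 (p+3) + w 3 (p+3))) = (\<lambda>p. q powi (-1) * (w (-1) p + z * w 0 p))"
    proof
      fix p
      have 1: "q powi p = q powi (-1) * q powi (p+1)" using powi_add[of "-1" "p+1"] by simp
      have 2: "w 2 (p+3) = \<Psi> (p+1)" "w 3 (p+3) = \<Psi> (p+1-1)" "w (-1) p = \<Psi> (p+1)" "w 0 p = \<Psi> (p+1-1)"
        by (simp_all add: w_def algebra_simps)
      show "q powi p * (w 2 (p+3) + w 3 (p+3)) = q powi (-1) * (w (-1) p + z * w 0 p)"
        unfolding 1 2 by (simp only: mult.assoc rel)
    qed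
    have "D a b 2 n + D a b 3 n = alt_sum (w a) (w b) (\<lambda>p. w 2 p + w 3 p) (3*n)"
      unfolding D_def by (simp add: alt_sum_add bw)
    also have "\<dots> = alt_sum (w a) (w b) (\<lambda>p. q powi p * (w 2 (p+3) + w 3 (p+3))) (3*n-3)"
      by (rule alt_sum_shift3)
    also have "\<dots> = q powi (-1) * (D a b (-1) (n-1) + z * D a b 0 (n-1))"
      unfolding h D_def by (simp only: alt_sum_scale alt_sum_add[OF bw bw]) simp
    finally show ?thesis .
  qed
  define n where "n = L + 1"
  have nL: "n - 1 = L" by (simp add: n_def)
  define x y v x' where "x = D 0 1 2 n" and "y = D 0 1 3 n" and "v = D 0 2 3 n" and "x' = D 0 1 2 (n-1)"
  have eq0: "D 0 1 0 (n-1) = 0" "D 0 2 0 (n-1) = 0" "D 0 2 2 n = 0" "D 1 2 2 n = 0"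
    unfolding D_def by (auto intro!: alt_sum_eq13 alt_sum_eq23)
  \<comment> \<open>A common shift turns the terms produced by \<open>seam\<close> at level \<open>n - 1\<close> back into terms at level \<open>n\<close>.\<close>
  have pw: "q powi (-1) * D a b c (n-1) = q powi (-L) * D (a+1) (b+1) (c+1) n" for a b c
    unfolding sh[of "a+1" "b+1" "c+1" n] using nL
    by (simp add: mult.assoc[symmetric] flip: powi_add) (simp add: n_def)
  have 1: "x + y = q powi (-L) * x"
    using seam[of 0 1 n] eq0 pw[of "-1" 0 1] rot[of 0 1 "-1" "n-1"] by (simp add: x_def y_def)
  have 2: "v = q powi (-L) * y"
    using seam[of 0 2 n] eq0 pw[of "-1" 0 2] rot[of 0 2 "-1" "n-1"] by (simp add: v_def y_def)
  have 3: "q powi (n-2) * x' = q powi (-L) * v + q powi (-1) * z * x'"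
    using seam[of 1 2 n] eq0 pw[of "-1" 1 2] rot[of 1 2 "-1" "n-1"] rot[of 1 2 0 "n-1"] sh[of 1 2 3 n]
    by (simp add: v_def x'_def ring_distribs)
  have y: "y = (q powi (-L) - 1) * x" using 1 by (simp add: algebra_simps)
  have "(q powi L - z) * x' = q powi 1 * (q powi (n-2) * x' - q powi (-1) * z * x')"
  proof -
    have "q powi L = q powi 1 * q powi (n-2)" "z = q powi 1 * q powi (-1) * z"
      using powi_add[of 1 "n-2"] by (simp_all add: n_def q_nz)
    then show ?thesis by (simp only: ring_distribs mult_ac)
  qed
  also have "\<dots> = q powi 1 * (q powi (-L) * (q powi (-L) * ((q powi (-L) - 1) * x)))"
    using 3 unfolding 2 y by simp
  also have "\<dots> = q powi (1 - 3*L) * (1 - q powi L) * x"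
  proof -
    have a: "q powi (-L) - 1 = q powi (-L) * (1 - q powi L)"
      by (simp add: ring_distribs flip: powi_add)
    have b: "q powi (1 - 3*L) = q powi 1 * (q powi (-L) * (q powi (-L) * q powi (-L)))"
    proof -
      have "1 - 3*L = 1 + (-L + (-L + -L))" by simp
      then show ?thesis by (simp only: powi_add)
    qed
    show ?thesis unfolding a b by (simp only: mult_ac)
  qed
  finally show ?thesis unfolding x_def x'_def X_def D_def w_def n_def by simp
qed

text \<open>The coefficients of the product of \<open>1 + x q^i\<close> over \<open>1 \<le> i \<le> m\<close>.\<close>

definition Psi :: "int \<Rightarrow> int \<Rightarrow> complex" where
  "Psi m j = q powi (j*(j+1) div 2) * qbin m j"

lemma finsupp_Psi: "finsupp (Psi m)"
proof -
  have "{x. Psi m x \<noteq> 0} \<subseteq> {0..m}"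
    by (auto simp: Psi_def q_nz not_le) (use qbin_0 in \<open>force simp: not_le\<close>)+
  then show ?thesis unfolding finsupp_def by (rule finite_subset) simp
qed

lemma qbin_ratio: "(1 - q powi j) * qbin m j = (1 - q powi (m+1-j)) * qbin m (j-1)"
proof -
  have 1: "iq (j-1) = (1 - q powi j) * iq j" by (rule iq_rec)
  have 2: "iq (m-j) = (1 - q powi (m+1-j)) * iq (m-(j-1))" using iq_rec[of "m+1-j"] by (simp add: algebra_simps)
  show ?thesis unfolding qbin_def 1 2 by (simp only: mult_ac)
qed

text \<open>The functional equation of the generating product under \<open>x \<mapsto> q x\<close>, written for its coefficients.\<close>

lemma Psi_rel: "q powi j * (Psi m j + Psi m (j-1)) = Psi m j + q powi (m+1) * Psi m (j-1)"
proof -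
  define T where "T = q powi ((j-1)*(j-1+1) div 2)"
  have "j*(j+1) = (j-1)*(j-1+1) + j * 2" by (simp add: algebra_simps)
  then have "j*(j+1) div 2 = (j-1)*(j-1+1) div 2 + j" by simp
  then have a: "Psi m j = T * q powi j * qbin m j" by (simp only: Psi_def powi_add T_def)
  have b: "Psi m (j-1) = T * qbin m (j-1)" by (simp add: Psi_def T_def)
  have c: "q powi (m+1) = q powi j * q powi (m+1-j)" by (simp flip: powi_add)
  have "q powi j * (Psi m j + Psi m (j-1)) - (Psi m j + q powi (m+1) * Psi m (j-1)) =
     T * q powi j * ((1 - q powi (m+1-j)) * qbin m (j-1) - (1 - q powi j) * qbin m j)"
    unfolding a b c by (simp add: algebra_simps)
  then show ?thesis unfolding qbin_ratio by simp
qed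

lemma alt_sum_Psi:
  assumes "m \<ge> 0" "L \<ge> 0"
  shows "alt_sum (Psi m) (\<lambda>p. Psi m (p-1)) (\<lambda>p. Psi m (p-2)) (3*(L+1)) = q powi (2*L*L+L) * qbin m L"
  using assms(2)
proof (induction L rule: int_ge_induct)
  case base
  let ?f = "\<lambda>(a, b, c). alt_weight a b c * Psi m a * Psi m (b-1) * Psi m (c-2)"
  have Psi0: "Psi m j = 0" if "j < 0" for j using that by (simp add: Psi_def qbin_0)
  have b1: "qbin m 0 = 1" using assms(1) by (simp add: qbin_def iq_0 qf_iq)
  have "alt_sum (Psi m) (\<lambda>p. Psi m (p-1)) (\<lambda>p. Psi m (p-2)) (3*(0+1)) = infsum ?f {(0,1,2)}"
    unfolding alt_sum_def
  proof (rule infsum_cong_neutral)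
    fix x assume x: "x \<in> plane (3*(0+1)) - {(0,1,2)}"
    obtain a b c where abc: "x = (a,b,c)" by (cases x)
    have "a < 0 \<or> b-1 < 0 \<or> c-2 < 0" using x abc by (auto simp: plane_def)
    then show "?f x = 0" unfolding abc by (auto simp: Psi0)
  qed (auto simp: plane_def)
  also have "\<dots> = 1" by (simp add: alt_weight_def Psi_def b1 chi3_def)
  finally show ?case by (simp add: b1)
next
  case (step L)
  let ?X = "\<lambda>n. alt_sum (Psi m) (\<lambda>p. Psi m (p-1)) (\<lambda>p. Psi m (p-2)) (3*n)"
  let ?L = "L + 1"
  have "q powi (1 - 3*?L) * (1 - q powi ?L) * ?X (?L+1) = (q powi ?L - q powi (m+1)) * ?X ?L"
    using alt_sum_recurrence[OF finsupp_Psi Psi_rel, of ?L m] by simp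
  also have "\<dots> = (q powi ?L - q powi (m+1)) * (q powi (2*L*L+L) * qbin m L)"
    using step.IH by simp
  also have "\<dots> = q powi ?L * q powi (2*L*L+L) * ((1 - q powi (m+1-?L)) * qbin m (?L-1))"
  proof -
    have "q powi (m+1) = q powi ?L * q powi (m+1-?L)" using powi_add[of ?L "m+1-?L"] by (simp add: add.commute)
    then show ?thesis by (simp add: algebra_simps)
  qed
  also have "\<dots> = q powi ?L * q powi (2*L*L+L) * ((1 - q powi ?L) * qbin m ?L)"
    by (simp only: qbin_ratio)
  also have "\<dots> = q powi (1 - 3*?L) * (1 - q powi ?L) * (q powi (2*?L*?L+?L) * qbin m ?L)"
  proof -
    have "q powi ?L * q powi (2*L*L+L) = q powi (1 - 3*?L) * q powi (2*?L*?L+?L)"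
      by (simp flip: powi_add add: algebra_simps)
    then show ?thesis by (simp add: mult_ac)
  qed
  finally show ?case using powi_neq_1[of ?L] step by (auto simp: q_nz)
qed

text \<open>The evaluation of the alternating sum, with positions \<open>k1 + L\<close>, \<open>k2 + 1 + L\<close> and
\<open>- k1 - k2 + 2 + L\<close>. Their contributions to the exponent that depend on \<open>L\<close> alone cancel against the
right-hand side.\<close>

lemma base_pair:
  assumes "0 \<le> L" "0 \<le> M" "L \<le> B" "M \<le> B"
  shows "(\<Sum>k1\<in>{-B..B}. \<Sum>k2\<in>{-B..B}. of_int (eps k1 k2) * q powi (nrm k1 k2 + (nrm k1 k2 - 2*k1 - k2) div 3) *
      (qbin (L+M) (L+k1) * qbin (L+M) (L+k2) * qbin (L+M) (L-k1-k2))) = qbin (L+M) L"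
proof -
  define m where "m = L + M"
  define f where "f = (\<lambda>(k1,k2). of_int (eps k1 k2) * q powi (nrm k1 k2 + (nrm k1 k2 - 2*k1 - k2) div 3) *
      (qbin m (L+k1) * qbin m (L+k2) * qbin m (L-k1-k2)))"
  let ?g = "\<lambda>(a, b, c). alt_weight a b c * Psi m a * Psi m (b-1) * Psi m (c-2)"
  let ?t = "\<lambda>(k1,k2). (k1+L, k2+1+L, -k1-k2+2+L)"
  let ?K = "{-B..B} \<times> {-B..B}"
  have Psi0: "Psi m j = 0" if "j < 0 \<or> m < j" for j using that by (simp add: Psi_def qbin_0)
  have g: "?g (?t k) = q powi (2*L*L+L) * f k" for k
  proof (cases k)
    case (Pair k1 k2)
    obtain z where z: "L * (L-1) = z * 2" using consecutive_product_even by blast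
    note ev = consecutive_product_even_Suc
    obtain t1 where t1: "(L+k1)*(L+k1+1) = t1 * 2" using ev by blast
    obtain t2 where t2: "(L+k2)*(L+k2+1) = t2 * 2" using ev by blast
    obtain t3 where t3: "(L-k1-k2)*(L-k1-k2+1) = t3 * 2" using ev by blast
    have s: "t1 + t2 + t3 = nrm k1 k2 + 3*z + 3*L"
      using z t1 t2 t3 unfolding nrm_def by (simp add: algebra_simps)
    let ?a = "k1+L" and ?b = "k2+1+L" and ?c = "-k1-k2+2+L"
    have "?a*?a + ?b*?b + ?c*?c - 3*(?a+?b+?c) + 4 = (nrm k1 k2 - 2*k1 - k2) * 2 + z * 6"
      using z unfolding nrm_def by (simp add: algebra_simps)
    then have T: "(?a*?a + ?b*?b + ?c*?c - 3*(?a+?b+?c) + 4) div 6 = (nrm k1 k2 - 2*k1 - k2) div 3 + z"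
      by simp
    have sg: "chi3 (?b - ?a) = eps k1 k2" unfolding eps_def by (simp add: algebra_simps)
    have p: "Psi m ?a = q powi t1 * qbin m (L+k1)" "Psi m (?b-1) = q powi t2 * qbin m (L+k2)"
         "Psi m (?c-2) = q powi t3 * qbin m (L-k1-k2)"
      unfolding Psi_def using t1 t2 t3 by (simp_all add: algebra_simps)
    have e: "q powi ((nrm k1 k2 - 2*k1 - k2) div 3 + z) * q powi t1 * q powi t2 * q powi t3 =
       q powi (2*L*L+L) * q powi (nrm k1 k2 + (nrm k1 k2 - 2*k1 - k2) div 3)"
    proof -
      have "(nrm k1 k2 - 2*k1 - k2) div 3 + z + t1 + t2 + t3 = 2*L*L+L + (nrm k1 k2 + (nrm k1 k2 - 2*k1 - k2) div 3)"
        using s z by (simp add: algebra_simps)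
      then show ?thesis by (simp only: flip: powi_add)
    qed
    have "?g (?t k) = of_int (eps k1 k2) * (q powi ((nrm k1 k2 - 2*k1 - k2) div 3 + z) * q powi t1 * q powi t2 * q powi t3) *
        (qbin m (L+k1) * qbin m (L+k2) * qbin m (L-k1-k2))"
      unfolding Pair prod.case alt_weight_def T sg p by (simp only: mult_ac)
    then show ?thesis unfolding e f_def Pair prod.case by (simp only: mult_ac)
  qed
  have "q powi (2*L*L+L) * qbin m L = infsum ?g (plane (3*(L+1)))"
    using alt_sum_Psi[of m L] assms unfolding alt_sum_def m_def by simp
  also have "\<dots> = infsum ?g (?t ` ?K)"
  proof (rule infsum_cong_neutral)
    fix x assume x: "x \<in> plane (3*(L+1)) - ?t ` ?K"
    obtain a b c where abc: "x = (a,b,c)" by (cases x)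
    show "?g x = 0"
    proof (rule ccontr)
      assume "?g x \<noteq> 0"
      then have ge: "0 \<le> a" "a \<le> m" "0 \<le> b-1" "b-1 \<le> m" using Psi0 unfolding abc by (auto simp: not_le[symmetric])
      have "x = ?t (a-L, b-1-L)" using x abc by (auto simp: plane_def)
      moreover have "(a-L, b-1-L) \<in> ?K" using ge assms by (auto simp: m_def)
      ultimately show False using x by blast
    qed
  qed (auto simp: plane_def)
  also have "\<dots> = sum ?g (?t ` ?K)" by (rule infsum_finite) auto
  also have "\<dots> = (\<Sum>k\<in>?K. ?g (?t k))" by (rule sum.reindex_cong[of ?t]) (auto simp: inj_on_def)
  also have "\<dots> = q powi (2*L*L+L) * (\<Sum>k\<in>?K. f k)" unfolding g sum_distrib_left ..
  finally have "qbin m L = (\<Sum>k\<in>?K. f k)" by (simp add: q_nz)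
  also have "\<dots> = (\<Sum>k1\<in>{-B..B}. \<Sum>k2\<in>{-B..B}. f (k1,k2))" by (simp add: sum.cartesian_product)
  finally show ?thesis by (simp add: f_def m_def)
qed

lemma q_not_root_inverse: "q_not_root (inverse q)"
  by unfold_locales (auto simp: q_nz q_nr power_inverse)

lemma qfac_inverse: "qfac (inverse q) (int n) = (-1)^n * q powi (- (int n * (int n + 1) div 2)) * qf (int n)"
proof (induction n)
  case 0
  then show ?case by (simp add: qfac_def)
next
  case (Suc n)
  interpret inv: q_not_root "inverse q" by (rule q_not_root_inverse)
  let ?n = "int n"
  have sn: "int (Suc n) = ?n + 1" by simp
  have "(?n+1)*(?n+1+1) = ?n*(?n+1) + (?n+1)*2" by (simp add: algebra_simps)
  then have e: "(?n+1)*(?n+1+1) div 2 = ?n*(?n+1) div 2 + (?n+1)" by simp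
  have a: "q powi (-((?n+1)*(?n+1+1) div 2)) = q powi (-(?n*(?n+1) div 2)) * q powi (-(?n+1))"
    unfolding e by (simp flip: powi_add)
  have b: "1 - inverse q powi (?n+1) = - (q powi (-(?n+1))) * (1 - q powi (?n+1))"
  proof -
    have y: "inverse q powi (?n+1) = q powi (-(?n+1))" by (simp only: power_int_inverse power_int_minus)
    have "q powi (-(?n+1)) * q powi (?n+1) = 1" by (simp flip: powi_add)
    then show ?thesis unfolding y by (simp add: right_diff_distrib)
  qed
  show ?case unfolding sn a using inv.qf_rec[of "?n+1"] qf_rec[of "?n+1"] b Suc by (simp add: mult_ac)
qed

text \<open>The palindromic symmetry of q-binomial coefficients; the signs of the three q-factorials cancel.\<close>

lemma qbin_inverse:
  assumes "n \<ge> 0"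
  shows "q_not_root.qbin (inverse q) n j = q powi (- (j * (n-j))) * qbin n j"
proof -
  interpret inv: q_not_root "inverse q" by (rule q_not_root_inverse)
  show ?thesis
  proof (cases "0 \<le> j \<and> j \<le> n")
    case True
    obtain a where a: "j = int a" using True nonneg_int_cases by blast
    obtain c where c: "n - j = int c" using True nonneg_int_cases[of "n-j"] by auto
    have n: "n = int (a + c)" using a c by simp
    have e: "q powi (- (int (a+c) * (int (a+c) + 1) div 2)) =
       q powi (- (int a * (int a + 1) div 2)) * q powi (- (int c * (int c + 1) div 2)) * q powi (- (int a * int c))"
    proof -
      note ev = consecutive_product_even_Suc
      obtain t1 where t1: "int a * (int a + 1) = t1 * 2" using ev by blast
      obtain t2 where t2: "int c * (int c + 1) = t2 * 2" using ev by blast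
      have "int (a+c) * (int (a+c) + 1) = (t1 + t2 + int a * int c) * 2"
        using t1 t2 by (simp add: algebra_simps)
      then show ?thesis unfolding t1 t2 by (simp flip: powi_add)
    qed
    have "inv.qbin n j = qfac (inverse q) (int (a+c)) / (qfac (inverse q) (int a) * qfac (inverse q) (int c))"
      unfolding inv.qbin_def a[symmetric] c[symmetric] n[symmetric] using True by (simp add: inv_qfac_def)
    also have "\<dots> = q powi (- (int a * int c)) * (qf (int (a+c)) / (qf (int a) * qf (int c)))"
      unfolding qfac_inverse e by (simp add: power_add q_nz)
    also have "\<dots> = q powi (- (j * (n-j))) * qbin n j"
      unfolding qbin_def a[symmetric] c[symmetric] n[symmetric] using True by (simp add: inv_qfac_def)
    finally show ?thesis .
  next
    case False
    then show ?thesis using inv.qbin_0[of j n] qbin_0[of j n] by auto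
  qed
qed

text \<open>The image of \<open>base_pair\<close> under \<open>q \<mapsto> 1/q\<close>, which multiplies each q-binomial coefficient by a
power of \<open>q\<close>.\<close>

lemma base_pair_dual:
  assumes "0 \<le> L" "0 \<le> M" "L \<le> B" "M \<le> B"
  shows "(\<Sum>k1\<in>{-B..B}. \<Sum>k2\<in>{-B..B}. of_int (eps k1 k2) * q powi (nrm k1 k2 - (nrm k1 k2 - 2*k1 - k2) div 3) *
      (qbin (L+M) (L+k1) * qbin (L+M) (L+k2) * qbin (L+M) (L-k1-k2))) = q powi (2*L*M) * qbin (L+M) L"
proof -
  interpret inv: q_not_root "inverse q" by (rule q_not_root_inverse)
  have m0: "L + M \<ge> 0" using assms by simp
  let ?e = "\<lambda>k1 k2. (nrm k1 k2 - 2*k1 - k2) div 3"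
  have "(\<Sum>k1\<in>{-B..B}. \<Sum>k2\<in>{-B..B}. of_int (eps k1 k2) * q powi (nrm k1 k2 - ?e k1 k2) *
      (qbin (L+M) (L+k1) * qbin (L+M) (L+k2) * qbin (L+M) (L-k1-k2))) =
    (\<Sum>k1\<in>{-B..B}. \<Sum>k2\<in>{-B..B}. q powi (3*L*M) * (of_int (eps k1 k2) * inverse q powi (nrm k1 k2 + ?e k1 k2) *
      (inv.qbin (L+M) (L+k1) * inv.qbin (L+M) (L+k2) * inv.qbin (L+M) (L-k1-k2))))"
    (is "(\<Sum>k1\<in>_. \<Sum>k2\<in>_. ?a k1 k2) = (\<Sum>k1\<in>_. \<Sum>k2\<in>_. ?b k1 k2)")
  proof (intro sum.cong[OF refl])
    fix k1 k2
    have "nrm k1 k2 - ?e k1 k2 = 3*L*M + - (nrm k1 k2 + ?e k1 k2) + - ((L+k1)*(L+M-(L+k1))) +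
       - ((L+k2)*(L+M-(L+k2))) + - ((L-k1-k2)*(L+M-(L-k1-k2)))"
      unfolding nrm_def by (simp add: algebra_simps)
    then have e: "q powi (nrm k1 k2 - ?e k1 k2) = q powi (3*L*M) * q powi (- (nrm k1 k2 + ?e k1 k2)) *
      q powi (- ((L+k1)*(L+M-(L+k1)))) * q powi (- ((L+k2)*(L+M-(L+k2)))) * q powi (- ((L-k1-k2)*(L+M-(L-k1-k2))))"
      by (simp only: powi_add)
    have i: "inverse q powi (nrm k1 k2 + ?e k1 k2) = q powi (- (nrm k1 k2 + ?e k1 k2))"
      by (simp only: power_int_inverse power_int_minus)
    show "?a k1 k2 = ?b k1 k2"
      unfolding e i qbin_inverse[OF m0] by (simp only: mult_ac)
  qed
  also have "\<dots> = q powi (3*L*M) * inv.qbin (L+M) L"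
    unfolding sum_distrib_left[symmetric] inv.base_pair[OF assms] ..
  also have "\<dots> = (q powi (3*L*M) * q powi (- (L * (L+M-L)))) * qbin (L+M) L"
    unfolding qbin_inverse[OF m0] by (simp only: mult_ac)
  also have "q powi (3*L*M) * q powi (- (L * (L+M-L))) = q powi (2*L*M)"
    by (simp flip: powi_add add: algebra_simps)
  finally show ?thesis .
qed

end

section \<open>Iterated Bailey pairs\<close>

context q_not_root begin

text \<open>The bound \<open>N\<close> only serves to keep the lattice sum finite: the kernel vanishes unless all entries of the
lattice point lie between \<open>- L\<close> and \<open>M\<close>.\<close>

definition bailey_pair :: "int \<Rightarrow> (int \<Rightarrow> int \<Rightarrow> complex) \<Rightarrow> (int \<Rightarrow> int \<Rightarrow> complex) \<Rightarrow> bool" where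
  "bailey_pair N \<alpha> \<beta> \<longleftrightarrow> (\<forall>L\<in>{0..N}. \<forall>M\<in>{0..N}.
     (\<Sum>k1\<in>{-N..N}. \<Sum>k2\<in>{-N..N}. \<alpha> k1 k2 * kernel L M k1 k2) = \<beta> L M)"

definition bailey_step :: "int \<Rightarrow> (int \<Rightarrow> int \<Rightarrow> complex) \<Rightarrow> int \<Rightarrow> int \<Rightarrow> complex" where
  "bailey_step N \<beta> L M = (\<Sum>r\<in>{0..N}. \<Sum>s\<in>{0..N}. q powi (r*r - r* s + s* s) * iq (L-r) * iq (M-s) * \<beta> r s)"

lemma bailey_pair_step:
  assumes "bailey_pair N \<alpha> \<beta>"
  shows "bailey_pair N (\<lambda>k1 k2. q powi (nrm k1 k2) * \<alpha> k1 k2) (bailey_step N \<beta>)"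
  unfolding bailey_pair_def
proof (intro ballI)
  fix L M assume L: "L \<in> {0..N}" and M: "M \<in> {0..N}"
  let ?c = "\<lambda>r s. q powi (r*r - r* s + s* s) * iq (L-r) * iq (M-s)"
  have "bailey_step N \<beta> L M = (\<Sum>r\<in>{0..L}. \<Sum>s\<in>{0..N}. ?c r s * \<beta> r s)"
    unfolding bailey_step_def by (rule sum.mono_neutral_right) (use L in \<open>auto simp: iq_neg\<close>)
  also have "\<dots> = (\<Sum>r\<in>{0..L}. \<Sum>s\<in>{0..M}. ?c r s * \<beta> r s)"
    by (intro sum.cong[OF refl] sum.mono_neutral_right) (use M in \<open>auto simp: iq_neg\<close>)
  also have "\<dots> = (\<Sum>r\<in>{0..L}. \<Sum>s\<in>{0..M}. \<Sum>k1\<in>{-N..N}. \<Sum>k2\<in>{-N..N}. \<alpha> k1 k2 * (?c r s * kernel r s k1 k2))"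
  proof (intro sum.cong[OF refl])
    fix r s assume "r \<in> {0..L}" "s \<in> {0..M}"
    then have "\<beta> r s = (\<Sum>k1\<in>{-N..N}. \<Sum>k2\<in>{-N..N}. \<alpha> k1 k2 * kernel r s k1 k2)"
      using assms L M unfolding bailey_pair_def by simp
    then show "?c r s * \<beta> r s = (\<Sum>k1\<in>{-N..N}. \<Sum>k2\<in>{-N..N}. \<alpha> k1 k2 * (?c r s * kernel r s k1 k2))"
      by (simp only: sum_distrib_left mult_ac)
  qed
  also have "\<dots> = (\<Sum>k1\<in>{-N..N}. \<Sum>k2\<in>{-N..N}. \<Sum>r\<in>{0..L}. \<Sum>s\<in>{0..M}. \<alpha> k1 k2 * (?c r s * kernel r s k1 k2))"
    unfolding sum.cartesian_product
    by (rule sum.reindex_bij_witness[of _ "\<lambda>(a,b,r,s). (r,s,a,b)" "\<lambda>(r,s,a,b). (a,b,r,s)"]) auto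
  also have "\<dots> = (\<Sum>k1\<in>{-N..N}. \<Sum>k2\<in>{-N..N}. q powi (nrm k1 k2) * \<alpha> k1 k2 * kernel L M k1 k2)"
    unfolding sum_distrib_left[symmetric] using bailey_lemma[of L M] L M
    by (simp add: nrm_def mult_ac)
  finally show "(\<Sum>k1\<in>{-N..N}. \<Sum>k2\<in>{-N..N}. q powi (nrm k1 k2) * \<alpha> k1 k2 * kernel L M k1 k2) = bailey_step N \<beta> L M" ..
qed

lemma bailey_pair_cong:
  assumes "bailey_pair N \<alpha> \<beta>" "\<And>k1 k2. \<alpha> k1 k2 = \<alpha>' k1 k2"
    "\<And>L M. 0 \<le> L \<Longrightarrow> L \<le> N \<Longrightarrow> 0 \<le> M \<Longrightarrow> M \<le> N \<Longrightarrow> \<beta> L M = \<beta>' L M"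
  shows "bailey_pair N \<alpha>' \<beta>'"
  using assms unfolding bailey_pair_def by auto

lemma kernel_qbin: "kernel L M k1 k2 = (qbin (L+M) (L+k1) * qbin (L+M) (L+k2) * qbin (L+M) (L-k1-k2)) / (qf (L+M))\<^sup>2"
  by (simp add: kernel_def qbin_def qf_nz power2_eq_square algebra_simps)

text \<open>The division is exact whenever \<open>eps\<close> does not vanish.\<close>

definition shift_exp :: "int \<Rightarrow> int \<Rightarrow> int" where
  "shift_exp k1 k2 = (nrm k1 k2 - 2*k1 - k2) div 3"

lemma bailey_pair_base:
  "bailey_pair N (\<lambda>k1 k2. of_int (eps k1 k2) * q powi (nrm k1 k2 + shift_exp k1 k2)) (\<lambda>L M. iq L * iq M * iq (L+M))"
  unfolding bailey_pair_def
proof (intro ballI)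
  fix L M assume LM: "L \<in> {0..N}" "M \<in> {0..N}"
  have "(\<Sum>k1\<in>{-N..N}. \<Sum>k2\<in>{-N..N}. of_int (eps k1 k2) * q powi (nrm k1 k2 + shift_exp k1 k2) * kernel L M k1 k2) =
     qbin (L+M) L / (qf (L+M))\<^sup>2"
    using base_pair[of L M N] LM unfolding kernel_qbin shift_exp_def
    by (simp flip: sum_divide_distrib)
  also have "\<dots> = iq L * iq M * iq (L+M)"
    using qf_iq[of "L+M"] LM by (simp add: qbin_def power2_eq_square qf_nz field_simps)
  finally show "(\<Sum>k1\<in>{-N..N}. \<Sum>k2\<in>{-N..N}. of_int (eps k1 k2) * q powi (nrm k1 k2 + shift_exp k1 k2) * kernel L M k1 k2) =
    iq L * iq M * iq (L+M)" .
qed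

lemma bailey_pair_base_dual:
  "bailey_pair N (\<lambda>k1 k2. of_int (eps k1 k2) * q powi (nrm k1 k2 - shift_exp k1 k2)) (\<lambda>L M. q powi (2*L*M) * (iq L * iq M * iq (L+M)))"
  unfolding bailey_pair_def
proof (intro ballI)
  fix L M assume LM: "L \<in> {0..N}" "M \<in> {0..N}"
  have "(\<Sum>k1\<in>{-N..N}. \<Sum>k2\<in>{-N..N}. of_int (eps k1 k2) * q powi (nrm k1 k2 - shift_exp k1 k2) * kernel L M k1 k2) =
     q powi (2*L*M) * qbin (L+M) L / (qf (L+M))\<^sup>2"
    using base_pair_dual[of L M N] LM unfolding kernel_qbin shift_exp_def
    by (simp flip: sum_divide_distrib)
  also have "\<dots> = q powi (2*L*M) * (iq L * iq M * iq (L+M))"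
    using qf_iq[of "L+M"] LM by (simp add: qbin_def power2_eq_square qf_nz field_simps)
  finally show "(\<Sum>k1\<in>{-N..N}. \<Sum>k2\<in>{-N..N}. of_int (eps k1 k2) * q powi (nrm k1 k2 - shift_exp k1 k2) * kernel L M k1 k2) =
    q powi (2*L*M) * (iq L * iq M * iq (L+M))" .
qed

lemma bailey_step_sum: "bailey_step N (\<lambda>L M. \<Sum>x\<in>X. f x L M) L M = (\<Sum>x\<in>X. bailey_step N (f x) L M)"
proof -
  have "bailey_step N (\<lambda>L M. \<Sum>x\<in>X. f x L M) L M = (\<Sum>r\<in>{0..N}. \<Sum>s\<in>{0..N}. \<Sum>x\<in>X. q powi (r*r - r* s + s* s) * iq (L-r) * iq (M-s) * f x r s)"
    unfolding bailey_step_def by (simp add: sum_distrib_left)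
  also have "\<dots> = (\<Sum>x\<in>X. bailey_step N (f x) L M)"
    unfolding bailey_step_def sum.cartesian_product
    by (rule sum.reindex_bij_witness[of _ "\<lambda>(x,r,s). (r,s,x)" "\<lambda>(r,s,x). (x,r,s)"]) auto
  finally show ?thesis .
qed

text \<open>If the second variable enters \<open>\<beta>\<close> through two reciprocals only, a Bailey step preserves this shape: the sum over
\<open>s\<close> is done by \<open>durfee_shifted\<close>, with the new variable \<open>J\<close> in the place of \<open>j\<close>. This is
how one of the two chains of variables disappears in the iteration.\<close>

lemma bailey_step_separated:
  assumes "M \<le> N"
    and "\<And>r. 0 \<le> r \<Longrightarrow> r \<le> N \<Longrightarrow> c r \<noteq> 0 \<Longrightarrow> 0 \<le> j \<and> j \<le> r + R r"
  shows "bailey_step N (\<lambda>r s. c r * iq (s-j) * iq (s + R r)) L M =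
    (\<Sum>r\<in>{0..N}. \<Sum>J\<in>{0..N}. q powi (r*r + J*J - r*J) * iq (L-r) * c r * qbin (r + R r - j) (J-j) * iq (M-J) * iq (M + R r))"
  unfolding bailey_step_def
proof (rule sum.cong[OF refl])
  fix r assume r: "r \<in> {0..N}"
  show "(\<Sum>s\<in>{0..N}. q powi (r*r - r* s + s* s) * iq (L-r) * iq (M-s) * (c r * iq (s-j) * iq (s + R r))) =
    (\<Sum>J\<in>{0..N}. q powi (r*r + J*J - r*J) * iq (L-r) * c r * qbin (r + R r - j) (J-j) * iq (M-J) * iq (M + R r))"
  proof (cases "c r = 0")
    case False
    then have j: "0 \<le> j" "j \<le> r + R r" using assms(2)[of r] r by auto
    have e1: "q powi (r*r - r* s + s* s) = q powi (r*r) * q powi (s* s - r* s)" for s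
      by (simp flip: powi_add add: algebra_simps)
    have e2: "q powi (r*r + J*J - r*J) = q powi (r*r) * q powi (J*J - r*J)" for J
      by (simp flip: powi_add add: algebra_simps)
    have "(\<Sum>s\<in>{0..N}. q powi (r*r - r* s + s* s) * iq (L-r) * iq (M-s) * (c r * iq (s-j) * iq (s + R r))) =
      q powi (r*r) * iq (L-r) * c r * (\<Sum>s\<in>{0..N}. q powi (s* s - r* s) * iq (M-s) * iq (s-j) * iq (s + R r))"
      unfolding sum_distrib_left e1 by (simp only: mult_ac)
    also have "(\<Sum>s\<in>{0..N}. q powi (s* s - r* s) * iq (M-s) * iq (s-j) * iq (s + R r)) =
       (\<Sum>J\<in>{0..N}. q powi (J*J - r*J) * qbin (r + R r - j) (J-j) * iq (M-J) * iq (M + R r))"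
      by (rule durfee_shifted) (use j assms(1) in auto)
    finally show ?thesis unfolding sum_distrib_left e2 by (simp only: mult_ac)
  qed simp
qed

text \<open>For the dual seed the factor \<open>q^(2 L M)\<close> turns \<open>- r s\<close> into \<open>+ r s\<close>, so that the sum over
\<open>s\<close> needs no expansion.\<close>

lemma bailey_step_base_dual:
  assumes "M \<le> N"
  shows "bailey_step N (\<lambda>L M. q powi (2*L*M) * (iq L * iq M * iq (L+M))) L M =
    (\<Sum>r\<in>{0..N}. (q powi (r*r) * iq (L-r) * iq r) * iq (M-0) * iq (M+r))"
  unfolding bailey_step_def
proof (rule sum.cong[OF refl])
  fix r assume r: "r \<in> {0..N}"
  have "(\<Sum>s\<in>{0..N}. q powi (r*r - r* s + s* s) * iq (L-r) * iq (M-s) * (q powi (2*r* s) * (iq r * iq s * iq (r+s)))) =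
    (\<Sum>s\<in>{0..N}. (q powi (r*r) * iq (L-r) * iq r) * (q powi ((s+0)*(s+r)) * iq (M-s) * iq (s+0) * iq (s+r)))" (is "sum ?lt _ = sum ?rt _")
  proof (rule sum.cong[OF refl])
    fix s
    have e: "q powi (r*r - r* s + s* s) * q powi (2*r* s) = q powi (r*r) * q powi ((s+0)*(s+r))"
      by (simp flip: powi_add add: algebra_simps)
    have "q powi (r*r - r* s + s* s) * iq (L-r) * iq (M-s) * (q powi (2*r* s) * (iq r * iq s * iq (r+s))) =
      (q powi (r*r - r* s + s* s) * q powi (2*r* s)) * iq (L-r) * iq (M-s) * (iq r * iq s * iq (s+r))"
      by (simp only: mult_ac add.commute)
    then show "?lt s = ?rt s"
      unfolding e by (simp add: mult_ac)
  qed
  also have "\<dots> = (q powi (r*r) * iq (L-r) * iq r) * (iq (M+0) * iq (M+r))"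
    unfolding sum_distrib_left[symmetric] by (subst durfee) (use assms in auto)
  finally show "(\<Sum>s\<in>{0..N}. q powi (r*r - r* s + s* s) * iq (L-r) * iq (M-s) * (q powi (2*r* s) * (iq r * iq s * iq (r+s)))) =
    (q powi (r*r) * iq (L-r) * iq r) * iq (M-0) * iq (M+r)" by (simp add: mult_ac)
qed

text \<open>A q-Vandermonde split of the coefficient that carries \<open>J\<close>, after which \<open>J = x + y\<close> is replaced by the two
independent variables \<open>x\<close> and \<open>y\<close>. The offsets \<open>a\<close> and \<open>b\<close> are the values of an
earlier split on which the second one is built.\<close>

lemma qbin_split:
  assumes "0 \<le> a" "a \<le> A" "0 \<le> b" "b \<le> B" "A \<le> N" and g: "\<And>J. J > N \<Longrightarrow> g J = 0"
  shows "(\<Sum>J\<in>{0..N}. g J * qbin (A+B-(a+b)) (J-(a+b))) =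
    (\<Sum>x\<in>{0..N}. \<Sum>y\<in>{0..N}. g (x+y) * (q powi ((y-b)*(A-x)) * qbin (A-a) (x-a) * qbin (B-b) (y-b)))"
proof -
  have "(\<Sum>J\<in>{0..N}. g J * qbin (A+B-(a+b)) (J-(a+b))) =
    (\<Sum>J\<in>{0..N}. \<Sum>x\<in>{0..N}. g J * (q powi ((J-x-b)*(A-x)) * qbin (A-a) (x-a) * qbin (B-b) (J-x-b)))"
  proof (rule sum.cong[OF refl])
    fix J
    have "qbin (A+B-(a+b)) (J-(a+b)) = qf ((B-b)+(A-a)) * iq (J-(a+b)) * iq ((B-b)+(A-a)-(J-(a+b)))"
      unfolding qbin_def by (simp add: algebra_simps)
    also have "\<dots> = qf (B-b) * qf (A-a) * (qf ((B-b)+(A-a)) * iq (J-(a+b)) * iq ((B-b)+(A-a)-(J-(a+b))) * iq (B-b) * iq (A-a))"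
    proof -
      have "qf (B-b) * qf (A-a) * (z * iq (B-b) * iq (A-a)) = z * (qf (B-b) * iq (B-b)) * (qf (A-a) * iq (A-a))" for z
        by (simp only: mult_ac)
      then show ?thesis using qf_iq[of "A-a"] qf_iq[of "B-b"] assms by simp
    qed
    also have "\<dots> = qf (B-b) * qf (A-a) * (\<Sum>t\<in>{-a..N-a}. q powi ((J-(a+b)-t)*((A-a)-t)) * iq t * iq ((A-a)-t) * iq (J-(a+b)-t) * iq ((B-b)-(J-(a+b))+t))"
      by (subst vandermonde) (use assms in auto)
    also have "\<dots> = (\<Sum>x\<in>{0..N}. qf (B-b) * qf (A-a) * (q powi ((J-(a+b)-(x-a))*((A-a)-(x-a))) * iq (x-a) * iq ((A-a)-(x-a)) * iq (J-(a+b)-(x-a)) * iq ((B-b)-(J-(a+b))+(x-a))))"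
      unfolding sum_distrib_left
      by (rule sum.reindex_bij_witness[of _ "\<lambda>x. x-a" "\<lambda>t. t+a"]) auto
    also have "\<dots> = (\<Sum>x\<in>{0..N}. q powi ((J-x-b)*(A-x)) * qbin (A-a) (x-a) * qbin (B-b) (J-x-b))" (is "sum ?lt _ = sum ?rt _")
    proof (rule sum.cong[OF refl])
      fix x
      have 1: "J-(a+b)-(x-a) = J-x-b" "(A-a)-(x-a) = A-x" "(B-b)-(J-(a+b))+(x-a) = (B-b)-(J-x-b)"
        by simp_all
      show "?lt x = ?rt x"
        unfolding qbin_def 1 by simp
    qed
    finally show "g J * qbin (A+B-(a+b)) (J-(a+b)) = (\<Sum>x\<in>{0..N}. g J * (q powi ((J-x-b)*(A-x)) * qbin (A-a) (x-a) * qbin (B-b) (J-x-b)))"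
      by (simp add: sum_distrib_left)
  qed
  also have "\<dots> = (\<Sum>x\<in>{0..N}. \<Sum>J\<in>{0..N}. g J * (q powi ((J-x-b)*(A-x)) * qbin (A-a) (x-a) * qbin (B-b) (J-x-b)))"
    by (rule sum.swap)
  also have "\<dots> = (\<Sum>x\<in>{0..N}. \<Sum>y\<in>{0..N}. g (x+y) * (q powi ((y-b)*(A-x)) * qbin (A-a) (x-a) * qbin (B-b) (y-b)))"
  proof (rule sum.cong[OF refl])
    fix x assume x: "x \<in> {0..N}"
    let ?h = "\<lambda>J. g J * (q powi ((J-x-b)*(A-x)) * qbin (A-a) (x-a) * qbin (B-b) (J-x-b))"
    have "(\<Sum>J\<in>{0..N}. ?h J) = (\<Sum>J\<in>{x..x+N}. ?h J)"
    proof -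
      have "qbin (B-b) (J-x-b) = 0" if "J < x" for J
        by (rule qbin_0) (use that assms in linarith)
      then have 1: "?h J = 0" if "J < x" for J using that by simp
      have "(\<Sum>J\<in>{0..N}. ?h J) = (\<Sum>J\<in>{0..x+N}. ?h J)"
        by (rule sum.mono_neutral_left) (use x g in auto)
      also have "\<dots> = (\<Sum>J\<in>{x..x+N}. ?h J)"
      proof (rule sum.mono_neutral_right)
        show "\<forall>J\<in>{0..x+N} - {x..x+N}. ?h J = 0"
        proof
          fix J assume "J \<in> {0..x+N} - {x..x+N}"
          then show "?h J = 0" by (intro 1) auto
        qed
      qed (use x in auto)
      finally show ?thesis .
    qed
    also have "\<dots> = (\<Sum>y\<in>{0..N}. ?h (x+y))"
      by (rule sum.reindex_bij_witness[of _ "\<lambda>y. x+y" "\<lambda>J. J-x"]) auto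
    finally show "(\<Sum>J\<in>{0..N}. ?h J) = (\<Sum>y\<in>{0..N}. g (x+y) * (q powi ((y-b)*(A-x)) * qbin (A-a) (x-a) * qbin (B-b) (y-b)))"
      by simp
  qed
  finally show ?thesis .
qed

text \<open>The second split takes the two variables of the first one as its offsets. Where these are not admissible, a
q-binomial coefficient of the first split vanishes.\<close>

lemma qbin_split_twice:
  assumes "0 \<le> A1" "A1 \<le> A2" "A2 \<le> N" "0 \<le> B1" "B1 \<le> B2" and h: "\<And>j J. J > N \<Longrightarrow> h j J = 0"
  shows "(\<Sum>j\<in>{0..N}. \<Sum>J\<in>{0..N}. h j J * (qbin (A1+B1) j * qbin (A2+B2-j) (J-j))) =
    (\<Sum>a\<in>{0..N}. \<Sum>b\<in>{0..N}. \<Sum>x\<in>{0..N}. \<Sum>y\<in>{0..N}. h (a+b) (x+y) *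
       ((q powi (b*(A1-a)) * qbin A1 a * qbin B1 b) * (q powi ((y-b)*(A2-x)) * qbin (A2-a) (x-a) * qbin (B2-b) (y-b))))"
proof -
  let ?I = "{0..N}"
  define g where "g = (\<lambda>j. \<Sum>J\<in>?I. h j J * qbin (A2+B2-j) (J-j))"
  have g0: "g j = 0" if "j > N" for j
    unfolding g_def by (rule sum.neutral) (use that in \<open>auto simp: qbin_0\<close>)
  have "(\<Sum>j\<in>?I. \<Sum>J\<in>?I. h j J * (qbin (A1+B1) j * qbin (A2+B2-j) (J-j))) = (\<Sum>j\<in>?I. g j * qbin (A1+B1-(0+0)) (j-(0+0)))"
    unfolding g_def sum_distrib_right by (simp add: mult_ac)
  also have "\<dots> = (\<Sum>a\<in>?I. \<Sum>b\<in>?I. g (a+b) * (q powi ((b-0)*(A1-a)) * qbin (A1-0) (a-0) * qbin (B1-0) (b-0)))"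
    by (rule qbin_split) (use assms g0 in auto)
  also have "\<dots> = (\<Sum>a\<in>?I. \<Sum>b\<in>?I. \<Sum>x\<in>?I. \<Sum>y\<in>?I. h (a+b) (x+y) *
       ((q powi (b*(A1-a)) * qbin A1 a * qbin B1 b) * (q powi ((y-b)*(A2-x)) * qbin (A2-a) (x-a) * qbin (B2-b) (y-b))))"
  proof (rule sum.cong[OF refl], rule sum.cong[OF refl])
    fix a b assume ab: "a \<in> ?I" "b \<in> ?I"
    let ?c = "q powi (b*(A1-a)) * qbin A1 a * qbin B1 b"
    let ?d = "\<lambda>x y. q powi ((y-b)*(A2-x)) * qbin (A2-a) (x-a) * qbin (B2-b) (y-b)"
    have "g (a+b) * ?c = (\<Sum>x\<in>?I. \<Sum>y\<in>?I. h (a+b) (x+y) * ?d x y) * ?c"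
    proof (cases "a \<le> A1 \<and> b \<le> B1")
      case True
      have "(\<Sum>J\<in>?I. h (a+b) J * qbin (A2+B2-(a+b)) (J-(a+b))) = (\<Sum>x\<in>?I. \<Sum>y\<in>?I. h (a+b) (x+y) * ?d x y)"
        by (rule qbin_split) (use assms ab True in auto)
      then show ?thesis unfolding g_def by simp
    next
      case False
      then have "?c = 0" by (auto simp: qbin_0)
      then show ?thesis by simp
    qed
    then show "g (a+b) * (q powi ((b-0)*(A1-a)) * qbin (A1-0) (a-0) * qbin (B1-0) (b-0)) =
       (\<Sum>x\<in>?I. \<Sum>y\<in>?I. h (a+b) (x+y) * (?c * ?d x y))"
      unfolding sum_distrib_right by (simp only: mult_ac diff_zero)
  qed
  finally show ?thesis .
qed

end

section \<open>Truncated forms of the identities\<close>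

context q_not_root begin

lemma bailey_pair_step_powi:
  assumes "bailey_pair N (\<lambda>k1 k2. of_int (eps k1 k2) * q powi e k1 k2) \<beta>"
    and e: "\<And>k1 k2. nrm k1 k2 + e k1 k2 = e' k1 k2"
    and "\<And>L M. 0 \<le> M \<Longrightarrow> M \<le> N \<Longrightarrow> bailey_step N \<beta> L M = \<beta>' L M"
  shows "bailey_pair N (\<lambda>k1 k2. of_int (eps k1 k2) * q powi e' k1 k2) \<beta>'"
proof (rule bailey_pair_cong[OF bailey_pair_step[OF assms(1)]])
  fix k1 k2
  show "q powi nrm k1 k2 * (of_int (eps k1 k2) * q powi e k1 k2) = of_int (eps k1 k2) * q powi e' k1 k2"
    unfolding e[symmetric] powi_add by (simp only: mult_ac)
qed (use assms(3) in auto)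

text \<open>For arguments that are nonnegative these are the summands of the series for the semigroups generated by 3 and 4, 5,
7, 8; the argument \<open>n_i\<close> is the entry at the gap \<open>i\<close>.\<close>

definition summand_34 where
  "summand_34 n1 n2 n5 =
     q powi (n1*n1 + n2*n2 + n5*n5 + n1*n2 - n1*n5) *
     (iq n1 * iq n2 * (qf n5 * iq (n5-n2) * iq (n5-n1)))"

definition summand_35 where
  "summand_35 n1 n2 n4 n7 =
     q powi (n1*n1 + n2*n2 + n4*n4 + n7*n7 + n1*n2 - n1*n7 + n2*n4 - n2*n7) *
     (iq n1 * iq n2 * iq (n4-n1) * (qf n7 * iq (n7-n4) * iq (n7-n2)))"

definition summand_37 where
  "summand_37 n1 n2 n4 n5 n8 n11 =
     q powi (n1*n1 + n2*n2 + n4*n4 + n5*n5 + n8*n8 + n11*n11 +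
       n1*n2 - n1*n8 + n2*n4 - n2*n11 + n4*n5 - n4*n11) *
     (iq n1 * iq n2 * iq (n4-n1) * iq (n5-n2) * (qf n8 * iq (n8-n5) * iq (n8-n1)) *
       (qf (n11-n1) * iq (n11-n8) * iq (n11-n4)))"

definition summand_38 where
  "summand_38 n1 n2 n4 n5 n7 n10 n13 =
     q powi (n1*n1 + n2*n2 + n4*n4 + n5*n5 + n7*n7 + n10*n10 + n13*n13 +
       n1*n2 + n2*n4 + n4*n5 + n5*n7 - n2*n10 - n1*n10 - n5*n13 - n4*n13) *
     (iq n1 * iq n2 * iq (n4-n1) * iq (n5-n2) * iq (n7-n4) * (qf n10 * iq (n10-n7) * iq (n10-n2)) *
       (qf (n13-n2) * iq (n13-n10) * iq (n13-n5)))"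

text \<open>One step from the seed of modulus 4, and one split. Here and in the next three lemmas the last three reciprocals
are those that become independent of the summation variables as \<open>N\<close> grows.\<close>

lemma finite_identity_34:
  assumes N: "N \<ge> 0"
  shows "(\<Sum>k1\<in>{-N..N}. \<Sum>k2\<in>{-N..N}. of_int (eps k1 k2) * q powi (2 * nrm k1 k2 + shift_exp k1 k2) * kernel N N k1 k2) =
    (\<Sum>n5\<in>{0..N}. \<Sum>n1\<in>{0..N}. \<Sum>n2\<in>{0..N}. summand_34 n1 n2 n5 * (iq (N-n5) * iq (N-(n1+n2)) * iq (N+n5)))"
    (is "?lhs = ?rhs")
proof -
  let ?I = "{0..N}"
  have b0: "(\<lambda>L M. iq L * iq M * iq (L+M)) = (\<lambda>r s. iq r * iq (s-0) * iq (s + r))"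
    by (simp add: add.commute)
  have "bailey_pair N (\<lambda>k1 k2. of_int (eps k1 k2) * q powi (2 * nrm k1 k2 + shift_exp k1 k2))
      (bailey_step N (\<lambda>r s. iq r * iq (s-0) * iq (s + r)))"
    by (rule bailey_pair_step_powi[OF bailey_pair_base[unfolded b0]]) simp_all
  then have "?lhs = bailey_step N (\<lambda>r s. iq r * iq (s-0) * iq (s + r)) N N"
    unfolding bailey_pair_def using N by auto
  also have "\<dots> = (\<Sum>r\<in>?I. \<Sum>J\<in>?I. q powi (r*r + J*J - r*J) * iq (N-r) * iq r * qbin (r + r - 0) (J-0) * iq (N-J) * iq (N + r))"
    by (rule bailey_step_separated) auto
  also have "\<dots> = ?rhs" (is "sum ?l _ = sum ?r _")
  proof (rule sum.cong[OF refl])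
    fix r assume r: "r \<in> ?I"
    define g where "g = (\<lambda>J. q powi (r*r + J*J - r*J) * iq (N-r) * iq r * iq (N-J) * iq (N + r))"
    have T: "g (x+y) * (q powi ((y-0)*(r-x)) * qbin (r-0) (x-0) * qbin (r-0) (y-0)) =
        summand_34 x y r * (iq (N-r) * iq (N-(x+y)) * iq (N+r))" for x y
    proof -
      have "q powi (x*x + y*y + r*r + x*y - x*r) = q powi (r*r + (x+y)*(x+y) - r*(x+y)) * q powi ((y-0)*(r-x))"
        by (simp flip: powi_add add: algebra_simps)
      then show ?thesis
        unfolding g_def qbin_def summand_34_def using qf_iq[of r] r by (simp add: mult_ac)
    qed
    have "?l r = (\<Sum>J\<in>?I. g J * qbin (r + r - (0+0)) (J-(0+0)))"
      unfolding g_def by (simp add: mult_ac)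
    also have "\<dots> = (\<Sum>x\<in>?I. \<Sum>y\<in>?I. g (x+y) * (q powi ((y-0)*(r-x)) * qbin (r-0) (x-0) * qbin (r-0) (y-0)))"
      by (rule qbin_split) (use r in \<open>auto simp: g_def iq_neg\<close>)
    finally show "?l r = ?r r" unfolding T .
  qed
  finally show ?thesis .
qed

text \<open>The first step from the dual seed eliminates the second chain variable altogether.\<close>

lemma dual_first_step:
  "bailey_pair N (\<lambda>k1 k2. of_int (eps k1 k2) * q powi (2 * nrm k1 k2 - shift_exp k1 k2))
     (\<lambda>L M. \<Sum>r\<in>{0..N}. (q powi (r*r) * iq (L-r) * iq r) * iq (M-0) * iq (M+r))"
  by (rule bailey_pair_step_powi[OF bailey_pair_base_dual]) (simp, rule bailey_step_base_dual)

lemma dual_second_step: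
  assumes "M \<le> N"
  shows "bailey_step N (\<lambda>L M. \<Sum>r\<in>{0..N}. (q powi (r*r) * iq (L-r) * iq r) * iq (M-0) * iq (M+r)) L M =
    (\<Sum>t\<in>{0..N}. \<Sum>s\<in>{0..N}. \<Sum>J\<in>{0..N}. q powi (s* s + J*J - s*J) * iq (L-s) * (q powi (t*t) * iq (s-t) * iq t) *
       qbin (s + t - 0) (J-0) * iq (M-J) * iq (M + t))"
  unfolding bailey_step_sum by (rule sum.cong[OF refl], rule bailey_step_separated) (use assms in auto)

text \<open>Two steps from the seed of modulus 2, and one split.\<close>

lemma finite_identity_35:
  assumes N: "N \<ge> 0"
  shows "(\<Sum>k1\<in>{-N..N}. \<Sum>k2\<in>{-N..N}. of_int (eps k1 k2) * q powi (3 * nrm k1 k2 - shift_exp k1 k2) * kernel N N k1 k2) =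
    (\<Sum>n4\<in>{0..N}. \<Sum>n7\<in>{0..N}. \<Sum>n1\<in>{0..N}. \<Sum>n2\<in>{0..N}.
       summand_35 n1 n2 n4 n7 * (iq (N-n7) * iq (N-(n1+n2)) * iq (N+n4)))"
    (is "?lhs = ?rhs")
proof -
  let ?I = "{0..N}"
  have "bailey_pair N (\<lambda>k1 k2. of_int (eps k1 k2) * q powi (3 * nrm k1 k2 - shift_exp k1 k2))
     (bailey_step N (\<lambda>L M. \<Sum>r\<in>{0..N}. (q powi (r*r) * iq (L-r) * iq r) * iq (M-0) * iq (M+r)))"
    by (rule bailey_pair_step_powi[OF dual_first_step]) simp_all
  then have "?lhs = bailey_step N (\<lambda>L M. \<Sum>r\<in>{0..N}. (q powi (r*r) * iq (L-r) * iq r) * iq (M-0) * iq (M+r)) N N"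
    unfolding bailey_pair_def using N by auto
  also note dual_second_step[OF order_refl]
  also have "(\<Sum>s\<in>?I. \<Sum>r\<in>?I. \<Sum>J\<in>?I. q powi (r*r + J*J - r*J) * iq (N-r) * (q powi (s* s) * iq (r-s) * iq s) *
       qbin (r + s - 0) (J-0) * iq (N-J) * iq (N + s)) = ?rhs"
    (is "(\<Sum>s\<in>_. \<Sum>r\<in>_. ?l s r) = (\<Sum>s\<in>_. \<Sum>r\<in>_. ?r s r)")
  proof (rule sum.cong[OF refl], rule sum.cong[OF refl])
    fix s r assume s: "s \<in> ?I" and r: "r \<in> ?I"
    define g where "g = (\<lambda>J. q powi (r*r + J*J - r*J) * iq (N-r) * (q powi (s* s) * iq (r-s) * iq s) * iq (N-J) * iq (N + s))"
    have T: "g (x+y) * (q powi ((y-0)*(s-x)) * qbin (s-0) (x-0) * qbin (r-0) (y-0)) =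
        summand_35 x y s r * (iq (N-r) * iq (N-(x+y)) * iq (N+s))" for x y
    proof -
      have "q powi (x*x + y*y + s* s + r*r + x*y - x*r + y* s - y*r) =
         q powi (r*r + (x+y)*(x+y) - r*(x+y)) * q powi (s* s) * q powi ((y-0)*(s-x))"
        by (simp flip: powi_add add: algebra_simps)
      then show ?thesis
        unfolding g_def qbin_def summand_35_def using qf_iq[of s] s by (simp add: mult_ac)
    qed
    have "?l s r = (\<Sum>J\<in>?I. g J * qbin (s + r - (0+0)) (J-(0+0)))"
      unfolding g_def by (simp add: mult_ac add.commute)
    also have "\<dots> = (\<Sum>x\<in>?I. \<Sum>y\<in>?I. g (x+y) * (q powi ((y-0)*(s-x)) * qbin (s-0) (x-0) * qbin (r-0) (y-0)))"
      by (rule qbin_split) (use r s in \<open>auto simp: g_def iq_neg\<close>)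
    finally show "?l s r = ?r s r" unfolding T .
  qed
  finally show ?thesis .
qed

text \<open>Two steps from the seed of modulus 4. The second step contributes a q-binomial coefficient whose entries involve the
sum \<open>j = n1 + n2\<close> of the variables of the first split; it is split into \<open>n4 + n5\<close> with \<open>n1\<close> and
\<open>n2\<close> as offsets.\<close>

lemma finite_identity_37:
  assumes N: "N \<ge> 0"
  shows "(\<Sum>k1\<in>{-N..N}. \<Sum>k2\<in>{-N..N}. of_int (eps k1 k2) * q powi (3 * nrm k1 k2 + shift_exp k1 k2) * kernel N N k1 k2) =
    (\<Sum>n8\<in>{0..N}. \<Sum>n11\<in>{0..N}. \<Sum>n1\<in>{0..N}. \<Sum>n2\<in>{0..N}. \<Sum>n4\<in>{0..N}. \<Sum>n5\<in>{0..N}.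
       summand_37 n1 n2 n4 n5 n8 n11 * (iq (N-n11) * iq (N-(n4+n5)) * iq (N+n8)))"
    (is "?lhs = ?rhs")
proof -
  let ?I = "{0..N}"
  define c where "c = (\<lambda>r j L. q powi (r*r + j*j - r*j) * iq (L-r) * iq r * qbin (r + r) j)"
  define \<beta>1 where "\<beta>1 = (\<lambda>L M. \<Sum>r\<in>?I. \<Sum>j\<in>?I. c r j L * iq (M-j) * iq (M+r))"
  have b0: "(\<lambda>L M. iq L * iq M * iq (L+M)) = (\<lambda>r s. iq r * iq (s-0) * iq (s + r))"
    by (simp add: add.commute)
  have r1: "bailey_step N (\<lambda>r s. iq r * iq (s-0) * iq (s + r)) L M = \<beta>1 L M" if "M \<le> N" for L M
    by (subst bailey_step_separated) (use that in \<open>auto simp: \<beta>1_def c_def\<close>)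
  have "bailey_pair N (\<lambda>k1 k2. of_int (eps k1 k2) * q powi (2 * nrm k1 k2 + shift_exp k1 k2)) \<beta>1"
    by (rule bailey_pair_step_powi[OF bailey_pair_base[unfolded b0]]) (simp, rule r1)
  then have "bailey_pair N (\<lambda>k1 k2. of_int (eps k1 k2) * q powi (3 * nrm k1 k2 + shift_exp k1 k2)) (bailey_step N \<beta>1)"
    by (rule bailey_pair_step_powi) simp_all
  then have "?lhs = bailey_step N \<beta>1 N N"
    unfolding bailey_pair_def using N by auto
  also have "\<dots> = (\<Sum>s\<in>?I. \<Sum>j\<in>?I. \<Sum>r\<in>?I. \<Sum>J\<in>?I. q powi (r*r + J*J - r*J) * iq (N-r) * c s j r * qbin (r + s - j) (J-j) * iq (N-J) * iq (N + s))"
    unfolding \<beta>1_def bailey_step_sum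
  proof (intro sum.cong[OF refl], rule bailey_step_separated)
    fix s j r assume "s \<in> ?I" "j \<in> ?I" "c s j r \<noteq> 0"
    then have "0 \<le> j" "iq (r-s) \<noteq> 0" "qbin (s+s) j \<noteq> 0" by (auto simp: c_def)
    then have "0 \<le> j" "\<not> r - s < 0" "\<not> s + s < j" using iq_neg qbin_0 by blast+
    then show "0 \<le> j \<and> j \<le> r + s" by linarith
  qed simp
  also have "\<dots> = (\<Sum>s\<in>?I. \<Sum>r\<in>?I. \<Sum>j\<in>?I. \<Sum>J\<in>?I. q powi (r*r + J*J - r*J) * iq (N-r) * c s j r * qbin (r + s - j) (J-j) * iq (N-J) * iq (N + s))"
    by (intro sum.cong[OF refl] sum.swap)
  also have "\<dots> = ?rhs" (is "(\<Sum>s\<in>_. \<Sum>r\<in>_. ?l s r) = (\<Sum>s\<in>_. \<Sum>r\<in>_. ?r s r)")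
  proof (rule sum.cong[OF refl], rule sum.cong[OF refl])
    fix s r assume s: "s \<in> ?I" and r: "r \<in> ?I"
    define h where "h = (\<lambda>j J. q powi (r*r + J*J - r*J) * iq (N-r) * iq (N-J) * iq (N + s) *
       (q powi (s* s + j*j - s*j) * iq (r-s) * iq s))"
    \<comment> \<open>The coefficient with upper entry \<open>s - b\<close> cancels a reciprocal of the first split; for \<open>b > s\<close> both sides vanish.\<close>
    have T: "h (a+b) (x+y) * ((q powi (b*(s-a)) * qbin s a * qbin s b) *
          (q powi ((y-b)*(r-x)) * qbin (r-a) (x-a) * qbin (s-b) (y-b))) =
        summand_37 a b x y s r * (iq (N-r) * iq (N-(x+y)) * iq (N+s))" for a b x y
    proof (cases "b \<le> s")
      case True
      have "q powi (a*a + b*b + x*x + y*y + s* s + r*r + a*b - a* s + b*x - b*r + x*y - x*r) =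
         q powi (r*r + (x+y)*(x+y) - r*(x+y)) * q powi (s* s + (a+b)*(a+b) - s*(a+b)) *
         q powi ((y-b)*(r-x)) * q powi (b*(s-a))"
        by (simp flip: powi_add add: algebra_simps)
      moreover have "r-a-(x-a) = r-x" "s-b-(y-b) = s-y" by simp_all
      ultimately show ?thesis
        unfolding h_def qbin_def summand_37_def using qf_iq[of s] qf_iq[of "s-b"] s True
        by (simp add: mult_ac)
    next
      case False
      then have "iq (y-b) * iq (s-y) = 0" by (cases "y < b") (simp_all add: iq_neg)
      then show ?thesis using False by (auto simp: summand_37_def qbin_0)
    qed
    have l: "?l s r = (\<Sum>j\<in>?I. \<Sum>J\<in>?I. h j J * (qbin (s+s) j * qbin (r+s-j) (J-j)))"
      unfolding h_def c_def by (simp add: mult_ac)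
    show "?l s r = ?r s r"
    proof (cases "s \<le> r")
      case True
      have "?l s r = (\<Sum>a\<in>?I. \<Sum>b\<in>?I. \<Sum>x\<in>?I. \<Sum>y\<in>?I. h (a+b) (x+y) * ((q powi (b*(s-a)) * qbin s a * qbin s b) *
          (q powi ((y-b)*(r-x)) * qbin (r-a) (x-a) * qbin (s-b) (y-b))))"
        unfolding l by (rule qbin_split_twice) (use s r True in \<open>auto simp: h_def iq_neg\<close>)
      then show ?thesis unfolding T .
    next
      case False
      then have "iq (r-s) = 0" by (simp add: iq_neg)
      then show ?thesis unfolding l by (simp add: h_def summand_37_def)
    qed
  qed
  finally show ?thesis .
qed

text \<open>Three steps from the seed of modulus 2; the splits are arranged as for \<open>b = 7\<close>.\<close>

lemma finite_identity_38:
  assumes N: "N \<ge> 0"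
  shows "(\<Sum>k1\<in>{-N..N}. \<Sum>k2\<in>{-N..N}. of_int (eps k1 k2) * q powi (4 * nrm k1 k2 - shift_exp k1 k2) * kernel N N k1 k2) =
    (\<Sum>n7\<in>{0..N}. \<Sum>n10\<in>{0..N}. \<Sum>n13\<in>{0..N}. \<Sum>n1\<in>{0..N}. \<Sum>n2\<in>{0..N}. \<Sum>n4\<in>{0..N}. \<Sum>n5\<in>{0..N}.
       summand_38 n1 n2 n4 n5 n7 n10 n13 * (iq (N-n13) * iq (N-(n4+n5)) * iq (N+n7)))"
    (is "?lhs = ?rhs")
proof -
  let ?I = "{0..N}"
  define c where "c = (\<lambda>t s j L. q powi (s* s + j*j - s*j) * iq (L-s) * (q powi (t*t) * iq (s-t) * iq t) * qbin (s + t) j)"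
  define \<beta>2 where "\<beta>2 = (\<lambda>L M. \<Sum>t\<in>?I. \<Sum>s\<in>?I. \<Sum>j\<in>?I. c t s j L * iq (M-j) * iq (M+t))"
  have "bailey_pair N (\<lambda>k1 k2. of_int (eps k1 k2) * q powi (3 * nrm k1 k2 - shift_exp k1 k2)) \<beta>2"
    by (rule bailey_pair_step_powi[OF dual_first_step]) (simp, subst dual_second_step, simp_all add: \<beta>2_def c_def)
  then have "bailey_pair N (\<lambda>k1 k2. of_int (eps k1 k2) * q powi (4 * nrm k1 k2 - shift_exp k1 k2)) (bailey_step N \<beta>2)"
    by (rule bailey_pair_step_powi) simp_all
  then have "?lhs = bailey_step N \<beta>2 N N"
    unfolding bailey_pair_def using N by auto
  also have "\<dots> = (\<Sum>t\<in>?I. \<Sum>s\<in>?I. \<Sum>j\<in>?I. \<Sum>r\<in>?I. \<Sum>J\<in>?I. q powi (r*r + J*J - r*J) * iq (N-r) * c t s j r * qbin (r + t - j) (J-j) * iq (N-J) * iq (N + t))"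
    unfolding \<beta>2_def bailey_step_sum
  proof (intro sum.cong[OF refl], rule bailey_step_separated)
    fix t s j r assume "t \<in> ?I" "s \<in> ?I" "j \<in> ?I" "c t s j r \<noteq> 0"
    then have "0 \<le> j" "iq (r-s) \<noteq> 0" "qbin (s+t) j \<noteq> 0" by (auto simp: c_def)
    then have "0 \<le> j" "\<not> r - s < 0" "\<not> s + t < j" using iq_neg qbin_0 by blast+
    then show "0 \<le> j \<and> j \<le> r + t" by linarith
  qed simp
  also have "\<dots> = (\<Sum>t\<in>?I. \<Sum>s\<in>?I. \<Sum>r\<in>?I. \<Sum>j\<in>?I. \<Sum>J\<in>?I. q powi (r*r + J*J - r*J) * iq (N-r) * c t s j r * qbin (r + t - j) (J-j) * iq (N-J) * iq (N + t))"
    by (intro sum.cong[OF refl] sum.swap)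
  also have "\<dots> = ?rhs" (is "(\<Sum>t\<in>_. \<Sum>s\<in>_. \<Sum>r\<in>_. ?l t s r) = (\<Sum>t\<in>_. \<Sum>s\<in>_. \<Sum>r\<in>_. ?r t s r)")
  proof (rule sum.cong[OF refl], rule sum.cong[OF refl], rule sum.cong[OF refl])
    fix t s r assume t: "t \<in> ?I" and s: "s \<in> ?I" and r: "r \<in> ?I"
    define h where "h = (\<lambda>j J. q powi (r*r + J*J - r*J) * iq (N-r) * iq (N-J) * iq (N + t) *
       (q powi (s* s + j*j - s*j) * iq (r-s) * (q powi (t*t) * iq (s-t) * iq t)))"
    \<comment> \<open>Here the coefficient with upper entry \<open>t - a\<close> is the one that cancels.\<close>
    have T: "h (a+b) (x+y) * ((q powi (b*(t-a)) * qbin t a * qbin s b) *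
          (q powi ((y-b)*(t-x)) * qbin (t-a) (x-a) * qbin (r-b) (y-b))) =
        summand_38 a b x y t s r * (iq (N-r) * iq (N-(x+y)) * iq (N+t))" for a b x y
    proof (cases "a \<le> t")
      case True
      have "q powi (a*a + b*b + x*x + y*y + t*t + s* s + r*r + a*b + b*x + x*y + y*t - b* s - a* s - y*r - x*r) =
         q powi (r*r + (x+y)*(x+y) - r*(x+y)) * q powi (s* s + (a+b)*(a+b) - s*(a+b)) * q powi (t*t) *
         q powi ((y-b)*(t-x)) * q powi (b*(t-a))"
        by (simp flip: powi_add add: algebra_simps)
      moreover have "t-a-(x-a) = t-x" "r-b-(y-b) = r-y" by simp_all
      ultimately show ?thesis
        unfolding h_def qbin_def summand_38_def using qf_iq[of t] qf_iq[of "t-a"] t True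
        by (simp add: mult_ac)
    next
      case False
      then have "iq (x-a) * iq (t-x) = 0" by (cases "x < a") (simp_all add: iq_neg)
      then show ?thesis using False by (auto simp: summand_38_def qbin_0)
    qed
    have l: "?l t s r = (\<Sum>j\<in>?I. \<Sum>J\<in>?I. h j J * (qbin (t+s) j * qbin (t+r-j) (J-j)))"
      unfolding h_def c_def by (simp add: mult_ac add.commute)
    show "?l t s r = ?r t s r"
    proof (cases "s \<le> r")
      case True
      have "?l t s r = (\<Sum>a\<in>?I. \<Sum>b\<in>?I. \<Sum>x\<in>?I. \<Sum>y\<in>?I. h (a+b) (x+y) * ((q powi (b*(t-a)) * qbin t a * qbin s b) *
          (q powi ((y-b)*(t-x)) * qbin (t-a) (x-a) * qbin (r-b) (y-b))))"
        unfolding l by (rule qbin_split_twice) (use t s r True in \<open>auto simp: h_def iq_neg\<close>)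
      then show ?thesis unfolding T .
    next
      case False
      then have "iq (r-s) = 0" by (simp add: iq_neg)
      then show ?thesis unfolding l by (simp add: h_def summand_38_def)
    qed
  qed
  finally show ?thesis .
qed

end

section \<open>Theta functions and the denominator identity\<close>

abbreviation norm_summable_on :: "('a \<Rightarrow> 'b::real_normed_vector) \<Rightarrow> 'a set \<Rightarrow> bool" (infixr "norm'_summable'_on" 46) where
  "f norm_summable_on A \<equiv> (\<lambda>x. norm (f x)) summable_on A"

text \<open>Tannery's theorem for unordered sums.\<close>

lemma tendsto_infsum_dominated:
  fixes f :: "'a \<Rightarrow> nat \<Rightarrow> complex"
  assumes lim: "\<And>x. x \<in> A \<Longrightarrow> f x \<longlonglongrightarrow> g x"
    and bound: "\<And>x n. x \<in> A \<Longrightarrow> norm (f x n) \<le> M x"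
    and M: "M summable_on A"
  shows "(\<lambda>n. \<Sum>\<^sub>\<infinity>x\<in>A. f x n) \<longlonglongrightarrow> (\<Sum>\<^sub>\<infinity>x\<in>A. g x)"
proof (rule swap_uniform_limit')
  have gM: "norm (g x) \<le> M x" if "x \<in> A" for x
    by (rule tendsto_upperbound[OF tendsto_norm[OF lim[OF that]]]) (use bound that in auto)
  have "g summable_on A"
    by (rule Infinite_Sum.abs_summable_summable, rule Infinite_Sum.abs_summable_on_comparison_test'[OF M]) (rule gM)
  then show "((\<lambda>X. \<Sum>x\<in>X. g x) \<longlongrightarrow> (\<Sum>\<^sub>\<infinity>x\<in>A. g x)) (finite_subsets_at_top A)"
    by (rule infsum_tendsto)
  show "\<forall>\<^sub>F X in finite_subsets_at_top A. (\<lambda>n. \<Sum>x\<in>X. f x n) \<longlonglongrightarrow> (\<Sum>x\<in>X. g x)"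
    by (rule eventually_finite_subsets_at_top_weakI) (auto intro!: tendsto_sum lim)
  show "\<forall>\<^sub>F n in sequentially. n \<in> (UNIV :: nat set)" by simp
  show "uniform_limit UNIV (\<lambda>X n. \<Sum>x\<in>X. f x n) (\<lambda>n. \<Sum>\<^sub>\<infinity>x\<in>A. f x n) (finite_subsets_at_top A)"
    by (rule Weierstrass_m_test_general[OF _ M]) (rule bound)
qed auto

lemma abs_summable_Times:
  fixes f :: "'a \<Rightarrow> complex" and g :: "'b \<Rightarrow> complex"
  assumes f: "f norm_summable_on A" and g: "g norm_summable_on B"
  shows "(\<lambda>(x,y). f x * g y) norm_summable_on (A \<times> B)"
  unfolding Infinite_Sum.abs_summable_on_Sigma_iff
proof (intro conjI ballI)
  fix x
  show "(\<lambda>y. case (x,y) of (x,y) \<Rightarrow> f x * g y) norm_summable_on B"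
    using summable_on_cmult_right[OF g, of "norm (f x)"] by (simp add: norm_mult)
next
  have "(\<lambda>x. infsum (\<lambda>y. norm (case (x,y) of (x,y) \<Rightarrow> f x * g y)) B) = (\<lambda>x. norm (f x) * infsum (\<lambda>y. norm (g y)) B)"
    by (simp add: norm_mult infsum_cmult_right')
  then show "(\<lambda>x. infsum (\<lambda>y. norm (case (x,y) of (x,y) \<Rightarrow> f x * g y)) B) norm_summable_on A"
    using summable_on_cmult_left[OF f, of "infsum (\<lambda>y. norm (g y)) B"]
    by (simp add: norm_mult infsum_nonneg)
qed

lemma infsum_Times:
  fixes f :: "'a \<Rightarrow> complex" and g :: "'b \<Rightarrow> complex"
  assumes f: "f norm_summable_on A" and g: "g norm_summable_on B"
  shows "(\<Sum>\<^sub>\<infinity>(x,y)\<in>A \<times> B. f x * g y) = infsum f A * infsum g B"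
proof -
  have "(\<Sum>\<^sub>\<infinity>(x,y)\<in>A \<times> B. f x * g y) = (\<Sum>\<^sub>\<infinity>x\<in>A. \<Sum>\<^sub>\<infinity>y\<in>B. f x * g y)"
    by (subst infsum_Sigma_banach[symmetric]) (use abs_summable_Times[OF f g] in \<open>auto intro: Infinite_Sum.abs_summable_summable\<close>)
  also have "\<dots> = infsum f A * infsum g B"
    by (simp add: infsum_cmult_right' infsum_cmult_left')
  finally show ?thesis .
qed

definition qinf :: "complex \<Rightarrow> complex" where
  "qinf q = (\<Prod>i. 1 - q ^ Suc i)"

definition theta_term :: "complex \<Rightarrow> complex \<Rightarrow> int \<Rightarrow> complex" where
  "theta_term q x k = (-1) powi k * q powi (k * (k-1) div 2) * x powi k"

definition theta :: "complex \<Rightarrow> complex \<Rightarrow> complex" where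
  "theta q x = (\<Sum>\<^sub>\<infinity>k. theta_term q x k)"

locale q_disc =
  fixes q :: complex
  assumes q_nz: "q \<noteq> 0" and q_lt_1: "norm q < 1"
begin

sublocale q_not_root q
proof
  fix n :: nat assume "n > 0"
  show "q ^ n \<noteq> 1"
  proof
    assume "q ^ n = 1"
    then have "norm q ^ n = 1" by (metis norm_one norm_power)
    then show False using q_lt_1 \<open>n > 0\<close> power_less_one_iff[of "norm q" n] by simp
  qed
qed (rule q_nz)

lemma convergent_prod_q: "convergent_prod (\<lambda>i. 1 - q ^ Suc i)"
proof (rule abs_convergent_prod_imp_convergent_prod, rule summable_imp_abs_convergent_prod)
  have "summable (\<lambda>i. norm q * norm q ^ i)"
    by (intro summable_mult summable_geometric) (use q_lt_1 in simp)
  then show "summable (\<lambda>i. norm (1 - q ^ Suc i - 1))" by (simp add: norm_mult norm_power)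
qed

lemma qinf_nz: "qinf q \<noteq> 0"
  unfolding qinf_def by (rule prodinf_nonzero[OF convergent_prod_q]) (use q_nr[of "Suc _"] in auto)

lemma qf_of_nat: "qf (int n) = (\<Prod>i<n. 1 - q ^ Suc i)"
proof -
  have "(\<Prod>i<n. 1 - q ^ Suc i) = (\<Prod>j=1..n. 1 - q ^ j)"
    by (rule prod.reindex_bij_witness[of _ "\<lambda>j. j - 1" Suc]) auto
  then show ?thesis by (simp add: qfac_def)
qed

lemma qf_lim: "(\<lambda>n. qf (int n)) \<longlonglongrightarrow> qinf q"
proof -
  have "(\<lambda>n. \<Prod>i\<le>n. 1 - q ^ Suc i) \<longlonglongrightarrow> qinf q"
    unfolding qinf_def by (rule convergent_prod_LIMSEQ[OF convergent_prod_q])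
  then have "(\<lambda>n. qf (int (Suc n))) \<longlonglongrightarrow> qinf q"
    unfolding qf_of_nat lessThan_Suc_atMost .
  then show ?thesis by (subst (asm) filterlim_sequentially_Suc)
qed

lemma qf_lim': "filterlim f at_top sequentially \<Longrightarrow> (\<lambda>n. qf (int (f n))) \<longlonglongrightarrow> qinf q"
  using filterlim_compose[OF qf_lim] by blast

lemma shift_at_top: "filterlim (\<lambda>n. nat (int n + k)) at_top sequentially"
  unfolding filterlim_at_top eventually_sequentially
  by (metis add.commute add_le_cancel_right le_add_diff_inverse nat_le_eq_zle nat_int nat_mono order_trans
      zle_iff_zadd linorder_linear nat_le_iff diff_add_cancel le_diff_eq)

lemma iq_lim: "(\<lambda>n. iq (int n + k)) \<longlonglongrightarrow> 1 / qinf q"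
proof -
  have "(\<lambda>n. 1 / qf (int (nat (int n + k)))) \<longlonglongrightarrow> 1 / qinf q"
    by (intro tendsto_divide tendsto_const qf_lim' shift_at_top qinf_nz)
  moreover have "\<forall>\<^sub>F n in sequentially. 1 / qf (int (nat (int n + k))) = iq (int n + k)"
    using eventually_ge_at_top[of "nat (- k)"] by eventually_elim (auto simp: inv_qfac_def)
  ultimately show ?thesis by (rule Lim_transform_eventually)
qed

lemma qfac_bounded: "\<exists>C\<ge>1. \<forall>m. norm (qf m) \<le> C \<and> norm (iq m) \<le> C"
proof -
  have "Bseq (\<lambda>n. qf (int n))" using qf_lim by (intro convergent_imp_Bseq) (auto simp: convergent_def)
  then obtain C1 where C1: "\<And>n. norm (qf (int n)) \<le> C1" by (auto simp: Bseq_def)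
  have "Bseq (\<lambda>n. iq (int n))" using iq_lim[of 0] by (intro convergent_imp_Bseq) (auto simp: convergent_def)
  then obtain C2 where C2: "\<And>n. norm (iq (int n)) \<le> C2" by (auto simp: Bseq_def)
  let ?C = "max 1 (max C1 C2)"
  have "norm (qf m) \<le> ?C \<and> norm (iq m) \<le> ?C" for m
  proof (cases "m \<ge> 0")
    case True
    then show ?thesis using C1[of "nat m"] C2[of "nat m"] by auto
  next
    case False
    then show ?thesis by (simp add: qfac_def inv_qfac_def)
  qed
  then show ?thesis by (intro exI[of _ ?C]) auto
qed

lemma theta_term_reflect:
  assumes "x \<noteq> 0"
  shows "theta_term q x (- k) = theta_term q (q / x) k"
proof -
  have "(- k) * (- k - 1) = k * (k - 1) + k * 2" by (simp add: algebra_simps)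
  then have e: "(- k) * (- k - 1) div 2 = k * (k - 1) div 2 + k" by simp
  have s: "(-1 :: complex) powi (- k) = (-1) powi k" by (simp add: power_int_minus power_int_inverse[symmetric])
  have d: "(q / x) powi k = q powi k * x powi (- k)"
    by (simp add: power_int_divide_distrib power_int_minus field_simps)
  show ?thesis unfolding theta_term_def e powi_add s d by (simp only: mult_ac)
qed

lemma theta_term_summable_nat:
  assumes "x \<noteq> 0"
  shows "summable (\<lambda>n. norm (theta_term q x (int n)))"
proof -
  have step: "norm (theta_term q x (int (Suc n))) = norm q ^ n * norm x * norm (theta_term q x (int n))" for n
  proof -
    have "int (Suc n) * (int (Suc n) - 1) = int n * (int n - 1) + int n * 2" by (simp add: algebra_simps)
    then have e: "int (Suc n) * (int (Suc n) - 1) div 2 = int n * (int n - 1) div 2 + int n" by simp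
    show ?thesis unfolding theta_term_def e powi_add
      by (simp add: norm_mult norm_power power_int_def nat_add_distrib)
  qed
  have "(\<lambda>n. norm q ^ n * norm x) \<longlonglongrightarrow> 0 * norm x"
    by (intro tendsto_mult tendsto_const LIMSEQ_power_zero) (use q_lt_1 in simp)
  then have "\<forall>\<^sub>F n in sequentially. norm q ^ n * norm x < 1/2"
    by (rule order_tendstoD(2)) simp
  then obtain N where N: "\<And>n. n \<ge> N \<Longrightarrow> norm q ^ n * norm x < 1/2" by (auto simp: eventually_sequentially)
  show ?thesis
  proof (rule summable_ratio_test[of "1/2" N])
    fix n assume "n \<ge> N"
    then have "norm q ^ n * norm x * norm (theta_term q x (int n)) \<le> 1/2 * norm (theta_term q x (int n))"
      using N[of n] by (intro mult_right_mono) auto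
    then show "norm (norm (theta_term q x (int (Suc n)))) \<le> 1/2 * norm (norm (theta_term q x (int n)))"
      using step[of n] by simp
  qed simp
qed

lemma theta_term_abs_summable:
  assumes "x \<noteq> 0"
  shows "theta_term q x norm_summable_on UNIV"
proof -
  have pos: "theta_term q x norm_summable_on range int" if "x \<noteq> 0" for x
    by (subst summable_on_reindex) (use theta_term_summable_nat[OF that] in
        \<open>auto simp: o_def summable_on_UNIV_nonneg_real_iff\<close>)
  have "theta_term q x norm_summable_on uminus ` range int"
    by (subst summable_on_reindex)
       (use pos[of "q / x"] assms q_nz in \<open>auto simp: o_def theta_term_reflect\<close>)
  then have "theta_term q x norm_summable_on (range int \<union> (uminus ` range int - range int))"
    by (intro summable_on_Un_disjoint pos assms) (auto elim: summable_on_subset_banach)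
  moreover have "range int \<union> (uminus ` range int - range int) = UNIV"
    by (auto simp: image_iff) (metis int_cases2)
  ultimately show ?thesis by simp
qed

lemma theta_reflect: "x \<noteq> 0 \<Longrightarrow> theta q (q / x) = theta q x"
  unfolding theta_def
  by (rule infsum_reindex_bij_witness[of _ uminus uminus]) (auto simp: theta_term_reflect)

text \<open>The involution \<open>k \<mapsto> 1 - k\<close> reverses the sign of every term.\<close>

lemma theta_one: "theta q 1 = 0"
proof -
  have "theta q 1 = (\<Sum>\<^sub>\<infinity>k. - theta_term q 1 k)"
    unfolding theta_def
  proof (rule infsum_reindex_bij_witness[of _ "\<lambda>k. 1-k" "\<lambda>k. 1-k"])
    fix k :: int
    have "(1-k) * (1-k-1) = k * (k-1)" by (simp add: algebra_simps)
    moreover have "(-1 :: complex) powi (1-k) = - ((-1) powi k)"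
      by (simp add: power_int_diff power_int_minus_left) 
    ultimately show "- theta_term q 1 (1-k) = theta_term q 1 k"
      by (simp add: theta_term_def)
  qed auto
  then show ?thesis by (simp add: infsum_uminus theta_def)
qed

text \<open>Quasi-periodicity, from the shift \<open>k \<mapsto> k + m\<close> of the summation index.\<close>

lemma theta_shift:
  assumes "x \<noteq> 0"
  shows "theta q (q powi m * x) = (-1) powi m * x powi (- m) * q powi (- (m * (m-1) div 2)) * theta q x"
proof -
  have "theta q (q powi m * x) = (\<Sum>\<^sub>\<infinity>k. (-1) powi m * x powi (- m) * q powi (- (m * (m-1) div 2)) * theta_term q x k)"
    unfolding theta_def
  proof (rule infsum_reindex_bij_witness[of _ "\<lambda>k. k-m" "\<lambda>k. k+m"])
    fix k :: int
    obtain a where a: "k * (k-1) = a * 2" using consecutive_product_even by blast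
    obtain b where b: "m * (m-1) = b * 2" using consecutive_product_even by blast
    have "(k+m) * (k+m-1) = (a + b + k * m) * 2" using a b by (simp add: algebra_simps)
    then have e: "(k+m) * (k+m-1) div 2 = a + b + k * m" by simp
    have s: "(-1 :: complex) powi (k+m) = (-1) powi k * (-1) powi m" by (simp add: power_int_add)
    have s1: "(-1 :: complex) powi m * (-1) powi m = 1" by (simp flip: power_int_mult_distrib)
    have x: "x powi (k+m) = x powi k * x powi m" "x powi (- m) * x powi m = 1"
      using assms by (simp_all add: power_int_add flip: power_int_add)
    have p: "q powi (- b) * q powi (a + b + k * m) = q powi a * (q powi m) powi k"
      by (simp flip: powi_add power_int_mult add: mult.commute)
    have "(-1) powi m * x powi (- m) * q powi (- b) * ((-1) powi (k+m) * q powi (a + b + k * m) * x powi (k+m)) =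
       ((-1) powi m * (-1) powi m) * (x powi (- m) * x powi m) * (q powi (- b) * q powi (a + b + k * m)) * (-1) powi k * x powi k"
      unfolding s x(1) by (simp only: mult_ac)
    also have "\<dots> = (-1) powi k * q powi a * (q powi m * x) powi k"
      unfolding s1 x p by (simp add: power_int_mult_distrib mult_ac)
    finally show "(-1) powi m * x powi (- m) * q powi (- (m * (m-1) div 2)) * theta_term q x (k+m) = theta_term q (q powi m * x) k"
      unfolding theta_term_def e a b by simp
  qed auto
  then show ?thesis unfolding infsum_cmult_right' theta_def[symmetric] .
qed

text \<open>In the induction step the q-Pascal rule turns the sum at \<open>z\<close> into the one at \<open>q z\<close> times \<open>1 - z\<close>,
which removes the first factor of the product.\<close>

lemma q_binomial:
  "(\<Sum>j\<in>{0..int m}. (-1) powi j * q powi (j * (j-1) div 2) * qbin (int m) j * z powi j) = (\<Prod>i<m. 1 - z * q ^ i)"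
proof (induction m arbitrary: z)
  case 0
  then show ?case by (simp add: qbin_def iq_0 qfac_def)
next
  case (Suc m)
  let ?m = "int m"
  define F where "F = (\<lambda>n z j. (-1) powi j * q powi (j * (j-1) div 2) * qbin n j * z powi j)"
  have F: "F (?m+1) z j = F ?m (z * q) j - z * F ?m (z * q) (j-1)" if "z \<noteq> 0" for j
  proof -
    have "j * (j-1) = (j-1) * (j-1-1) + (j-1) * 2" by (simp add: algebra_simps)
    then have e: "j * (j-1) div 2 = (j-1) * (j-1-1) div 2 + (j-1)" by simp
    have s: "(-1 :: complex) powi (j-1) = - ((-1) powi j)" by (simp add: power_int_diff)
    have z: "z powi j = z * z powi (j-1)" using that by (simp add: power_int_diff)
    have "F (?m+1) z j = F ?m (z * q) j + (-1) powi j * q powi (j * (j-1) div 2) * qbin ?m (j-1) * z powi j"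
      unfolding F_def qbin_Suc[of ?m, simplified] by (simp add: power_int_mult_distrib algebra_simps)
    also have "(-1) powi j * q powi (j * (j-1) div 2) * qbin ?m (j-1) * z powi j = - z * F ?m (z * q) (j-1)"
      unfolding F_def s e z powi_add by (simp add: power_int_mult_distrib)
    finally show ?thesis by simp
  qed
  have F0: "F n z j = 0" if "j < 0 \<or> n < j" for n z j using that by (simp add: F_def qbin_0)
  show ?case
  proof (cases "z = 0")
    case True
    have "(\<Sum>j\<in>{0..int (Suc m)}. F (int (Suc m)) z j) = (\<Sum>j\<in>{0}. F (int (Suc m)) z j)"
      by (rule sum.mono_neutral_right) (auto simp: F_def True)
    then show ?thesis unfolding F_def using True qf_iq[of "int (Suc m)"] by (simp add: qbin_def iq_0)
  next
    case False
    have "(\<Sum>j\<in>{0..?m+1}. F (?m+1) z j) = (\<Sum>j\<in>{0..?m+1}. F ?m (z * q) j) - z * (\<Sum>j\<in>{0..?m+1}. F ?m (z * q) (j-1))"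
      unfolding F[OF False] by (simp add: sum_subtractf sum_distrib_left)
    also have "(\<Sum>j\<in>{0..?m+1}. F ?m (z * q) j) = (\<Sum>j\<in>{0..?m}. F ?m (z * q) j)"
      by (rule sum.mono_neutral_right) (auto simp: F0)
    also have "(\<Sum>j\<in>{0..?m+1}. F ?m (z * q) (j-1)) = (\<Sum>j\<in>{-1..?m}. F ?m (z * q) j)"
      by (rule sum.reindex_bij_witness[of _ "\<lambda>t. t+1" "\<lambda>t. t-1"]) auto
    also have "\<dots> = (\<Sum>j\<in>{0..?m}. F ?m (z * q) j)"
      by (rule sum.mono_neutral_right) (auto simp: F0)
    also have "(\<Sum>j\<in>{0..?m}. F ?m (z * q) j) = (\<Prod>i<m. 1 - (z * q) * q ^ i)"
      unfolding F_def by (rule Suc.IH)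
    finally have "(\<Sum>j\<in>{0..?m+1}. F (?m+1) z j) = (1 - z) * (\<Prod>i<m. 1 - z * q ^ Suc i)"
      by (simp add: algebra_simps)
    also have "\<dots> = (\<Prod>i<Suc m. 1 - z * q ^ i)" by (subst prod.lessThan_Suc_shift) simp
    finally show ?thesis by (simp add: F_def add.commute)
  qed
qed

text \<open>The q-binomial theorem with \<open>2 n\<close> factors, recentred by the choice \<open>z = x q^(-n)\<close>.\<close>

lemma finite_triple_product:
  assumes x: "x \<noteq> 0"
  shows "(\<Sum>k\<in>{-int n..int n}. theta_term q x k * qbin (2 * int n) (int n + k)) =
    (\<Prod>i<n. (1 - x * q ^ i) * (1 - q ^ Suc i / x))"
proof -
  let ?n = "int n"
  define z where "z = x * q powi (- ?n)"
  obtain b where b: "?n * (?n - 1) = b * 2" using consecutive_product_even by blast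
  \<comment> \<open>The factor by which the first \<open>n\<close> factors of the product over \<open>1 - z q^i\<close> differ from those over \<open>1 - q^i/x\<close>.\<close>
  define c where "c = (-1) powi ?n * x powi ?n * q powi (- b - ?n)"
  have c0: "c \<noteq> 0" using x q_nz by (simp add: c_def)
  have "(\<Prod>i<2*n. 1 - z * q ^ i) = (\<Sum>j\<in>{0..2 * ?n}. (-1) powi j * q powi (j * (j-1) div 2) * qbin (2 * ?n) j * z powi j)"
    using q_binomial[of "2*n" z] by simp
  also have "\<dots> = (\<Sum>k\<in>{-?n..?n}. c * (theta_term q x k * qbin (2 * ?n) (?n + k)))"
  proof (rule sum.reindex_bij_witness[of _ "\<lambda>k. ?n + k" "\<lambda>j. j - ?n"])
    fix j assume "j \<in> {0..2 * ?n}"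
    define k where "k = j - ?n"
    have j: "j = ?n + k" by (simp add: k_def)
    obtain a where a: "k * (k-1) = a * 2" using consecutive_product_even by blast
    have "j * (j-1) = (a + b + k * ?n) * 2" using a b unfolding j by (simp add: algebra_simps)
    then have e: "j * (j-1) div 2 = a + b + k * ?n" by simp
    have s: "(-1 :: complex) powi j = (-1) powi ?n * (-1) powi k" unfolding j by (simp add: power_int_add)
    have "(q powi (- ?n)) powi (?n + k) = q powi (- ?n * (?n + k))" by (simp only: power_int_mult)
    then have zz: "z powi j = x powi ?n * x powi k * q powi (- ?n * (?n + k))"
      unfolding z_def j using x by (simp only: power_int_mult_distrib power_int_add simp_thms)
    have p: "q powi (a + b + k * ?n) * q powi (- ?n * (?n + k)) = q powi (- b - ?n) * q powi a"
    proof -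
      have "?n * ?n = b * 2 + ?n" using b by (simp add: algebra_simps)
      then show ?thesis by (simp flip: powi_add add: algebra_simps)
    qed
    have "(-1) powi j * q powi (j * (j-1) div 2) * qbin (2 * ?n) j * z powi j =
      (-1) powi ?n * (-1) powi k * x powi ?n * x powi k * (q powi (a + b + k * ?n) * q powi (- ?n * (?n + k))) * qbin (2 * ?n) j"
      unfolding e s zz by (simp only: mult_ac)
    also have "\<dots> = c * (theta_term q x k * qbin (2 * ?n) (?n + k))"
      unfolding p c_def theta_term_def a j by simp
    finally have eq: "(-1) powi j * q powi (j * (j-1) div 2) * qbin (2 * ?n) j * z powi j =
        c * (theta_term q x k * qbin (2 * ?n) (?n + k))" .
    show "c * (theta_term q x (j - ?n) * qbin (2 * ?n) (?n + (j - ?n))) =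
        (-1) powi j * q powi (j * (j-1) div 2) * qbin (2 * ?n) j * z powi j" unfolding eq k_def ..
  qed auto
  finally have 1: "(\<Prod>i<2*n. 1 - z * q ^ i) = c * (\<Sum>k\<in>{-?n..?n}. theta_term q x k * qbin (2 * ?n) (?n + k))"
    by (simp add: sum_distrib_left)
  have 2: "(\<Prod>i<2*n. 1 - z * q ^ i) = (\<Prod>i<n. 1 - z * q ^ i) * (\<Prod>i<n. 1 - x * q ^ i)"
  proof -
    have u: "{..<2*n} = {..<n} \<union> {n..<2*n}" by auto
    have "(\<Prod>i<2*n. 1 - z * q ^ i) = (\<Prod>i<n. 1 - z * q ^ i) * (\<Prod>i\<in>{n..<2*n}. 1 - z * q ^ i)"
      unfolding u by (rule prod.union_disjoint) auto
    also have "(\<Prod>i\<in>{n..<2*n}. 1 - z * q ^ i) = (\<Prod>i<n. 1 - x * q ^ i)"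
      by (rule prod.reindex_bij_witness[of _ "\<lambda>i. i+n" "\<lambda>i. i-n"])
         (auto simp: z_def power_add power_int_minus q_nz field_simps le_iff_add)
    finally show ?thesis .
  qed
  have 3: "(\<Prod>i<n. 1 - z * q ^ i) = c * (\<Prod>i<n. 1 - q ^ Suc i / x)"
  proof -
    have "(\<Prod>i<n. 1 - z * q ^ i) = (\<Prod>i<n. 1 - x / q ^ Suc i)"
      by (rule prod.reindex_bij_witness[of _ "\<lambda>i. n - Suc i" "\<lambda>i. n - Suc i"])
         (auto simp: z_def power_int_minus q_nz power_diff field_simps)
    also have "\<dots> = (\<Prod>i<n. (- x / q ^ Suc i) * (1 - q ^ Suc i / x))"
      by (rule prod.cong) (use x q_nz in \<open>auto simp: field_simps\<close>)
    also have "\<dots> = (\<Prod>i<n. - x / q ^ Suc i) * (\<Prod>i<n. 1 - q ^ Suc i / x)" by (rule prod.distrib)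
    also have "(\<Prod>i<n. - x / q ^ Suc i) = c"
    proof -
      have "(\<Prod>i<n. - x / q ^ Suc i) = (-1) ^ n * x ^ n / (\<Prod>i<n. q ^ Suc i)"
        by (induction n) (auto simp: field_simps)
      also have "(\<Prod>i<n. q ^ Suc i) = q powi (b + ?n)"
      proof -
        have "int (\<Sum>i<m. Suc i) * 2 = int m * (int m - 1) + int m * 2" for m
          by (induction m) (auto simp: algebra_simps)
        from this[of n] have "int (\<Sum>i<n. Suc i) = b + ?n" using b by simp
        then have "q powi (b + ?n) = q ^ (\<Sum>i<n. Suc i)" by (metis power_int_of_nat)
        then show ?thesis by (simp add: power_sum)
      qed
      also have "(-1) ^ n * x ^ n / q powi (b + ?n) = c"
        unfolding c_def using q_nz by (simp add: power_int_minus power_int_diff power_int_add field_simps)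
      finally show ?thesis .
    qed
    finally show ?thesis .
  qed
  show ?thesis using 1 c0 unfolding 2 3 by (simp add: prod.distrib mult_ac)
qed

lemma jacobi_triple_product:
  assumes x: "x \<noteq> 0"
  shows "(\<lambda>n. \<Prod>i<n. (1 - x * q ^ i) * (1 - q ^ Suc i / x)) \<longlonglongrightarrow> theta q x / qinf q"
proof -
  obtain C where C: "C \<ge> 1" "\<And>m. norm (qf m) \<le> C" "\<And>m. norm (iq m) \<le> C" using qfac_bounded by blast
  have e: "(\<Prod>i<n. (1 - x * q ^ i) * (1 - q ^ Suc i / x)) =
     (\<Sum>\<^sub>\<infinity>k. theta_term q x k * qbin (2 * int n) (int n + k))" for n
  proof -
    have "(\<Sum>\<^sub>\<infinity>k. theta_term q x k * qbin (2 * int n) (int n + k)) =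
       (\<Sum>\<^sub>\<infinity>k\<in>{-int n..int n}. theta_term q x k * qbin (2 * int n) (int n + k))"
      by (rule infsum_cong_neutral) (auto simp: qbin_0)
    then show ?thesis using finite_triple_product[OF x, of n] by simp
  qed
  have "(\<lambda>n. \<Sum>\<^sub>\<infinity>k. theta_term q x k * qbin (2 * int n) (int n + k)) \<longlonglongrightarrow> (\<Sum>\<^sub>\<infinity>k. theta_term q x k * (qinf q * (1 / qinf q) * (1 / qinf q)))"
  proof (rule tendsto_infsum_dominated)
    fix k :: int
    have "(\<lambda>n. qf (int (2*n))) \<longlonglongrightarrow> qinf q"
      by (rule qf_lim'[OF filterlim_subseq]) (auto simp: strict_mono_def)
    moreover have "(\<lambda>n. iq (int n + k)) \<longlonglongrightarrow> 1 / qinf q" by (rule iq_lim)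
    moreover have "(\<lambda>n. iq (int n + (- k))) \<longlonglongrightarrow> 1 / qinf q" by (rule iq_lim)
    ultimately have "(\<lambda>n. theta_term q x k * (qf (int (2*n)) * iq (int n + k) * iq (int n + (- k))))
       \<longlonglongrightarrow> theta_term q x k * (qinf q * (1 / qinf q) * (1 / qinf q))" by (intro tendsto_intros)
    then show "(\<lambda>n. theta_term q x k * qbin (2 * int n) (int n + k)) \<longlonglongrightarrow> theta_term q x k * (qinf q * (1 / qinf q) * (1 / qinf q))"
      by (simp add: qbin_def)
  next
    fix k :: int and n :: nat
    have "norm (qbin (2 * int n) (int n + k)) \<le> C * C * C"
      unfolding qbin_def norm_mult using C by (intro mult_mono mult_nonneg_nonneg) (auto intro: order_trans[OF _ C(1)])
    then show "norm (theta_term q x k * qbin (2 * int n) (int n + k)) \<le> norm (theta_term q x k) * (C * C * C)"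
      unfolding norm_mult by (intro mult_left_mono) auto
  next
    show "(\<lambda>k. norm (theta_term q x k) * (C * C * C)) summable_on UNIV"
      by (rule summable_on_cmult_left, rule theta_term_abs_summable[OF x])
  qed
  also have "(\<Sum>\<^sub>\<infinity>k. theta_term q x k * (qinf q * (1 / qinf q) * (1 / qinf q))) = theta q x / qinf q"
    using qinf_nz by (simp add: infsum_cmult_left' theta_def divide_inverse)
  finally show ?thesis unfolding e .
qed

lemma q_disc_power: "K > 0 \<Longrightarrow> q_disc (q ^ K)"
  using q_nz q_lt_1 by unfold_locales (auto simp: norm_power power_less_one_iff)

text \<open>Euler's pentagonal number theorem: the factors of the triple product run through the residues 1 and 2 modulo 3.\<close>

lemma theta_cube: "theta (q ^ 3) q = qinf q"
proof -
  interpret c: q_disc "q ^ 3" by (rule q_disc_power) simp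
  have blk: "qf (int (3*n)) = (\<Prod>i<n. (1 - q * (q^3)^i) * (1 - (q^3)^Suc i / q)) * c.qf (int n)" for n
  proof (induction n)
    case 0
    then show ?case by (simp add: qfac_def)
  next
    case (Suc n)
    have A: "qf (int (3 * Suc n)) = qf (int (3*n)) * ((1 - q ^ Suc (3*n)) * (1 - q ^ Suc (Suc (3*n))) * (1 - q ^ Suc (Suc (Suc (3*n)))))"
      unfolding qf_of_nat by (simp add: eval_nat_numeral)
    have p: "q ^ Suc (3*n) = q * (q^3)^n" "q ^ Suc (Suc (3*n)) = (q^3)^Suc n / q"
       "q ^ Suc (Suc (Suc (3*n))) = (q^3) ^ Suc n"
      using q_nz by (simp_all only: power_Suc power_mult) (simp_all add: power3_eq_cube)
    have B: "c.qf (int (Suc n)) = c.qf (int n) * (1 - (q^3) ^ Suc n)"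
      by (simp only: c.qf_of_nat prod.lessThan_Suc)
    show ?case unfolding A Suc p B prod.lessThan_Suc by (simp only: mult_ac)
  qed
  have "(\<lambda>n. (\<Prod>i<n. (1 - q * (q^3)^i) * (1 - (q^3)^Suc i / q)) * c.qf (int n)) \<longlonglongrightarrow> theta (q^3) q / qinf (q^3) * qinf (q^3)"
    by (intro tendsto_mult c.jacobi_triple_product c.qf_lim q_nz)
  then have "(\<lambda>n. qf (int (3*n))) \<longlonglongrightarrow> theta (q^3) q" unfolding blk using c.qinf_nz by simp
  moreover have "(\<lambda>n. qf (int (3*n))) \<longlonglongrightarrow> qinf q"
    by (rule qf_lim'[OF filterlim_subseq]) (auto simp: strict_mono_def)
  ultimately show ?thesis by (rule LIMSEQ_unique)
qed

definition macdonald_term :: "complex \<Rightarrow> complex \<Rightarrow> int \<Rightarrow> int \<Rightarrow> complex" where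
  "macdonald_term x y k1 k2 = of_int (eps k1 k2) * q powi ((nrm k1 k2 + k1 - k2) div 3) * x powi (- k1) * y powi k2"

text \<open>The product of three theta series is a sum over \<open>(a, b, c)\<close>. In the coordinates \<open>k1 = c - a\<close>,
\<open>k2 = b - c\<close> and \<open>c\<close> the inner sum over \<open>c\<close> is \<open>\<theta>(q^t; q^3)\<close> with
\<open>t = k2 - k1 + 1\<close>. By quasi-periodicity and \<open>theta_cube\<close> this is, up to sign and a power of
\<open>q\<close>, equal to \<open>qinf q\<close>, except that it vanishes if 3 divides \<open>t\<close>; the three cases are the three
values of \<open>eps\<close>.\<close>

lemma macdonald:
  assumes x: "x \<noteq> 0" and y: "y \<noteq> 0"
  shows "(\<lambda>(k1,k2). macdonald_term x y k1 k2) norm_summable_on UNIV"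
    and "qinf q * (\<Sum>\<^sub>\<infinity>(k1,k2). macdonald_term x y k1 k2) = theta q x * theta q y * theta q (q / (x * y))"
proof -
  interpret c: q_disc "q ^ 3" by (rule q_disc_power) simp
  let ?w = "q / (x * y)"
  have w: "?w \<noteq> 0" using x y q_nz by simp
  let ?F = "\<lambda>((a,b),c). theta_term q x a * theta_term q y b * theta_term q ?w c"
  \<comment> \<open>The substitution \<open>a = c - k1\<close>, \<open>b = c + k2\<close> is a bijection, so sums and summability transfer.\<close>
  define G where "G = (\<lambda>((k1,k2),c). ?F ((c - k1, c + k2), c))"
  have sab: "(\<lambda>(a,b). theta_term q x a * theta_term q y b) norm_summable_on UNIV"
    using abs_summable_Times[OF theta_term_abs_summable[OF x] theta_term_abs_summable[OF y]] by simp
  have sF: "?F norm_summable_on UNIV"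
    using abs_summable_Times[OF sab theta_term_abs_summable[OF w]] by (simp add: case_prod_unfold)
  have iF: "infsum ?F UNIV = theta q x * theta q y * theta q ?w"
    using infsum_Times[OF sab theta_term_abs_summable[OF w]] infsum_Times[OF theta_term_abs_summable[OF x] theta_term_abs_summable[OF y]]
    by (simp add: case_prod_unfold theta_def)
  have sG: "G norm_summable_on UNIV"
    unfolding G_def
    by (rule iffD1[OF summable_on_reindex_bij_witness[of UNIV "\<lambda>((k1,k2),c). ((c-k1,c+k2),c)" "\<lambda>((a,b),c). ((c-a,b-c),c)" UNIV] sF]) auto
  have iG: "infsum G UNIV = infsum ?F UNIV"
    unfolding G_def
    by (rule infsum_reindex_bij_witness[of UNIV "\<lambda>((a,b),c). ((c-a,b-c),c)" "\<lambda>((k1,k2),c). ((c-k1,c+k2),c)"]) auto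
  have inner: "infsum (\<lambda>c. G ((k1,k2),c)) UNIV = qinf q * macdonald_term x y k1 k2" for k1 k2
  proof -
    define t where "t = k2 - k1 + 1"
    note ev = consecutive_product_even
    obtain a where a: "(- k1) * (- k1 - 1) = a * 2" using ev by blast
    obtain b where b: "k2 * (k2 - 1) = b * 2" using ev by blast
    have G: "G ((k1,k2),c) = ((-1) powi (k1 + k2) * q powi (a + b) * x powi (- k1) * y powi k2) * theta_term (q^3) (q powi t) c" for c
    proof -
      obtain d where d: "c * (c - 1) = d * 2" using ev by blast
      have "(c - k1) * (c - k1 - 1) = (a + d - k1 * c) * 2" using a d by (simp add: algebra_simps)
      then have e1: "(c - k1) * (c - k1 - 1) div 2 = a + d - k1 * c" by simp
      have "(c + k2) * (c + k2 - 1) = (b + d + k2 * c) * 2" using b d by (simp add: algebra_simps)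
      then have e2: "(c + k2) * (c + k2 - 1) div 2 = b + d + k2 * c" by simp
      have e3: "c * (c - 1) div 2 = d" using d by simp
      have s: "(-1 :: complex) powi (c - k1) * (-1) powi (c + k2) * (-1) powi c = (-1) powi (k1 + k2) * (-1) powi c"
        by (auto simp: power_int_minus_left)
      have xy: "x powi (c - k1) * y powi (c + k2) * ?w powi c = q powi c * x powi (- k1) * y powi k2"
        using x y by (simp add: power_int_add power_int_diff power_int_divide_distrib power_int_mult_distrib power_int_minus field_simps)
      have p: "q powi (a + d - k1 * c) * q powi (b + d + k2 * c) * q powi d * q powi c = q powi (a + b) * ((q^3) powi d * (q powi t) powi c)"
      proof -
        have 1: "(q^3) powi d = q powi (3 * d)" by (simp add: power_int_mult)
        have 2: "(q powi t) powi c = q powi (t * c)" by (simp add: power_int_mult)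
        show ?thesis unfolding 1 2 by (simp flip: powi_add add: t_def algebra_simps)
      qed
      have "G ((k1,k2),c) = ((-1) powi (c - k1) * (-1) powi (c + k2) * (-1) powi c) *
         (q powi (a + d - k1 * c) * q powi (b + d + k2 * c) * q powi d) * (x powi (c - k1) * y powi (c + k2) * ?w powi c)"
        unfolding G_def theta_term_def prod.case e1 e2 e3 by (simp only: mult_ac)
      also have "\<dots> = ((-1) powi (k1 + k2) * (-1) powi c) * (q powi (a + d - k1 * c) * q powi (b + d + k2 * c) * q powi d * q powi c) * x powi (- k1) * y powi k2"
        unfolding s xy by (simp only: mult_ac)
      also have "\<dots> = ((-1) powi (k1 + k2) * q powi (a + b) * x powi (- k1) * y powi k2) * theta_term (q^3) (q powi t) c"
        unfolding p theta_term_def e3 by (simp only: mult_ac)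
      finally show ?thesis .
    qed
    have th: "infsum (\<lambda>c. G ((k1,k2),c)) UNIV =
        ((-1) powi (k1 + k2) * q powi (a + b) * x powi (- k1) * y powi k2) * theta (q^3) (q powi t)"
      unfolding G by (simp add: infsum_cmult_right' theta_def)
    have pq: "(q^3) powi m = q powi (3 * m)" for m by (simp add: power_int_mult)
    have sc: "(-1) powi (k1 + k2) * q powi (a + b) * theta (q^3) (q powi t) =
       qinf q * (of_int (eps k1 k2) * q powi ((nrm k1 k2 + k1 - k2) div 3))"
    proof -
      define m where "m = t div 3"
      have "t = 3 * m \<or> t = 3 * m + 1 \<or> t = 3 * m + 2" unfolding m_def by presburger
      then consider "t = 3 * m" | "t = 3 * m + 1" | "t = 3 * m + 2" by blast
      then show ?thesis
      proof cases
        case 1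
        have "theta (q^3) (q powi t) = 0"
          using c.theta_shift[of 1 m] unfolding 1 pq by (simp add: c.theta_one)
        moreover have "eps k1 k2 = 0" unfolding eps_def t_def[symmetric] 1 by (simp add: chi3_def)
        ultimately show ?thesis by simp
      next
        case 2
        obtain d where d: "m * (m - 1) = d * 2" using ev by blast
        have k2: "k2 = k1 + 3 * m" using 2 unfolding t_def by simp
        have "theta (q^3) (q powi t) = theta (q^3) ((q^3) powi m * q)"
          unfolding 2 pq by (simp add: powi_add)
        also have "\<dots> = (-1) powi m * q powi (- m) * q powi (- 3 * d) * qinf q"
          by (simp only: c.theta_shift[OF q_nz] theta_cube d) (simp add: pq)
        finally have th: "theta (q^3) (q powi t) = (-1) powi m * (q powi (- m) * q powi (- 3 * d)) * qinf q" by simp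
        have e: "eps k1 k2 = 1" unfolding eps_def t_def[symmetric] 2 by (simp add: chi3_def)
        have s: "(-1 :: complex) powi (k1 + k2) * (-1) powi m = 1"
          unfolding k2 by (auto simp: power_int_minus_left)
        have p: "q powi (a + b) * (q powi (- m) * q powi (- 3 * d)) = q powi ((nrm k1 k2 + k1 - k2) div 3)"
        proof -
          have "nrm k1 k2 + k1 - k2 = (k1*k1 + 3*k1*m + 3*m*m - m) * 3" unfolding nrm_def k2 by (simp add: algebra_simps)
          then have 1: "(nrm k1 k2 + k1 - k2) div 3 = k1*k1 + 3*k1*m + 3*m*m - m" by simp
          have "a + b - m - 3 * d = k1*k1 + 3*k1*m + 3*m*m - m"
            using a b d unfolding k2 by (simp add: algebra_simps)
          then have "a + b + (- m + - 3 * d) = k1*k1 + 3*k1*m + 3*m*m - m" by simp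
          then show ?thesis unfolding 1 powi_add[symmetric] by (simp only:)
        qed
        have "(-1) powi (k1 + k2) * q powi (a + b) * theta (q^3) (q powi t) =
            ((-1) powi (k1 + k2) * (-1) powi m) * (q powi (a + b) * (q powi (- m) * q powi (- 3 * d))) * qinf q"
          unfolding th by (simp only: mult_ac)
        then show ?thesis unfolding s p e by simp
      next
        case 3
        obtain d where d: "m * (m - 1) = d * 2" using ev by blast
        have k2: "k2 = k1 + 3 * m + 1" using 3 unfolding t_def by simp
        have qq: "q^3 / q = q^2" using q_nz by (simp add: power2_eq_square power3_eq_cube)
        have t2: "theta (q^3) (q^2) = qinf q" using c.theta_reflect[OF q_nz] theta_cube unfolding qq by simp
        have q2: "(q^2) powi m = q powi (2 * m)" for m by (simp add: power_int_mult)
        have "theta (q^3) (q powi t) = theta (q^3) ((q^3) powi m * q^2)"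
          unfolding 3 pq by (simp add: powi_add)
        also have "\<dots> = (-1) powi m * q powi (2 * - m) * q powi (- 3 * d) * qinf q"
          using q_nz by (subst c.theta_shift) (simp_all only: t2 d pq q2, simp_all)
        finally have th: "theta (q^3) (q powi t) = (-1) powi m * (q powi (2 * - m) * q powi (- 3 * d)) * qinf q" by simp
        have e: "eps k1 k2 = -1" unfolding eps_def t_def[symmetric] 3 by (simp add: chi3_def)
        have s: "(-1 :: complex) powi (k1 + k2) * (-1) powi m = -1"
          unfolding k2 by (auto simp: power_int_minus_left)
        have p: "q powi (a + b) * (q powi (2 * - m) * q powi (- 3 * d)) = q powi ((nrm k1 k2 + k1 - k2) div 3)"
        proof -
          have "nrm k1 k2 + k1 - k2 = (k1*k1 + 3*k1*m + k1 + 3*m*m + m) * 3" unfolding nrm_def k2 by (simp add: algebra_simps)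
          then have 1: "(nrm k1 k2 + k1 - k2) div 3 = k1*k1 + 3*k1*m + k1 + 3*m*m + m" by simp
          have "a + b - 2 * m - 3 * d = k1*k1 + 3*k1*m + k1 + 3*m*m + m"
            using a b d unfolding k2 by (simp add: algebra_simps)
          then have "a + b + (2 * - m + - 3 * d) = k1*k1 + 3*k1*m + k1 + 3*m*m + m" by simp
          then show ?thesis unfolding 1 powi_add[symmetric] by (simp only:)
        qed
        have "(-1) powi (k1 + k2) * q powi (a + b) * theta (q^3) (q powi t) =
            ((-1) powi (k1 + k2) * (-1) powi m) * (q powi (a + b) * (q powi (2 * - m) * q powi (- 3 * d))) * qinf q"
          unfolding th by (simp only: mult_ac)
        then show ?thesis unfolding s p e by simp
      qed
    qed
    have "infsum (\<lambda>c. G ((k1,k2),c)) UNIV =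
        ((-1) powi (k1 + k2) * q powi (a + b) * theta (q^3) (q powi t)) * (x powi (- k1) * y powi k2)"
      unfolding th by (simp only: mult_ac)
    then show ?thesis unfolding sc macdonald_term_def by (simp only: mult_ac)
  qed
  have U: "(UNIV :: ((int \<times> int) \<times> int) set) = UNIV \<times> UNIV" by simp
  have sG': "G norm_summable_on (UNIV \<times> UNIV)" using sG by simp
  have "(\<lambda>k. infsum (\<lambda>c. norm (G (k,c))) UNIV) norm_summable_on UNIV"
    using sG' unfolding Infinite_Sum.abs_summable_on_Sigma_iff by blast
  then have *: "(\<lambda>k. qinf q * (\<lambda>(k1,k2). macdonald_term x y k1 k2) k) norm_summable_on UNIV"
  proof (rule Infinite_Sum.abs_summable_on_comparison_test)
    fix k :: "int \<times> int"
    obtain k1 k2 where k: "k = (k1,k2)" by (cases k)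
    have "(\<lambda>c. G (k,c)) norm_summable_on UNIV" using sG' unfolding Infinite_Sum.abs_summable_on_Sigma_iff by blast
    then have "norm (infsum (\<lambda>c. G (k,c)) UNIV) \<le> infsum (\<lambda>c. norm (G (k,c))) UNIV" by (rule norm_infsum_bound)
    then show "norm (qinf q * (\<lambda>(k1,k2). macdonald_term x y k1 k2) k) \<le> norm (infsum (\<lambda>c. norm (G (k,c))) UNIV)"
      unfolding k inner by simp
  qed
  then have "(\<lambda>k. inverse (norm (qinf q)) * norm (qinf q * (\<lambda>(k1,k2). macdonald_term x y k1 k2) k)) summable_on UNIV"
    by (rule summable_on_cmult_right)
  then show "(\<lambda>(k1,k2). macdonald_term x y k1 k2) norm_summable_on UNIV"
    using qinf_nz by (simp add: norm_mult mult.assoc[symmetric])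
  have "infsum G UNIV = infsum (\<lambda>k. infsum (\<lambda>c. G (k,c)) UNIV) UNIV"
    unfolding U by (rule infsum_Sigma_banach[symmetric]) (rule Infinite_Sum.abs_summable_summable[OF sG'])
  also have "\<dots> = (\<Sum>\<^sub>\<infinity>k. qinf q * (\<lambda>(k1,k2). macdonald_term x y k1 k2) k)"
    by (rule infsum_cong) (auto simp: inner)
  also have "\<dots> = qinf q * (\<Sum>\<^sub>\<infinity>(k1,k2). macdonald_term x y k1 k2)" by (simp add: infsum_cmult_right')
  finally show "qinf q * (\<Sum>\<^sub>\<infinity>(k1,k2). macdonald_term x y k1 k2) = theta q x * theta q y * theta q (q / (x * y))"
    unfolding iG iF by simp
qed

end

section \<open>The summands of the series\<close>

lemma gaps_34: "gaps 3 4 = {1, 2, 5}"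
  unfolding gaps_def Gam_def by (auto; presburger)
lemma gaps_35: "gaps 3 5 = {1, 2, 4, 7}"
  unfolding gaps_def Gam_def by (auto; presburger)
lemma gaps_37: "gaps 3 7 = {1, 2, 4, 5, 8, 11}"
  unfolding gaps_def Gam_def by (auto; presburger)
lemma gaps_38: "gaps 3 8 = {1, 2, 4, 5, 7, 10, 13}"
  unfolding gaps_def Gam_def by (auto; presburger)

lemma Q_34: "Q 3 4 n = n 1*n 1 + n 2*n 2 + n 5*n 5 + n 1*n 2 - n 1*n 5"
  by (simp add: Q_def gaps_34 U_def algebra_simps)
lemma Q_35: "Q 3 5 n = n 1*n 1 + n 2*n 2 + n 4*n 4 + n 7*n 7 + n 1*n 2 - n 1*n 7 + n 2*n 4 - n 2*n 7"
  by (simp add: Q_def gaps_35 U_def algebra_simps)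
lemma Q_37: "Q 3 7 n = n 1*n 1 + n 2*n 2 + n 4*n 4 + n 5*n 5 + n 8*n 8 + n 11*n 11 +
          n 1*n 2 - n 1*n 8 + n 2*n 4 - n 2*n 11 + n 4*n 5 - n 4*n 11"
  by (simp add: Q_def gaps_37 U_def algebra_simps)
lemma Q_38: "Q 3 8 n = n 1*n 1 + n 2*n 2 + n 4*n 4 + n 5*n 5 + n 7*n 7 + n 10*n 10 + n 13*n 13 +
          n 1*n 2 + n 2*n 4 + n 4*n 5 + n 5*n 7 - n 2*n 10 - n 1*n 10 - n 5*n 13 - n 4*n 13"
  by (simp add: Q_def gaps_38 U_def algebra_simps)

lemma dist_multiples_eq:
  assumes "m > 0"
  shows "dist_multiples x m = min (x mod m) (m - x mod m)"
  unfolding dist_multiples_def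
proof (rule cInf_eq_minimum)
  have 1: "\<bar>x - m * (x div m)\<bar> = x mod m" using assms by (simp add: minus_mult_div_eq_mod)
  have 2: "\<bar>x - m * (x div m + 1)\<bar> = m - x mod m"
  proof -
    have "x - m * (x div m + 1) = x mod m - m" by (simp add: algebra_simps minus_mult_div_eq_mod[symmetric])
    then show ?thesis using pos_mod_bound[OF assms, of x] by simp
  qed
  show "min (x mod m) (m - x mod m) \<in> range (\<lambda>k. \<bar>x - m * k\<bar>)"
    unfolding min_def using 1 2 by (auto simp: image_iff) (metis+)
next
  fix y assume "y \<in> range (\<lambda>k. \<bar>x - m * k\<bar>)"
  then obtain k where y: "y = \<bar>x - m * k\<bar>" by auto
  have x: "x - m * k = m * (x div m - k) + x mod m" by (simp add: algebra_simps)
  have b: "0 \<le> x mod m" "x mod m < m" using assms by auto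
  show "min (x mod m) (m - x mod m) \<le> y"
  proof (cases "x div m - k \<ge> 0")
    case True
    then have "m * (x div m - k) \<ge> 0" using assms by simp
    then show ?thesis unfolding y x using b by linarith
  next
    case False
    then have "m * (x div m - k) \<le> m * (-1)" using assms by (intro mult_left_mono) auto
    then show ?thesis unfolding y x using b by linarith
  qed
qed

context q_disc begin

text \<open>The kernel consists of one q-factorial and six reciprocals, each of which is bounded uniformly and converges.\<close>

lemma kernel_limit:
  assumes "(\<lambda>(k1,k2). \<alpha> k1 k2) norm_summable_on UNIV"
  shows "(\<lambda>N. \<Sum>k1\<in>{-int N..int N}. \<Sum>k2\<in>{-int N..int N}. \<alpha> k1 k2 * kernel (int N) (int N) k1 k2)
    \<longlonglongrightarrow> (\<Sum>\<^sub>\<infinity>(k1,k2). \<alpha> k1 k2) / qinf q ^ 5"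
proof -
  obtain C where C: "C \<ge> 1" "\<And>m. norm (qf m) \<le> C" "\<And>m. norm (iq m) \<le> C" using qfac_bounded by blast
  let ?f = "\<lambda>k N. (\<lambda>(k1,k2). \<alpha> k1 k2 * kernel (int N) (int N) k1 k2) k"
  have e: "(\<Sum>k1\<in>{-int N..int N}. \<Sum>k2\<in>{-int N..int N}. \<alpha> k1 k2 * kernel (int N) (int N) k1 k2) = (\<Sum>\<^sub>\<infinity>k. ?f k N)" for N
  proof -
    let ?B = "{-int N..int N} \<times> {-int N..int N}"
    have "(\<Sum>\<^sub>\<infinity>k. ?f k N) = (\<Sum>\<^sub>\<infinity>k\<in>?B. ?f k N)"
    proof (rule infsum_cong_neutral)
      fix k assume k: "k \<in> UNIV - ?B"
      obtain k1 k2 where kk: "k = (k1,k2)" by (cases k)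
      have "int N + k1 < 0 \<or> int N - k1 < 0 \<or> int N + k2 < 0 \<or> int N - k2 < 0" using k unfolding kk by auto
      then show "?f k N = 0" unfolding kk kernel_def by (auto simp: iq_neg)
    qed auto
    then show ?thesis by (simp add: sum.cartesian_product)
  qed
  have "(\<lambda>N. \<Sum>\<^sub>\<infinity>k. ?f k N) \<longlonglongrightarrow> (\<Sum>\<^sub>\<infinity>k. (\<lambda>(k1,k2). \<alpha> k1 k2 * (1 / qinf q ^ 5)) k)"
  proof (rule tendsto_infsum_dominated)
    fix k :: "int \<times> int"
    obtain k1 k2 where kk: "k = (k1,k2)" by (cases k)
    have a: "kernel (int N) (int N) k1 k2 = qf (int (2*N)) * (iq (int N + k1) * iq (int N + k2) * iq (int N + (-k1-k2))) *
        (iq (int N + (-k1)) * iq (int N + (-k2)) * iq (int N + (k1+k2)))" for N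
      unfolding kernel_def by (simp add: algebra_simps)
    have "(\<lambda>N. qf (int (2*N))) \<longlonglongrightarrow> qinf q"
      by (rule qf_lim'[OF filterlim_subseq]) (auto simp: strict_mono_def)
    then have "(\<lambda>N. \<alpha> k1 k2 * kernel (int N) (int N) k1 k2) \<longlonglongrightarrow>
      \<alpha> k1 k2 * (qinf q * (1 / qinf q * (1 / qinf q) * (1 / qinf q)) * (1 / qinf q * (1 / qinf q) * (1 / qinf q)))"
      unfolding a by (intro tendsto_mult tendsto_const iq_lim)
    moreover have "qinf q * (1 / qinf q * (1 / qinf q) * (1 / qinf q)) * (1 / qinf q * (1 / qinf q) * (1 / qinf q)) = 1 / qinf q ^ 5"
      using qinf_nz by (simp add: field_simps eval_nat_numeral)
    ultimately show "?f k \<longlonglongrightarrow> (\<lambda>(k1,k2). \<alpha> k1 k2 * (1 / qinf q ^ 5)) k"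
      unfolding kk prod.case by (simp only:)
  next
    fix k :: "int \<times> int" and N :: nat
    obtain k1 k2 where kk: "k = (k1,k2)" by (cases k)
    have "norm (kernel (int N) (int N) k1 k2) \<le> C * (C * C * C) * (C * C * C)"
      unfolding kernel_def norm_mult using C by (intro mult_mono mult_nonneg_nonneg) (auto intro: order_trans[OF _ C(1)])
    then show "norm (?f k N) \<le> norm ((\<lambda>(k1,k2). \<alpha> k1 k2) k) * (C * (C * C * C) * (C * C * C))"
      unfolding kk prod.case norm_mult by (intro mult_left_mono) auto
  next
    show "(\<lambda>k. norm ((\<lambda>(k1,k2). \<alpha> k1 k2) k) * (C * (C * C * C) * (C * C * C))) summable_on UNIV"
      by (rule summable_on_cmult_left[OF assms])
  qed
  also have "(\<Sum>\<^sub>\<infinity>k. (\<lambda>(k1,k2). \<alpha> k1 k2 * (1 / qinf q ^ 5)) k) = (\<Sum>\<^sub>\<infinity>k. (\<lambda>(k1,k2). \<alpha> k1 k2) k * (1 / qinf q ^ 5))"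
    by (rule infsum_cong) auto
  also have "\<dots> = (\<Sum>\<^sub>\<infinity>(k1,k2). \<alpha> k1 k2) / qinf q ^ 5" by (simp add: infsum_cmult_left' divide_inverse)
  finally show ?thesis unfolding e .
qed

lemma Zterm_limit:
  assumes "Zterm 3 b q norm_summable_on V"
  shows "(\<lambda>N. \<Sum>\<^sub>\<infinity>n\<in>V. Zterm 3 b q n * (iq (int N - n t) * iq (int N - (n u + n v)) * iq (int N + n w)))
    \<longlonglongrightarrow> (\<Sum>\<^sub>\<infinity>n\<in>V. Zterm 3 b q n) / qinf q ^ 3"
  (is "(\<lambda>N. \<Sum>\<^sub>\<infinity>n\<in>V. ?T N n) \<longlonglongrightarrow> _")
proof -
  obtain C where C: "C \<ge> 1" "\<And>m. norm (qf m) \<le> C" "\<And>m. norm (iq m) \<le> C" using qfac_bounded by blast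
  have "(\<lambda>N. \<Sum>\<^sub>\<infinity>n\<in>V. ?T N n)
    \<longlonglongrightarrow> (\<Sum>\<^sub>\<infinity>n\<in>V. Zterm 3 b q n * (1 / qinf q ^ 3))"
  proof (rule tendsto_infsum_dominated)
    fix n :: "int \<Rightarrow> int"
    have "(\<lambda>N. Zterm 3 b q n * (iq (int N + - n t) * iq (int N + - (n u + n v)) * iq (int N + n w)))
      \<longlonglongrightarrow> Zterm 3 b q n * (1 / qinf q * (1 / qinf q) * (1 / qinf q))"
      by (intro tendsto_mult tendsto_const iq_lim)
    moreover have "1 / qinf q * (1 / qinf q) * (1 / qinf q) = 1 / qinf q ^ 3" by (simp add: power3_eq_cube)
    ultimately show "(\<lambda>N. ?T N n)
      \<longlonglongrightarrow> Zterm 3 b q n * (1 / qinf q ^ 3)" by (simp only: diff_conv_add_uminus)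
  next
    fix n :: "int \<Rightarrow> int" and N :: nat
    have "norm (iq (int N - n t) * iq (int N - (n u + n v)) * iq (int N + n w)) \<le> C * C * C"
      unfolding norm_mult using C by (intro mult_mono mult_nonneg_nonneg) (auto intro: order_trans[OF _ C(1)])
    then show "norm (?T N n) \<le>
        norm (Zterm 3 b q n) * (C * C * C)"
      unfolding norm_mult[of "Zterm 3 b q n"] by (intro mult_left_mono) auto
  next
    show "(\<lambda>n. norm (Zterm 3 b q n) * (C * C * C)) summable_on V"
      by (rule summable_on_cmult_left[OF assms])
  qed
  also have "(\<Sum>\<^sub>\<infinity>n\<in>V. Zterm 3 b q n * (1 / qinf q ^ 3)) = (\<Sum>\<^sub>\<infinity>n\<in>V. Zterm 3 b q n) / qinf q ^ 3"
    by (simp add: infsum_cmult_left' divide_inverse)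
  finally show ?thesis .
qed

text \<open>As \<open>N\<close> grows in the truncated identity, the kernel leaves the power \<open>qinf q ^ (-5)\<close>, whereas the three
truncation factors on the side of the series leave \<open>qinf q ^ (-3)\<close>.\<close>

lemma Z_eq_lattice_sum:
  assumes "Zterm 3 b q norm_summable_on gap_vectors 3 b"
    and "(\<lambda>(k1,k2). \<alpha> k1 k2) norm_summable_on UNIV"
    and "\<And>N. (\<Sum>k1\<in>{-int N..int N}. \<Sum>k2\<in>{-int N..int N}. \<alpha> k1 k2 * kernel (int N) (int N) k1 k2) =
       (\<Sum>\<^sub>\<infinity>n\<in>gap_vectors 3 b. Zterm 3 b q n * (iq (int N - n t) * iq (int N - (n u + n v)) * iq (int N + n w)))"
  shows "Z 3 b q = (\<Sum>\<^sub>\<infinity>(k1,k2). \<alpha> k1 k2) / qinf q ^ 2"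
proof -
  have "Z 3 b q / qinf q ^ 3 = (\<Sum>\<^sub>\<infinity>(k1,k2). \<alpha> k1 k2) / qinf q ^ 5"
    using Zterm_limit[OF assms(1), of t u v w] kernel_limit[OF assms(2)] unfolding assms(3) Z_def by (rule LIMSEQ_unique)
  then show ?thesis using qinf_nz by (simp add: field_simps eval_nat_numeral)
qed

end

definition supported :: "int \<Rightarrow> (int \<Rightarrow> int) \<Rightarrow> bool" where
  "supported b n \<longleftrightarrow> (\<forall>i\<in>gaps 3 b. n (i - 3) \<le> n i \<and> n (i - b) \<le> n i)"

lemma Zterm_unsupported:
  assumes "finite (gaps 3 b)" "\<not> supported b n"
  shows "Zterm 3 b q n = 0"
proof -
  obtain i where i: "i \<in> gaps 3 b" "n i - n (i - 3) < 0 \<or> n i - n (i - b) < 0"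
    using assms(2) unfolding supported_def by force
  then have "inv_qfac q (n i - n (i - 3)) = 0 \<or> inv_qfac q (n i - n (i - b)) = 0"
    by (auto simp: inv_qfac_def)
  then have "(\<Prod>i\<in>gaps 3 b. qfac q (n i - n (i - 3 - b)) * inv_qfac q (n i - n (i - 3)) * inv_qfac q (n i - n (i - b))) = 0"
    using assms(1) i(1) by (intro prod_zero) auto
  then show ?thesis unfolding Zterm_def by simp
qed

text \<open>All entries of a vector in the support of the series lie between 0 and the entry at the gap \<open>t\<close>, and the
quadratic form controls the square of that entry. The bound 7 on the number of gaps makes the form control the
sum of all squares, with one constant for all four semigroups.\<close>

definition dominated_by :: "int \<Rightarrow> int \<Rightarrow> bool" where
  "dominated_by b t \<longleftrightarrow> finite (gaps 3 b) \<and> card (gaps 3 b) \<le> 7 \<and>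
     (\<forall>n\<in>gap_vectors 3 b. supported b n \<longrightarrow>
       (\<forall>i\<in>gaps 3 b. 0 \<le> n i \<and> n i \<le> n t) \<and> 3 * (n t * n t) \<le> 4 * Q 3 b n)"

text \<open>In each of the four cases \<open>Q\<close> is a sum of forms \<open>r^2 - r J + J^2\<close>, squares, and products of differences
that are nonnegative on the support; these products are the exponents that the q-Vandermonde splits contribute. The
summand with \<open>r = n t\<close> gives the bound.\<close>

lemma dominated_by_34: "dominated_by 4 5"
  unfolding dominated_by_def gaps_34
proof (intro conjI ballI impI)
  fix n assume n: "n \<in> gap_vectors 3 4" and s: "supported 4 n"
  have z: "n (-2) = 0" "n (-1) = 0" "n (-3) = 0" using n by (auto simp: gap_vectors_def gaps_34)
  have l: "0 \<le> n 1" "0 \<le> n 2" "n 1 \<le> n 5" "n 2 \<le> n 5"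
    using s z by (auto simp: supported_def gaps_34)
  show "\<And>i. i \<in> {1, 2, 5} \<Longrightarrow> 0 \<le> n i" "\<And>i. i \<in> {1, 2, 5} \<Longrightarrow> n i \<le> n 5" using l by auto
  have "4 * Q 3 4 n = 3 * (n 5 * n 5) + (n 5 - 2 * (n 1 + n 2)) * (n 5 - 2 * (n 1 + n 2)) + 4 * (n 2 * (n 5 - n 1))"
    unfolding Q_34 by (simp add: algebra_simps)
  moreover have "0 \<le> n 2 * (n 5 - n 1)" using l by simp
  ultimately show "3 * (n 5 * n 5) \<le> 4 * Q 3 4 n" by simp
qed auto

lemma dominated_by_35: "dominated_by 5 7"
  unfolding dominated_by_def gaps_35
proof (intro conjI ballI impI)
  fix n assume n: "n \<in> gap_vectors 3 5" and s: "supported 5 n"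
  have z: "n (-2) = 0" "n (-1) = 0" "n (-4) = 0" "n (-3) = 0" using n by (auto simp: gap_vectors_def gaps_35)
  have l: "0 \<le> n 1" "0 \<le> n 2" "n 1 \<le> n 4" "n 4 \<le> n 7" "n 2 \<le> n 7"
    using s z by (auto simp: supported_def gaps_35)
  show "\<And>i. i \<in> {1, 2, 4, 7} \<Longrightarrow> 0 \<le> n i" "\<And>i. i \<in> {1, 2, 4, 7} \<Longrightarrow> n i \<le> n 7" using l by auto
  have "4 * Q 3 5 n = 3 * (n 7 * n 7) + (n 7 - 2 * (n 1 + n 2)) * (n 7 - 2 * (n 1 + n 2)) + 4 * (n 4 * n 4) + 4 * (n 2 * (n 4 - n 1))"
    unfolding Q_35 by (simp add: algebra_simps)
  moreover have "0 \<le> n 2 * (n 4 - n 1)" using l by simp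
  ultimately show "3 * (n 7 * n 7) \<le> 4 * Q 3 5 n" by simp
qed auto

lemma dominated_by_37: "dominated_by 7 11"
  unfolding dominated_by_def gaps_37
proof (intro conjI ballI impI)
  fix n assume n: "n \<in> gap_vectors 3 7" and s: "supported 7 n"
  have z: "n (-2) = 0" "n (-1) = 0" "n (-6) = 0" "n (-5) = 0" "n (-3) = 0" using n by (auto simp: gap_vectors_def gaps_37)
  have l: "0 \<le> n 1" "0 \<le> n 2" "n 1 \<le> n 4" "n 2 \<le> n 5" "n 5 \<le> n 8" "n 1 \<le> n 8" "n 8 \<le> n 11" "n 4 \<le> n 11"
    using s z by (auto simp: supported_def gaps_37)
  show "\<And>i. i \<in> {1, 2, 4, 5, 8, 11} \<Longrightarrow> 0 \<le> n i" "\<And>i. i \<in> {1, 2, 4, 5, 8, 11} \<Longrightarrow> n i \<le> n 11" using l by auto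
  have "4 * Q 3 7 n = 3 * (n 11 * n 11) + (n 11 - 2 * (n 4 + n 5)) * (n 11 - 2 * (n 4 + n 5)) +
      3 * (n 8 * n 8) + (n 8 - 2 * (n 1 + n 2)) * (n 8 - 2 * (n 1 + n 2)) +
      4 * ((n 5 - n 2) * (n 11 - n 4)) + 4 * (n 2 * (n 8 - n 1))"
    unfolding Q_37 by (simp add: algebra_simps)
  moreover have "0 \<le> (n 5 - n 2) * (n 11 - n 4)" "0 \<le> n 2 * (n 8 - n 1)" "0 \<le> n 8 * n 8"
     "0 \<le> (n 11 - 2 * (n 4 + n 5)) * (n 11 - 2 * (n 4 + n 5))" "0 \<le> (n 8 - 2 * (n 1 + n 2)) * (n 8 - 2 * (n 1 + n 2))"
    using l by simp_all
  ultimately show "3 * (n 11 * n 11) \<le> 4 * Q 3 7 n" by linarith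
qed auto

lemma dominated_by_38: "dominated_by 8 13"
  unfolding dominated_by_def gaps_38
proof (intro conjI ballI impI)
  fix n assume n: "n \<in> gap_vectors 3 8" and s: "supported 8 n"
  have z: "n (-2) = 0" "n (-1) = 0" "n (-7) = 0" "n (-6) = 0" "n (-4) = 0" "n (-3) = 0" using n by (auto simp: gap_vectors_def gaps_38)
  have l: "0 \<le> n 1" "0 \<le> n 2" "n 1 \<le> n 4" "n 2 \<le> n 5" "n 4 \<le> n 7" "n 7 \<le> n 10" "n 2 \<le> n 10" "n 10 \<le> n 13" "n 5 \<le> n 13"
    using s z by (auto simp: supported_def gaps_38)
  show "\<And>i. i \<in> {1, 2, 4, 5, 7, 10, 13} \<Longrightarrow> 0 \<le> n i" "\<And>i. i \<in> {1, 2, 4, 5, 7, 10, 13} \<Longrightarrow> n i \<le> n 13" using l by auto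
  have "4 * Q 3 8 n = 3 * (n 13 * n 13) + (n 13 - 2 * (n 4 + n 5)) * (n 13 - 2 * (n 4 + n 5)) +
      3 * (n 10 * n 10) + (n 10 - 2 * (n 1 + n 2)) * (n 10 - 2 * (n 1 + n 2)) + 4 * (n 7 * n 7) +
      4 * ((n 5 - n 2) * (n 7 - n 4)) + 4 * (n 2 * (n 7 - n 1))"
    unfolding Q_38 by (simp add: algebra_simps)
  moreover have "0 \<le> (n 5 - n 2) * (n 7 - n 4)" "0 \<le> n 2 * (n 7 - n 1)" "0 \<le> n 10 * n 10" "0 \<le> n 7 * n 7"
     "0 \<le> (n 13 - 2 * (n 4 + n 5)) * (n 13 - 2 * (n 4 + n 5))" "0 \<le> (n 10 - 2 * (n 1 + n 2)) * (n 10 - 2 * (n 1 + n 2))"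
    using l by simp_all
  ultimately show "3 * (n 13 * n 13) \<le> 4 * Q 3 8 n" by linarith
qed auto

text \<open>At \<open>q = 0\<close> only exponent 0 contributes, and the form is positive on the support away from the origin.\<close>

lemma Zterm_q_0:
  assumes "dominated_by b t" "n \<in> gap_vectors 3 b"
  shows "Zterm 3 b 0 n = of_bool (n = (\<lambda>_. 0))"
proof (cases "n = (\<lambda>_. 0)")
  case True
  then show ?thesis by (simp add: Zterm_def Q_def qfac_def inv_qfac_def)
next
  case False
  have fin: "finite (gaps 3 b)" using assms(1) by (simp add: dominated_by_def)
  show ?thesis
  proof (cases "supported b n")
    case s: True
    then have b: "\<forall>i\<in>gaps 3 b. 0 \<le> n i \<and> n i \<le> n t" and q: "3 * (n t * n t) \<le> 4 * Q 3 b n"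
      using assms unfolding dominated_by_def by blast+
    obtain i where i: "n i \<noteq> 0" using False by auto
    then have "i \<in> gaps 3 b" using assms(2) by (auto simp: gap_vectors_def)
    then have "n t > 0" using b i by force
    then have "0 < n t * n t" by simp
    then have "Q 3 b n \<noteq> 0" using q by linarith
    then show ?thesis using False by (simp add: Zterm_def)
  next
    case False
    then show ?thesis using Zterm_unsupported[OF fin] \<open>n \<noteq> (\<lambda>_. 0)\<close> by simp
  qed
qed
lemma sum_squares_le_Q:
  assumes "dominated_by b t" "n \<in> gap_vectors 3 b" "supported b n"
  shows "(\<Sum>i\<in>gaps 3 b. n i * n i) \<le> 10 * Q 3 b n"
proof -
  have b: "\<forall>i\<in>gaps 3 b. 0 \<le> n i \<and> n i \<le> n t" and q: "3 * (n t * n t) \<le> 4 * Q 3 b n"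
    and c: "card (gaps 3 b) \<le> 7"
    using assms unfolding dominated_by_def by blast+
  have "(\<Sum>i\<in>gaps 3 b. n i * n i) \<le> of_nat (card (gaps 3 b)) * (n t * n t)"
    by (rule sum_bounded_above) (use b in \<open>auto intro!: mult_mono\<close>)
  also have "\<dots> \<le> 7 * (n t * n t)" using c by (intro mult_right_mono) auto
  also have "\<dots> \<le> 10 * Q 3 b n"
  proof -
    have "0 \<le> n t * n t" by simp
    then show ?thesis using q by linarith
  qed
  finally show ?thesis .
qed

context q_disc begin

text \<open>Up to the sign, \<open>y^(m^2)\<close> is a term of the theta series with parameter \<open>y^2\<close> at the point \<open>y\<close>.\<close>

lemma square_power_summable:
  fixes y :: real
  assumes "0 < y" "y < 1"
  shows "(\<lambda>m::int. y ^ nat (m * m)) summable_on UNIV"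
proof -
  interpret y: q_disc "complex_of_real (y\<^sup>2)"
    using assms by unfold_locales (auto simp: norm_power power_less_one_iff)
  have "norm (theta_term (of_real (y\<^sup>2)) (of_real y) m) = y ^ nat (m * m)" for m :: int
  proof -
    obtain a where a: "m * (m - 1) = a * 2" using consecutive_product_even by blast
    have "norm (theta_term (of_real (y\<^sup>2)) (of_real y) m) = (y\<^sup>2) powi a * y powi m"
    proof -
      have "norm (complex_of_real (y\<^sup>2)) = y\<^sup>2" "norm (complex_of_real y) = y" using assms by (simp_all only: norm_of_real) simp_all
      then show ?thesis unfolding theta_term_def a norm_mult norm_power_int by simp
    qed
    also have "(y\<^sup>2) powi a = y powi (2 * a)" by (simp add: power_int_mult)
    also have "y powi (2 * a) * y powi m = y powi (m * m)"
      using a assms by (simp flip: power_int_add add: algebra_simps)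
    also have "\<dots> = y ^ nat (m * m)" by (simp add: power_int_def)
    finally show ?thesis .
  qed
  then show ?thesis using y.theta_term_abs_summable[of "of_real y"] assms by simp
qed

text \<open>With \<open>y^10 = |q|\<close>, the bound on the form dominates \<open>|q|^Q\<close> by a product of independent factors
\<open>y^(n_i^2)\<close>; the q-factorials are bounded uniformly.\<close>

lemma Zterm_norm_summable:
  assumes tb: "dominated_by b t"
  shows "Zterm 3 b q norm_summable_on gap_vectors 3 b"
proof -
  let ?G = "gaps 3 b" and ?V = "gap_vectors 3 b"
  have fin: "finite ?G" using tb by (simp add: dominated_by_def)
  obtain C where C: "C \<ge> 1" "\<And>m. norm (qf m) \<le> C" "\<And>m. norm (iq m) \<le> C" using qfac_bounded by blast
  define y where "y = root 10 (norm q)"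
  have y: "0 < y" "y < 1" "y ^ 10 = norm q" using q_nz q_lt_1 by (auto simp: y_def)
  define M where "M = (\<lambda>n::int\<Rightarrow>int. (\<Prod>i\<in>?G. y ^ nat (n i * n i)) * (\<Prod>i\<in>?G. C * C * C))"
  have "(\<lambda>g. \<Prod>i\<in>?G. (\<lambda>m. y ^ nat (m * m)) (g i)) norm_summable_on (PiE ?G (\<lambda>_. UNIV))"
    unfolding abs_summable_equivalent
    by (rule abs_summable_on_prod_PiE[OF fin]) (use square_power_summable[OF y(1,2)] y(1) in \<open>auto simp flip: abs_summable_equivalent\<close>)
  then have "(\<lambda>g. \<Prod>i\<in>?G. y ^ nat (g i * g i)) summable_on (PiE ?G (\<lambda>_. UNIV))"
    using y(1) by (simp add: abs_prod)
  then have "(\<lambda>n. \<Prod>i\<in>?G. y ^ nat (n i * n i)) summable_on ?V"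
    by (rule iffD1[OF summable_on_reindex_bij_witness[of _ "\<lambda>n. restrict n ?G" "\<lambda>g i. if i \<in> ?G then g i else 0"], rotated -1])
       (auto simp: gap_vectors_def fun_eq_iff PiE_def extensional_def)
  then have M: "M summable_on ?V" unfolding M_def by (rule summable_on_cmult_left)
  show ?thesis
  proof (rule Infinite_Sum.abs_summable_on_comparison_test'[OF M])
    fix n assume n: "n \<in> ?V"
    show "norm (Zterm 3 b q n) \<le> M n"
    proof (cases "supported b n")
      case False
      have "M n \<ge> 0" using y(1) C(1) unfolding M_def by (intro mult_nonneg_nonneg prod_nonneg) auto
      then show ?thesis using Zterm_unsupported[OF fin False] by simp
    next
      case True
      have s: "(\<Sum>i\<in>?G. n i * n i) \<le> 10 * Q 3 b n" by (rule sum_squares_le_Q[OF tb n True])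
      have s0: "0 \<le> (\<Sum>i\<in>?G. n i * n i)" by (rule sum_nonneg) simp
      have Q0: "0 \<le> Q 3 b n" using s s0 by linarith
      have "norm (q powi Q 3 b n) = y ^ (10 * nat (Q 3 b n))"
        using Q0 y(3) by (simp add: power_int_def norm_power power_mult)
      also have "\<dots> \<le> y ^ nat (\<Sum>i\<in>?G. n i * n i)"
        by (rule power_decreasing) (use s Q0 y in auto)
      also have "nat (\<Sum>i\<in>?G. n i * n i) = (\<Sum>i\<in>?G. nat (n i * n i))"
      proof -
        have "int (\<Sum>i\<in>?G. nat (n i * n i)) = (\<Sum>i\<in>?G. n i * n i)" by simp
        then show ?thesis by (metis nat_int)
      qed
      also have "y ^ (\<Sum>i\<in>?G. nat (n i * n i)) = (\<Prod>i\<in>?G. y ^ nat (n i * n i))" by (rule power_sum)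
      finally have 1: "norm (q powi Q 3 b n) \<le> (\<Prod>i\<in>?G. y ^ nat (n i * n i))" .
      have 2: "norm (\<Prod>i\<in>?G. qf (n i - n (i - 3 - b)) * iq (n i - n (i - 3)) * iq (n i - n (i - b))) \<le> (\<Prod>i\<in>?G. C * C * C)"
        unfolding prod_norm[symmetric] norm_mult
        by (rule prod_mono) (use C in \<open>auto intro!: mult_mono mult_nonneg_nonneg intro: order_trans[OF _ C(1)]\<close>)
      show ?thesis unfolding Zterm_def norm_mult M_def
        by (intro mult_mono 1 2) (use y(1) in \<open>auto intro!: prod_nonneg\<close>)
    qed
  qed
qed

text \<open>On the support all entries are at most the one at \<open>t\<close>, and this one is at most \<open>N\<close> unless the reciprocal
vanishes.\<close>

lemma box_sum:
  fixes N :: nat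
  assumes tb: "dominated_by b t" and t: "t \<in> gaps 3 b"
  shows "(\<Sum>\<^sub>\<infinity>n\<in>gap_vectors 3 b. Zterm 3 b q n * (iq (int N - n t) * w n)) =
    (\<Sum>n\<in>{n\<in>gap_vectors 3 b. \<forall>i\<in>gaps 3 b. n i \<in> {0..int N}}. Zterm 3 b q n * (iq (int N - n t) * w n))"
proof -
  let ?G = "gaps 3 b" and ?V = "gap_vectors 3 b"
  have fin: "finite ?G" using tb by (simp add: dominated_by_def)
  let ?B = "{n\<in>?V. \<forall>i\<in>?G. n i \<in> {0..int N}}"
  have "?B \<subseteq> (\<lambda>g i. if i \<in> ?G then g i else 0) ` (PiE ?G (\<lambda>_. {0..int N}))"
  proof
    fix n assume n: "n \<in> ?B"
    then have "n = (\<lambda>i. if i \<in> ?G then restrict n ?G i else 0)" by (auto simp: gap_vectors_def fun_eq_iff)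
    moreover have "restrict n ?G \<in> PiE ?G (\<lambda>_. {0..int N})" using n by auto
    ultimately show "n \<in> (\<lambda>g i. if i \<in> ?G then g i else 0) ` (PiE ?G (\<lambda>_. {0..int N}))" by blast
  qed
  then have finB: "finite ?B" by (rule finite_subset) (use fin in \<open>auto intro!: finite_PiE\<close>)
  have "(\<Sum>\<^sub>\<infinity>n\<in>?V. Zterm 3 b q n * (iq (int N - n t) * w n)) = (\<Sum>\<^sub>\<infinity>n\<in>?B. Zterm 3 b q n * (iq (int N - n t) * w n))"
  proof (rule infsum_cong_neutral)
    fix n assume n: "n \<in> ?V - ?B"
    show "Zterm 3 b q n * (iq (int N - n t) * w n) = 0"
    proof (cases "supported b n")
      case False
      then show ?thesis using Zterm_unsupported[OF fin] by simp
    next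
      case True
      then have b: "\<forall>i\<in>?G. 0 \<le> n i \<and> n i \<le> n t" using tb n unfolding dominated_by_def by blast
      then have "n t > int N" using n by force
      then show ?thesis by (simp add: iq_neg)
    qed
  qed auto
  also have "\<dots> = (\<Sum>n\<in>?B. Zterm 3 b q n * (iq (int N - n t) * w n))"
    by (rule infsum_finite[OF finB])
  finally show ?thesis .
qed

lemma Zterm_34:
  assumes "n \<in> gap_vectors 3 4" "\<forall>i\<in>gaps 3 4. 0 \<le> n i"
  shows "Zterm 3 4 q n = summand_34 (n 1) (n 2) (n 5)"
proof -
  have z: "n (-2) = 0" "n (-1) = 0" "n (-3) = 0" "n (-6) = 0" "n (-5) = 0"
    using assms(1) by (auto simp: gap_vectors_def gaps_34)
  have s: "qf x * (y * iq x) = y" if "x \<ge> 0" for x y using qf_iq[OF that] by simp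
  show ?thesis
    using assms(2) unfolding summand_34_def Zterm_def Q_34 gaps_34 by (simp add: z s mult.assoc)
qed

lemma Zterm_35:
  assumes "n \<in> gap_vectors 3 5" "\<forall>i\<in>gaps 3 5. 0 \<le> n i"
  shows "Zterm 3 5 q n = summand_35 (n 1) (n 2) (n 4) (n 7)"
proof -
  have z: "n (-2) = 0" "n (-1) = 0" "n (-3) = 0" "n (-6) = 0" "n (-7) = 0" "n (-4) = 0"
    using assms(1) by (auto simp: gap_vectors_def gaps_35)
  have s: "qf x * (y * iq x) = y" if "x \<ge> 0" for x y using qf_iq[OF that] by simp
  show ?thesis
    using assms(2) unfolding summand_35_def Zterm_def Q_35 gaps_35 by (simp add: z s mult.assoc)
qed

lemma Zterm_37:
  assumes "n \<in> gap_vectors 3 7" "\<forall>i\<in>gaps 3 7. 0 \<le> n i"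
  shows "Zterm 3 7 q n = summand_37 (n 1) (n 2) (n 4) (n 5) (n 8) (n 11)"
proof -
  have z: "n (-2) = 0" "n (-1) = 0" "n (-9) = 0" "n (-6) = 0" "n (-8) = 0" "n (-5) = 0" "n (-3) = 0"
    using assms(1) by (auto simp: gap_vectors_def gaps_37)
  have s: "qf x * (y * iq x) = y" if "x \<ge> 0" for x y using qf_iq[OF that] by simp
  show ?thesis
    using assms(2) unfolding summand_37_def Zterm_def Q_37 gaps_37 by (simp add: z s mult.assoc)
qed

lemma Zterm_38:
  assumes "n \<in> gap_vectors 3 8" "\<forall>i\<in>gaps 3 8. 0 \<le> n i"
  shows "Zterm 3 8 q n = summand_38 (n 1) (n 2) (n 4) (n 5) (n 7) (n 10) (n 13)"
proof -
  have z: "n (-2) = 0" "n (-1) = 0" "n (-10) = 0" "n (-7) = 0" "n (-9) = 0" "n (-6) = 0" "n (-4) = 0" "n (-3) = 0"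
    using assms(1) by (auto simp: gap_vectors_def gaps_38)
  have s: "qf x * (y * iq x) = y" if "x \<ge> 0" for x y using qf_iq[OF that] by simp
  show ?thesis
    using assms(2) unfolding summand_38_def Zterm_def Q_38 gaps_38 by (simp add: z s mult.assoc)
qed

text \<open>Here and below, the right-hand side of the finite identity is read as a sum over vectors indexed by the gaps.\<close>

lemma Zsum_34:
  "(\<Sum>k1\<in>{-int N..int N}. \<Sum>k2\<in>{-int N..int N}. (of_int (eps k1 k2) * q powi (2 * nrm k1 k2 + shift_exp k1 k2)) * kernel (int N) (int N) k1 k2) =
   (\<Sum>\<^sub>\<infinity>n\<in>gap_vectors 3 4. Zterm 3 4 q n * (iq (int N - n 5) * iq (int N - (n 1 + n 2)) * iq (int N + n 5)))"
  (is "_ = ?rhs")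
proof -
  let ?I = "{0..int N}" and ?B = "{n\<in>gap_vectors 3 4. \<forall>i\<in>gaps 3 4. n i \<in> {0..int N}}"
  let ?F = "\<lambda>n5 n1 n2. summand_34 n1 n2 n5 * (iq (int N-n5) * iq (int N-(n1+n2)) * iq (int N+n5))"
  let ?w = "\<lambda>n. iq (int N - (n 1 + n 2)) * iq (int N + n 5)"
  have "?rhs =
     (\<Sum>n\<in>?B. Zterm 3 4 q n * (iq (int N - n 5) * ?w n))"
    unfolding mult.assoc[of "iq (int N - _)"] by (rule box_sum[OF dominated_by_34]) (simp add: gaps_34)
  also have "\<dots> = (\<Sum>n\<in>?B. (\<lambda>(n5, n1, n2). ?F n5 n1 n2) (n 5, n 1, n 2))"
    by (rule sum.cong[OF refl]) (simp add: Zterm_34 mult.assoc)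
  also have "\<dots> = (\<Sum>(n5, n1, n2)\<in>?I \<times> ?I \<times> ?I. ?F n5 n1 n2)"
    by (rule sum.reindex_bij_witness[of _
          "\<lambda>(n5, n1, n2) i.
             if i = 5 then n5
             else if i = 1 then n1
             else if i = 2 then n2 else 0"
          "\<lambda>n. (n 5, n 1, n 2)"])
       (auto simp: gap_vectors_def gaps_34 fun_eq_iff)
  finally show ?thesis
    unfolding finite_identity_34[OF of_nat_0_le_iff] unfolding sum.cartesian_product by simp
qed

lemma Zsum_35:
  "(\<Sum>k1\<in>{-int N..int N}. \<Sum>k2\<in>{-int N..int N}. (of_int (eps k1 k2) * q powi (3 * nrm k1 k2 - shift_exp k1 k2)) * kernel (int N) (int N) k1 k2) =
   (\<Sum>\<^sub>\<infinity>n\<in>gap_vectors 3 5. Zterm 3 5 q n * (iq (int N - n 7) * iq (int N - (n 1 + n 2)) * iq (int N + n 4)))"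
  (is "_ = ?rhs")
proof -
  let ?I = "{0..int N}" and ?B = "{n\<in>gap_vectors 3 5. \<forall>i\<in>gaps 3 5. n i \<in> {0..int N}}"
  let ?F = "\<lambda>n4 n7 n1 n2. summand_35 n1 n2 n4 n7 * (iq (int N-n7) * iq (int N-(n1+n2)) * iq (int N+n4))"
  let ?w = "\<lambda>n. iq (int N - (n 1 + n 2)) * iq (int N + n 4)"
  have "?rhs =
     (\<Sum>n\<in>?B. Zterm 3 5 q n * (iq (int N - n 7) * ?w n))"
    unfolding mult.assoc[of "iq (int N - _)"] by (rule box_sum[OF dominated_by_35]) (simp add: gaps_35)
  also have "\<dots> = (\<Sum>n\<in>?B. (\<lambda>(n4, n7, n1, n2). ?F n4 n7 n1 n2) (n 4, n 7, n 1, n 2))"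
    by (rule sum.cong[OF refl]) (simp add: Zterm_35 mult.assoc)
  also have "\<dots> = (\<Sum>(n4, n7, n1, n2)\<in>?I \<times> ?I \<times> ?I \<times> ?I. ?F n4 n7 n1 n2)"
    by (rule sum.reindex_bij_witness[of _
          "\<lambda>(n4, n7, n1, n2) i.
             if i = 4 then n4
             else if i = 7 then n7
             else if i = 1 then n1
             else if i = 2 then n2 else 0"
          "\<lambda>n. (n 4, n 7, n 1, n 2)"])
       (auto simp: gap_vectors_def gaps_35 fun_eq_iff)
  finally show ?thesis
    unfolding finite_identity_35[OF of_nat_0_le_iff] unfolding sum.cartesian_product by simp
qed

lemma Zsum_37:
  "(\<Sum>k1\<in>{-int N..int N}. \<Sum>k2\<in>{-int N..int N}. (of_int (eps k1 k2) * q powi (3 * nrm k1 k2 + shift_exp k1 k2)) * kernel (int N) (int N) k1 k2) =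
   (\<Sum>\<^sub>\<infinity>n\<in>gap_vectors 3 7. Zterm 3 7 q n * (iq (int N - n 11) * iq (int N - (n 4 + n 5)) * iq (int N + n 8)))"
  (is "_ = ?rhs")
proof -
  let ?I = "{0..int N}" and ?B = "{n\<in>gap_vectors 3 7. \<forall>i\<in>gaps 3 7. n i \<in> {0..int N}}"
  let ?F = "\<lambda>n8 n11 n1 n2 n4 n5. summand_37 n1 n2 n4 n5 n8 n11 * (iq (int N-n11) * iq (int N-(n4+n5)) * iq (int N+n8))"
  let ?w = "\<lambda>n. iq (int N - (n 4 + n 5)) * iq (int N + n 8)"
  have "?rhs =
     (\<Sum>n\<in>?B. Zterm 3 7 q n * (iq (int N - n 11) * ?w n))"
    unfolding mult.assoc[of "iq (int N - _)"] by (rule box_sum[OF dominated_by_37]) (simp add: gaps_37)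
  also have "\<dots> = (\<Sum>n\<in>?B. (\<lambda>(n8, n11, n1, n2, n4, n5). ?F n8 n11 n1 n2 n4 n5) (n 8, n 11, n 1, n 2, n 4, n 5))"
    by (rule sum.cong[OF refl]) (simp add: Zterm_37 mult.assoc)
  also have "\<dots> = (\<Sum>(n8, n11, n1, n2, n4, n5)\<in>?I \<times> ?I \<times> ?I \<times> ?I \<times> ?I \<times> ?I. ?F n8 n11 n1 n2 n4 n5)"
    by (rule sum.reindex_bij_witness[of _
          "\<lambda>(n8, n11, n1, n2, n4, n5) i.
             if i = 8 then n8
             else if i = 11 then n11
             else if i = 1 then n1
             else if i = 2 then n2
             else if i = 4 then n4
             else if i = 5 then n5 else 0"
          "\<lambda>n. (n 8, n 11, n 1, n 2, n 4, n 5)"])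
       (auto simp: gap_vectors_def gaps_37 fun_eq_iff)
  finally show ?thesis
    unfolding finite_identity_37[OF of_nat_0_le_iff] unfolding sum.cartesian_product by simp
qed

lemma Zsum_38:
  "(\<Sum>k1\<in>{-int N..int N}. \<Sum>k2\<in>{-int N..int N}. (of_int (eps k1 k2) * q powi (4 * nrm k1 k2 - shift_exp k1 k2)) * kernel (int N) (int N) k1 k2) =
   (\<Sum>\<^sub>\<infinity>n\<in>gap_vectors 3 8. Zterm 3 8 q n * (iq (int N - n 13) * iq (int N - (n 4 + n 5)) * iq (int N + n 7)))"
  (is "_ = ?rhs")
proof -
  let ?I = "{0..int N}" and ?B = "{n\<in>gap_vectors 3 8. \<forall>i\<in>gaps 3 8. n i \<in> {0..int N}}"
  let ?F = "\<lambda>n7 n10 n13 n1 n2 n4 n5. summand_38 n1 n2 n4 n5 n7 n10 n13 * (iq (int N-n13) * iq (int N-(n4+n5)) * iq (int N+n7))"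
  let ?w = "\<lambda>n. iq (int N - (n 4 + n 5)) * iq (int N + n 7)"
  have "?rhs =
     (\<Sum>n\<in>?B. Zterm 3 8 q n * (iq (int N - n 13) * ?w n))"
    unfolding mult.assoc[of "iq (int N - _)"] by (rule box_sum[OF dominated_by_38]) (simp add: gaps_38)
  also have "\<dots> = (\<Sum>n\<in>?B. (\<lambda>(n7, n10, n13, n1, n2, n4, n5). ?F n7 n10 n13 n1 n2 n4 n5) (n 7, n 10, n 13, n 1, n 2, n 4, n 5))"
    by (rule sum.cong[OF refl]) (simp add: Zterm_38 mult.assoc)
  also have "\<dots> = (\<Sum>(n7, n10, n13, n1, n2, n4, n5)\<in>?I \<times> ?I \<times> ?I \<times> ?I \<times> ?I \<times> ?I \<times> ?I. ?F n7 n10 n13 n1 n2 n4 n5)"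
    by (rule sum.reindex_bij_witness[of _
          "\<lambda>(n7, n10, n13, n1, n2, n4, n5) i.
             if i = 7 then n7
             else if i = 10 then n10
             else if i = 13 then n13
             else if i = 1 then n1
             else if i = 2 then n2
             else if i = 4 then n4
             else if i = 5 then n5 else 0"
          "\<lambda>n. (n 7, n 10, n 13, n 1, n 2, n 4, n 5)"])
       (auto simp: gap_vectors_def gaps_38 fun_eq_iff)
  finally show ?thesis
    unfolding finite_identity_38[OF of_nat_0_le_iff] unfolding sum.cartesian_product by simp
qed

end

section \<open>The product and the lattice sum\<close>

text \<open>The exponents of the lattice sums are integers at the lattice points that contribute.\<close>

lemma eps_nonzero_dvd:
  assumes "eps k1 k2 \<noteq> 0"
  obtains z where "nrm k1 k2 + k1 - k2 = 3 * z"
proof -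
  define m where "m = (k2 - k1 + 1) div 3"
  have "(k2 - k1 + 1) mod 3 = 1 \<or> (k2 - k1 + 1) mod 3 = 2"
    using assms unfolding eps_def chi3_def by (auto split: if_splits)
  then have "k2 = k1 + 3 * m \<or> k2 = k1 + 3 * m + 1" unfolding m_def by presburger
  then consider "k2 = k1 + 3 * m" | "k2 = k1 + 3 * m + 1" by blast
  then show ?thesis
  proof cases
    case 1
    show ?thesis by (rule that[of "k1*k1 + 3*k1*m + 3*m*m - m"]) (simp add: nrm_def 1 algebra_simps)
  next
    case 2
    show ?thesis by (rule that[of "k1*k1 + 3*k1*m + k1 + 3*m*m + m"]) (simp add: nrm_def 2 algebra_simps)
  qed
qed

context q_disc begin

text \<open>The exponent produced by the Bailey steps is compared with the one in the denominator identity for \<open>q^K\<close> through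
the common parameter \<open>z = (nrm k1 k2 + k1 - k2) / 3\<close>.\<close>

lemma lattice_term_eq:
  assumes "K > 0"
    and e: "\<And>z. nrm k1 k2 = 3 * z - k1 + k2 \<Longrightarrow> shift_exp k1 k2 = z - k1 \<Longrightarrow> e = int K * z - int a * k1 + int b * k2"
  shows "of_int (eps k1 k2) * q powi e = q_disc.macdonald_term (q ^ K) (q ^ a) (q ^ b) k1 k2"
proof -
  interpret Qd: q_disc "q ^ K" by (rule q_disc_power[OF assms(1)])
  show ?thesis
  proof (cases "eps k1 k2 = 0")
    case True
    then show ?thesis by (simp add: Qd.macdonald_term_def)
  next
    case False
    then obtain z where z: "nrm k1 k2 + k1 - k2 = 3 * z" by (rule eps_nonzero_dvd)
    have "nrm k1 k2 - 2*k1 - k2 = 3 * (z - k1)" using z by simp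
    then have s: "shift_exp k1 k2 = z - k1" unfolding shift_exp_def by simp
    have e': "e = int K * z + int a * (- k1) + int b * k2" using e[OF _ s] z by simp
    have "q powi e = (q ^ K) powi z * (q ^ a) powi (- k1) * (q ^ b) powi k2"
      unfolding e' powi_add by (simp only: power_int_mult power_int_of_nat)
    then show ?thesis unfolding Qd.macdonald_term_def z by (simp add: mult.assoc)
  qed
qed

text \<open>The exponents take the values 0, 1 and 2 only, so that the product is the inverse of a product of two absolutely
convergent ones.\<close>

lemma P_partial_products:
  assumes "\<And>i. r 3 b i \<in> {0, 1, 2}"
  shows "(\<lambda>n. \<Prod>i<n. (1 - q ^ Suc i) powi (- r 3 b (int (Suc i)))) \<longlonglongrightarrow> P 3 b q"
proof -
  define g where "g = (\<lambda>(c :: nat \<Rightarrow> bool) i. if c i then 1 - q ^ Suc i else 1)"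
  have g: "convergent_prod (g c)" for c
  proof (rule abs_convergent_prod_imp_convergent_prod, rule summable_imp_abs_convergent_prod)
    have "summable (\<lambda>i. norm q * norm q ^ i)"
      by (intro summable_mult summable_geometric) (use q_lt_1 in simp)
    then show "summable (\<lambda>i. norm (g c i - 1))"
      by (rule summable_comparison_test') (simp add: g_def norm_mult norm_power)
  qed
  let ?f = "\<lambda>i. (1 - q ^ Suc i) powi (- r 3 b (int (Suc i)))"
  have "?f i = inverse (g (\<lambda>i. r 3 b (int (Suc i)) \<ge> 1) i * g (\<lambda>i. r 3 b (int (Suc i)) \<ge> 2) i)" for i
  proof -
    consider "r 3 b (int (Suc i)) = 0" | "r 3 b (int (Suc i)) = 1" | "r 3 b (int (Suc i)) = 2"
      using assms[of "int (Suc i)"] by blast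
    then show ?thesis
      by cases (simp_all only: g_def, simp_all add: power_int_minus power2_eq_square)
  qed
  then have "convergent_prod ?f"
    using convergent_prod_inverse[OF convergent_prod_mult[OF g g]] by (simp only:)
  then have "(\<lambda>n. \<Prod>i\<le>n. ?f i) \<longlonglongrightarrow> P 3 b q"
    unfolding P_def by (rule convergent_prod_LIMSEQ)
  then have "(\<lambda>n. \<Prod>i<Suc n. ?f i) \<longlonglongrightarrow> P 3 b q" unfolding lessThan_Suc_atMost .
  then show ?thesis by (subst (asm) filterlim_sequentially_Suc)
qed

text \<open>The product of \<open>(1 - q^i)^(2 - r(i))\<close> over a block of \<open>K\<close> consecutive indices: \<open>2 - r(i)\<close> counts how
often \<open>i\<close> occurs modulo \<open>K\<close> among \<open>a, K - a, b, K - b, c, K - c, K, K\<close>.\<close>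

definition residue_blocks :: "int \<Rightarrow> nat \<Rightarrow> nat \<Rightarrow> nat \<Rightarrow> nat \<Rightarrow> bool" where
  "residue_blocks B K a b c \<longleftrightarrow> (\<forall>m.
     (\<Prod>j<K. (1 - q ^ (m*K + Suc j))\<^sup>2 * (1 - q ^ (m*K + Suc j)) powi (- r 3 B (int (m*K + Suc j)))) =
     ((1 - q ^ (m*K + a)) * (1 - q ^ (m*K + (K - a)))) * ((1 - q ^ (m*K + b)) * (1 - q ^ (m*K + (K - b)))) *
     ((1 - q ^ (m*K + c)) * (1 - q ^ (m*K + (K - c)))) * (1 - q ^ (m*K + K))\<^sup>2)"

text \<open>Grouped into blocks of \<open>K\<close> factors, the partial products are those of three Jacobi triple products in
\<open>q^K\<close> and of the square of \<open>qinf (q^K)\<close>.\<close>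

lemma P_eq_lattice_sum:
  assumes K: "a + b + c = K" "a > 0"
    and r: "\<And>i. r 3 B i \<in> {0, 1, 2}"
    and blk: "residue_blocks B K a b c"
  shows "P 3 B q * (qinf q)\<^sup>2 = (\<Sum>\<^sub>\<infinity>(k1,k2). q_disc.macdonald_term (q ^ K) (q ^ a) (q ^ b) k1 k2)"
proof -
  have K0: "K > 0" using K by simp
  interpret Qd: q_disc "q ^ K" by (rule q_disc_power[OF K0])
  let ?Q = "q ^ K"
  define L where "L = (\<lambda>x n. \<Prod>i<n. (1 - x * ?Q ^ i) * (1 - ?Q ^ Suc i / x))"
  have L: "L x \<longlonglongrightarrow> theta ?Q x / qinf ?Q" if "x \<noteq> 0" for x
    unfolding L_def by (rule Qd.jacobi_triple_product[OF that])
  let ?f = "\<lambda>i. (1 - q ^ Suc i)\<^sup>2 * (1 - q ^ Suc i) powi (- r 3 B (int (Suc i)))"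
  let ?PP = "\<lambda>n. \<Prod>i<n. (1 - q ^ Suc i) powi (- r 3 B (int (Suc i)))"
  have p1: "q ^ (m*K + d) = q ^ d * ?Q ^ m" for m d
    by (simp add: power_add mult.commute flip: power_mult)
  have p2: "q ^ (m*K + (K - d)) = ?Q ^ Suc m / q ^ d" if "d \<le> K" for m d
    using that q_nz by (simp add: p1 power_diff)
  have eq: "(qf (int (n*K)))\<^sup>2 * ?PP (n*K) = L (q^a) n * L (q^b) n * L (q^c) n * (Qd.qf (int n))\<^sup>2" for n
  proof -
    have "(qf (int (n*K)))\<^sup>2 * ?PP (n*K) = (\<Prod>i<n*K. ?f i)"
      unfolding qf_of_nat prod_power_distrib prod.distrib ..
    also have "\<dots> = (\<Prod>m<n. \<Prod>i\<in>{m*K..<m*K+K}. ?f i)" by (rule prod.nat_group[symmetric])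
    also have "\<dots> = (\<Prod>m<n. ((1 - q^a * ?Q^m) * (1 - ?Q^Suc m / q^a)) * ((1 - q^b * ?Q^m) * (1 - ?Q^Suc m / q^b)) *
       ((1 - q^c * ?Q^m) * (1 - ?Q^Suc m / q^c)) * (1 - ?Q^Suc m)\<^sup>2)"
      (is "_ = (\<Prod>m<n. ?rhs m)")
    proof (rule prod.cong[OF refl])
      fix m
      have "(\<Prod>i\<in>{m*K..<m*K+K}. ?f i) = (\<Prod>j<K. ?f (m*K + j))"
        by (rule prod.reindex_bij_witness[of _ "\<lambda>j. m*K + j" "\<lambda>i. i - m*K"]) auto
      also have "\<dots> = (\<Prod>j<K. (1 - q ^ (m*K + Suc j))\<^sup>2 * (1 - q ^ (m*K + Suc j)) powi (- r 3 B (int (m*K + Suc j))))"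
        by simp
      also have "\<dots> = ?rhs m"
      proof -
        have le: "a \<le> K" "b \<le> K" "c \<le> K" using K by auto
        have e: "q ^ (m*K + K) = ?Q ^ Suc m" using p1[of m K] by simp
        show ?thesis
          using blk unfolding residue_blocks_def p2[OF le(1)] p2[OF le(2)] p2[OF le(3)] p1[of _ a] p1[of _ b] p1[of _ c]
          by (simp only: e)
      qed
      finally show "(\<Prod>i\<in>{m*K..<m*K+K}. ?f i) = ?rhs m" .
    qed
    also have "\<dots> = L (q^a) n * L (q^b) n * L (q^c) n * (Qd.qf (int n))\<^sup>2"
      unfolding L_def Qd.qf_of_nat prod_power_distrib prod.distrib ..
    finally show ?thesis .
  qed
  have "(\<lambda>n. (qf (int (n*K)))\<^sup>2 * ?PP (n*K)) \<longlonglongrightarrow> (qinf q)\<^sup>2 * P 3 B q"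
  proof (intro tendsto_mult tendsto_power)
    have s: "strict_mono (\<lambda>n. n*K)" using K0 by (simp add: strict_mono_def)
    show "(\<lambda>n. qf (int (n*K))) \<longlonglongrightarrow> qinf q" by (rule qf_lim'[OF filterlim_subseq[OF s]])
    show "(\<lambda>n. ?PP (n*K)) \<longlonglongrightarrow> P 3 B q"
      using filterlim_compose[OF P_partial_products[OF r] filterlim_subseq[OF s]] .
  qed
  moreover have "(\<lambda>n. L (q^a) n * L (q^b) n * L (q^c) n * (Qd.qf (int n))\<^sup>2) \<longlonglongrightarrow>
     theta ?Q (q^a) / qinf ?Q * (theta ?Q (q^b) / qinf ?Q) * (theta ?Q (q^c) / qinf ?Q) * (qinf ?Q)\<^sup>2"
    by (intro tendsto_mult tendsto_power L Qd.qf_lim) (use q_nz in auto)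
  ultimately have "(qinf q)\<^sup>2 * P 3 B q = theta ?Q (q^a) / qinf ?Q * (theta ?Q (q^b) / qinf ?Q) * (theta ?Q (q^c) / qinf ?Q) * (qinf ?Q)\<^sup>2"
    unfolding eq by (rule LIMSEQ_unique)
  also have "\<dots> = theta ?Q (q^a) * theta ?Q (q^b) * theta ?Q (q^c) / qinf ?Q"
    using Qd.qinf_nz by (simp add: field_simps power2_eq_square)
  also have "q ^ c = ?Q / (q ^ a * q ^ b)" using q_nz unfolding K(1)[symmetric] by (simp add: power_add)
  also have "theta ?Q (q^a) * theta ?Q (q^b) * theta ?Q (?Q / (q ^ a * q ^ b)) / qinf ?Q =
      (\<Sum>\<^sub>\<infinity>(k1,k2). Qd.macdonald_term (q ^ a) (q ^ b) k1 k2)"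
    using Qd.macdonald(2)[of "q^a" "q^b"] q_nz Qd.qinf_nz by (simp add: field_simps)
  finally show ?thesis by (simp only: mult.commute)
qed

lemma Z_eq_P:
  assumes tb: "dominated_by B t"
    and K: "a + b + c = K" "a > 0"
    and r: "\<And>i. r 3 B i \<in> {0, 1, 2}"
    and blk: "residue_blocks B K a b c"
    and e: "\<And>k1 k2 z. nrm k1 k2 = 3 * z - k1 + k2 \<Longrightarrow> shift_exp k1 k2 = z - k1 \<Longrightarrow> e k1 k2 = int K * z - int a * k1 + int b * k2"
    and Zs: "\<And>N. (\<Sum>k1\<in>{-int N..int N}. \<Sum>k2\<in>{-int N..int N}. (of_int (eps k1 k2) * q powi (e k1 k2)) * kernel (int N) (int N) k1 k2) =
       (\<Sum>\<^sub>\<infinity>n\<in>gap_vectors 3 B. Zterm 3 B q n * (iq (int N - n t) * iq (int N - (n u + n v)) * iq (int N + n w)))"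
  shows "Z 3 B q = P 3 B q"
proof -
  have K0: "K > 0" using K by simp
  interpret Qd: q_disc "q ^ K" by (rule q_disc_power[OF K0])
  have \<alpha>: "of_int (eps k1 k2) * q powi (e k1 k2) = Qd.macdonald_term (q ^ a) (q ^ b) k1 k2" for k1 k2
    by (rule lattice_term_eq[OF K0]) (rule e)
  have "Z 3 B q = (\<Sum>\<^sub>\<infinity>(k1,k2). Qd.macdonald_term (q ^ a) (q ^ b) k1 k2) / qinf q ^ 2"
  proof (rule Z_eq_lattice_sum[OF Zterm_norm_summable[OF tb]])
    show "(\<lambda>(k1,k2). Qd.macdonald_term (q ^ a) (q ^ b) k1 k2) norm_summable_on UNIV"
      by (rule Qd.macdonald(1)) (use q_nz in auto)
  qed (rule Zs[unfolded \<alpha>])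
  also have "\<dots> = P 3 B q"
    using P_eq_lattice_sum[OF K r blk] qinf_nz by (simp add: field_simps)
  finally show ?thesis .
qed

lemma square_powi:
  assumes "x \<noteq> (0::complex)" "e \<in> {0, 1, 2}"
  shows "x\<^sup>2 * x powi (- e) = x ^ nat (2 - e)"
proof -
  consider "e = 0" | "e = 1" | "e = 2" using assms(2) by blast
  then show ?thesis
    by cases (use assms(1) in \<open>simp_all add: power_int_minus power2_eq_square field_simps\<close>)
qed

lemma one_minus_nz: "n > 0 \<Longrightarrow> 1 - q ^ n \<noteq> 0"
  using q_nr[of n] by auto

end

lemma r_def': "b > 0 \<Longrightarrow> r 3 b i = min 3 (min b (min (3*i mod (3+b)) (3+b - 3*i mod (3+b)))) - 1 + of_bool (3+b dvd i)"
  unfolding r_def by (subst dist_multiples_eq) auto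

lemma r_periodic:
  assumes "b > 0"
  shows "r 3 b ((3+b)*m + j) = r 3 b j"
proof -
  have "3 * ((3+b)*m + j) = 3 * j + (3+b) * (3*m)" by (simp add: algebra_simps)
  then have "3 * ((3+b)*m + j) mod (3+b) = 3 * j mod (3+b)" by (simp only: mod_mult_self2)
  moreover have "3+b dvd (3+b)*m + j \<longleftrightarrow> 3+b dvd j" by (rule dvd_add_right_iff) simp
  ultimately show ?thesis unfolding r_def'[OF assms] by simp
qed

text \<open>The exponents are periodic with period \<open>K\<close>, so the identity for all blocks reduces to one between monomials
in indeterminates \<open>X 1, ..., X K\<close>.\<close>

lemma (in q_disc) residue_blocksI:
  assumes B: "B > 0" "int K = 3 + B" and r: "\<And>i. r 3 B i \<in> {0, 1, 2}"
    and X: "\<And>X :: nat \<Rightarrow> complex. (\<Prod>j<K. X (Suc j) ^ nat (2 - r 3 B (int (Suc j)))) =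
      (X a * X (K - a)) * (X b * X (K - b)) * (X c * X (K - c)) * (X K)\<^sup>2"
  shows "residue_blocks B K a b c"
proof -
  have p: "r 3 B (int (m*K + j)) = r 3 B (int j)" for m j
    using r_periodic[OF B(1), of "int m" "int j"] B(2) by (simp add: mult.commute)
  have "(1 - q ^ (m*K + Suc j))\<^sup>2 * (1 - q ^ (m*K + Suc j)) powi (- r 3 B (int (Suc j))) =
      (1 - q ^ (m*K + Suc j)) ^ nat (2 - r 3 B (int (Suc j)))" for m j
    by (rule square_powi[OF one_minus_nz r]) simp
  then show ?thesis
    unfolding residue_blocks_def p using X[of "\<lambda>j. 1 - q ^ (_*K + j)"] by (simp only: simp_thms)
qed

lemma r_34: "r 3 4 0 = 0" "r 3 4 1 = 2" "r 3 4 2 = 0" "r 3 4 3 = 1" "r 3 4 4 = 1" "r 3 4 5 = 0" "r 3 4 6 = 2" "r 3 4 7 = 0"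
  by (simp_all add: r_def')

lemma r_34_range: "r 3 4 i \<in> {0, 1, 2}"
proof -
  define j where "j = i mod 7"
  have rj: "r 3 4 i = r 3 4 j" using r_periodic[of 4 "i div 7" j] by (simp add: j_def)
  have "0 \<le> j" "j < 7" unfolding j_def by simp_all
  then have "j = 0 \<or> j = 1 \<or> j = 2 \<or> j = 3 \<or> j = 4 \<or> j = 5 \<or> j = 6"
    by presburger
  with rj show ?thesis by (auto simp: r_34)
qed

lemma lessThan_7: "{..<7::nat} = {0, 1, 2, 3, 4, 5, 6}"
  by (auto; presburger)

lemma (in q_disc) block_34: "residue_blocks 4 7 3 2 2"
  by (rule residue_blocksI)
     (use r_34_range in \<open>simp_all add: lessThan_7 r_34 numeral_2_eq_2[symmetric] mult_ac power2_eq_square\<close>)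

lemma r_35: "r 3 5 0 = 0" "r 3 5 1 = 2" "r 3 5 2 = 1" "r 3 5 3 = 0" "r 3 5 4 = 2" "r 3 5 5 = 0" "r 3 5 6 = 1" "r 3 5 7 = 2" "r 3 5 8 = 0"
  by (simp_all add: r_def')

lemma r_35_range: "r 3 5 i \<in> {0, 1, 2}"
proof -
  define j where "j = i mod 8"
  have rj: "r 3 5 i = r 3 5 j" using r_periodic[of 5 "i div 8" j] by (simp add: j_def)
  have "0 \<le> j" "j < 8" unfolding j_def by simp_all
  then have "j = 0 \<or> j = 1 \<or> j = 2 \<or> j = 3 \<or> j = 4 \<or> j = 5 \<or> j = 6 \<or> j = 7"
    by presburger
  with rj show ?thesis by (auto simp: r_35)
qed

lemma lessThan_8: "{..<8::nat} = {0, 1, 2, 3, 4, 5, 6, 7}"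
  by (auto; presburger)

lemma (in q_disc) block_35: "residue_blocks 5 8 2 3 3"
  by (rule residue_blocksI)
     (use r_35_range in \<open>simp_all add: lessThan_8 r_35 numeral_2_eq_2[symmetric] mult_ac power2_eq_square\<close>)

lemma r_37: "r 3 7 0 = 0" "r 3 7 1 = 2" "r 3 7 2 = 2" "r 3 7 3 = 0" "r 3 7 4 = 1" "r 3 7 5 = 2" "r 3 7 6 = 1" "r 3 7 7 = 0" "r 3 7 8 = 2" "r 3 7 9 = 2" "r 3 7 10 = 0"
  by (simp_all add: r_def')

lemma r_37_range: "r 3 7 i \<in> {0, 1, 2}"
proof -
  define j where "j = i mod 10"
  have rj: "r 3 7 i = r 3 7 j" using r_periodic[of 7 "i div 10" j] by (simp add: j_def)
  have "0 \<le> j" "j < 10" unfolding j_def by simp_all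
  then have "j = 0 \<or> j = 1 \<or> j = 2 \<or> j = 3 \<or> j = 4 \<or> j = 5 \<or> j = 6 \<or> j = 7 \<or> j = 8 \<or> j = 9"
    by presburger
  with rj show ?thesis by (auto simp: r_37)
qed

lemma lessThan_10: "{..<10::nat} = {0, 1, 2, 3, 4, 5, 6, 7, 8, 9}"
  by (auto; presburger)

lemma (in q_disc) block_37: "residue_blocks 7 10 4 3 3"
  by (rule residue_blocksI)
     (use r_37_range in \<open>simp_all add: lessThan_10 r_37 numeral_2_eq_2[symmetric] mult_ac power2_eq_square\<close>)

lemma r_38: "r 3 8 0 = 0" "r 3 8 1 = 2" "r 3 8 2 = 2" "r 3 8 3 = 1" "r 3 8 4 = 0" "r 3 8 5 = 2" "r 3 8 6 = 2" "r 3 8 7 = 0" "r 3 8 8 = 1" "r 3 8 9 = 2" "r 3 8 10 = 2" "r 3 8 11 = 0"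
  by (simp_all add: r_def')

lemma r_38_range: "r 3 8 i \<in> {0, 1, 2}"
proof -
  define j where "j = i mod 11"
  have rj: "r 3 8 i = r 3 8 j" using r_periodic[of 8 "i div 11" j] by (simp add: j_def)
  have "0 \<le> j" "j < 11" unfolding j_def by simp_all
  then have "j = 0 \<or> j = 1 \<or> j = 2 \<or> j = 3 \<or> j = 4 \<or> j = 5 \<or> j = 6 \<or> j = 7 \<or> j = 8 \<or> j = 9 \<or> j = 10"
    by presburger
  with rj show ?thesis by (auto simp: r_38)
qed

lemma lessThan_11: "{..<11::nat} = {0, 1, 2, 3, 4, 5, 6, 7, 8, 9, 10}"
  by (auto; presburger)

lemma (in q_disc) block_38: "residue_blocks 8 11 3 4 4"
  by (rule residue_blocksI)
     (use r_38_range in \<open>simp_all add: lessThan_11 r_38 numeral_2_eq_2[symmetric] mult_ac power2_eq_square\<close>)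

lemma (in q_disc) Z_eq_P_cases:
  assumes "b \<in> {4, 5, 7, 8}"
  shows "Z 3 b q = P 3 b q"
proof -
  have "Z 3 4 q = P 3 4 q"
    by (rule Z_eq_P[OF dominated_by_34 _ _ r_34_range block_34 _ Zsum_34]) simp_all
  moreover have "Z 3 5 q = P 3 5 q"
    by (rule Z_eq_P[OF dominated_by_35 _ _ r_35_range block_35 _ Zsum_35]) simp_all
  moreover have "Z 3 7 q = P 3 7 q"
    by (rule Z_eq_P[OF dominated_by_37 _ _ r_37_range block_37 _ Zsum_37]) simp_all
  moreover have "Z 3 8 q = P 3 8 q"
    by (rule Z_eq_P[OF dominated_by_38 _ _ r_38_range block_38 _ Zsum_38]) simp_all
  ultimately show ?thesis using assms by auto
qed

lemma dominated_by_cases: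
  assumes "b \<in> {4, 5, 7, 8}"
  obtains t where "dominated_by b t"
  using assms dominated_by_34 dominated_by_35 dominated_by_37 dominated_by_38 by auto

lemma Z_eq_P_at_0:
  assumes "dominated_by b t"
  shows "Zterm 3 b 0 summable_on gap_vectors 3 b" "Z 3 b 0 = P 3 b 0"
proof -
  let ?z = "\<lambda>_. 0 :: int"
  have z: "?z \<in> gap_vectors 3 b" by (simp add: gap_vectors_def)
  have e: "Zterm 3 b 0 n = of_bool (n = ?z)" if "n \<in> gap_vectors 3 b" for n
    by (rule Zterm_q_0[OF assms that])
  show "Zterm 3 b 0 summable_on gap_vectors 3 b"
  proof (rule finite_nonzero_values_imp_summable_on)
    have "{n \<in> gap_vectors 3 b. Zterm 3 b 0 n \<noteq> 0} \<subseteq> {?z}" using e by auto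
    then show "finite {n \<in> gap_vectors 3 b. Zterm 3 b 0 n \<noteq> 0}" by (rule finite_subset) simp
  qed
  have "Z 3 b 0 = infsum (Zterm 3 b 0) {?z}"
    unfolding Z_def by (rule infsum_cong_neutral) (use z e in auto)
  also have "\<dots> = 1" using e[OF z] by simp
  finally show "Z 3 b 0 = P 3 b 0" by (simp add: P_def)
qed

theorem theorem3:
  fixes b :: int and q :: complex
  assumes "b \<in> {4, 5, 7, 8}" and "norm q < 1"
  shows "Zterm 3 b q summable_on gap_vectors 3 b \<and> Z 3 b q = P 3 b q"
proof -
  obtain t where t: "dominated_by b t" using assms(1) by (rule dominated_by_cases)
  show ?thesis
  proof (cases "q = 0")
    case True
    then show ?thesis using Z_eq_P_at_0[OF t] by simp
  next
    case False
    then interpret q_disc q using assms(2) by unfold_locales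
    show ?thesis
      using Infinite_Sum.abs_summable_summable[OF Zterm_norm_summable[OF t]] Z_eq_P_cases[OF assms(1)] by simp
  qed
qed

end
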